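(* Let $k$ be a positive integer, $p\ge2$, $\eta>-1$, and let $(\alpha_0,\ldots,\alpha_k)\in\mathbb R^{k+1}$ satisfy $\alpha_k-kp+1=0$ and $\alpha_i\ge\alpha_k-(k-i)p$ for all $i=1,\ldots,k$. Let $\gamma=(2p-1+(p-1)\eta)/p$ and let $\theta\in\mathbb R$ satisfy $\theta+2>\gamma$ and $\theta>\lfloor\frac k2\rfloor(\theta+2-\gamma)-1$. Set $\nu=\alpha_k+\lfloor\frac k2\rfloor(\theta-\gamma)p$, and let $\beta_{0,k}$ be the constant given in the context. Then for any $\tau>0$ there exists a constant $C_\tau>0$ such that $$\sup\left\{\int_0^\infty\exp_p\left(\beta_{0,k}|u|^{\frac p{p-1}}\right)r^\eta\,dr\;:\;u\in X^{k,p}_\infty(\alpha_0,\ldots,\alpha_k),\ \|\nabla^k_Lu\|^p_{L^p_\nu}+\tau\|u\|^p_{L^p_\eta}\le1\right\}\le C_\tau.$$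
   Context: For $p\ge1$ and $\alpha\in\mathbb R$, $\|u\|_{L^p_\alpha}=\left(\int_0^\infty|u|^pr^\alpha\,dr\right)^{1/p}$, and $L^p_\alpha$ is the space of measurable $u:(0,\infty)\to\mathbb R$ with finite such norm. $X^{k,p}_\infty(\alpha_0,\ldots,\alpha_k)$ is the space of functions $u:(0,\infty)\to\mathbb R$ whose weak derivatives satisfy $u^{(j)}\in L^p_{\alpha_j}$ for $j=0,\ldots,k$ (so $u^{(k-1)}$ is locally absolutely continuous on $(0,\infty)$). $L_{\theta,\gamma}u=-r^{-\theta}(r^\gamma u')'$; $\nabla^k_Lu=L_{\theta,\gamma}^{k/2}u$ if $k$ is even and $\nabla_L^ku=(L_{\theta,\gamma}^{(k-1)/2}u)'$ if $k$ is odd. For real $p>1$ and $t\ge0$, $\exp_p(t):=\sum_{j=0}^\infty\frac{t^{p-1+j}}{\Gamma(p+j)}$. The constant $\beta_{0,k}$ is $$\beta_{0,k}=\begin{cases}(\eta+1)\left[(\gamma-1)(\theta+2-\gamma)^{k-2}\dfrac{\Gamma\left(\frac k2\right)\Gamma\left(\frac{\gamma-1}{\theta+2-\gamma}\right)}{\Gamma\left(\frac{\gamma-1}{\theta+2-\gamma}-\frac{k-2}2\right)}\right]^{\frac p{p-1}}&\text{if }k\text{ is even},\\[4mm](\eta+1)\left[(\gamma-1)(\theta+2-\gamma)^{k-2}\dfrac{\Gamma\left(\frac{k+1}2\right)\Gamma\left(\frac{\gamma-1}{\theta+2-\gamma}\right)}{\Gamma\left(\frac{\gamma-1}{\theta+2-\gamma}-\frac{k-3}2\right)}\right]^{\frac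 p{p-1}}&\text{if }k\text{ is odd}.\end{cases}$$ *)

theory Defs
  imports "HOL-Analysis.Analysis"
begin

text \<open>
  A function on \<open>(0,\<infinity>)\<close> is represented by a total function on the reals; only its values on
  \<open>{0<..}\<close> are ever used. Integrals that may diverge take values in \<open>ennreal\<close>, because the
  Bochner integral of a non-integrable function is \<open>0\<close> and would admit functions of infinite norm.
\<close>

abbreviation halfline :: "real measure" where
  "halfline \<equiv> lebesgue_on {0<..}"

text \<open>Only used for exponents \<open>a > 0\<close>.\<close>

definition epowr :: "ennreal \<Rightarrow> real \<Rightarrow> ennreal" where
  "epowr x a = (if x = top then top else ennreal (enn2real x powr a))"

definition Lp_norm :: "real \<Rightarrow> real \<Rightarrow> (real \<Rightarrow> real) \<Rightarrow> ennreal" where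
  "Lp_norm p \<alpha> u = epowr (\<integral>\<^sup>+ r. ennreal (\<bar>u r\<bar> powr p * r powr \<alpha>) \<partial>halfline) (1 / p)"

definition Lp_space :: "real \<Rightarrow> real \<Rightarrow> (real \<Rightarrow> real) set" where
  "Lp_space p \<alpha> = {u. u \<in> borel_measurable halfline \<and> Lp_norm p \<alpha> u < top}"

definition test_function :: "(real \<Rightarrow> real) \<Rightarrow> bool" where
  "test_function \<phi> \<longleftrightarrow>
     (\<forall>n x. (deriv ^^ n) \<phi> differentiable (at x)) \<and>
     compact (closure {x. \<phi> x \<noteq> 0}) \<and> closure {x. \<phi> x \<noteq> 0} \<subseteq> {0<..}"

definition locally_integrable :: "(real \<Rightarrow> real) \<Rightarrow> bool" where
  "locally_integrable u \<longleftrightarrow>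
     (\<forall>K. compact K \<longrightarrow> K \<subseteq> {0<..} \<longrightarrow> set_integrable lebesgue K u)"

definition has_weak_deriv :: "nat \<Rightarrow> (real \<Rightarrow> real) \<Rightarrow> (real \<Rightarrow> real) \<Rightarrow> bool" where
  "has_weak_deriv n u v \<longleftrightarrow>
     locally_integrable u \<and> locally_integrable v \<and>
     (\<forall>\<phi>. test_function \<phi> \<longrightarrow>
        (\<integral>r. u r * (deriv ^^ n) \<phi> r \<partial>halfline) = (- 1) ^ n * (\<integral>r. v r * \<phi> r \<partial>halfline))"

text \<open>
  Weak derivatives are unique up to null sets of \<open>(0,\<infinity>)\<close>, and everything below depends only on
  the almost-everywhere class, so the representative chosen here is immaterial. The value is
  meaningful only if a weak derivative exists.
\<close>

definition weak_deriv :: "(real \<Rightarrow> real) \<Rightarrow> real \<Rightarrow> real" where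
  "weak_deriv u = (SOME v. has_weak_deriv 1 u v)"

definition X_space :: "nat \<Rightarrow> real \<Rightarrow> (nat \<Rightarrow> real) \<Rightarrow> (real \<Rightarrow> real) set" where
  "X_space k p \<alpha> = {u. \<forall>j\<le>k. \<exists>v. has_weak_deriv j u v \<and> v \<in> Lp_space p (\<alpha> j)}"

definition L_op :: "real \<Rightarrow> real \<Rightarrow> (real \<Rightarrow> real) \<Rightarrow> real \<Rightarrow> real" where
  "L_op \<theta> \<gamma> u = (\<lambda>r. - (r powr (- \<theta>)) * weak_deriv (\<lambda>s. s powr \<gamma> * weak_deriv u s) r)"

definition L_grad :: "real \<Rightarrow> real \<Rightarrow> nat \<Rightarrow> (real \<Rightarrow> real) \<Rightarrow> real \<Rightarrow> real" where
  "L_grad \<theta> \<gamma> k u =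
     (if even k then (L_op \<theta> \<gamma> ^^ (k div 2)) u
      else weak_deriv ((L_op \<theta> \<gamma> ^^ ((k - 1) div 2)) u))"

definition exp_p :: "real \<Rightarrow> real \<Rightarrow> real" where
  "exp_p p t = (\<Sum>j. t powr (p - 1 + real j) / Gamma (p + real j))"

definition beta0 :: "nat \<Rightarrow> real \<Rightarrow> real \<Rightarrow> real \<Rightarrow> real \<Rightarrow> real" where
  "beta0 k p \<eta> \<theta> \<gamma> =
     (if even k then
        (\<eta> + 1) *
        ((\<gamma> - 1) * (\<theta> + 2 - \<gamma>) powi (int k - 2) *
          (Gamma (real k / 2) * Gamma ((\<gamma> - 1) / (\<theta> + 2 - \<gamma>)) /
           Gamma ((\<gamma> - 1) / (\<theta> + 2 - \<gamma>) - (real k - 2) / 2))) powr (p / (p - 1))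
      else
        (\<eta> + 1) *
        ((\<gamma> - 1) * (\<theta> + 2 - \<gamma>) powi (int k - 2) *
          (Gamma ((real k + 1) / 2) * Gamma ((\<gamma> - 1) / (\<theta> + 2 - \<gamma>)) /
           Gamma ((\<gamma> - 1) / (\<theta> + 2 - \<gamma>) - (real k - 3) / 2))) powr (p / (p - 1)))"

end

theory Submission
  imports Defs
begin

text \<open>
  Write \<open>D = r d/dr\<close>, \<open>\<delta> = \<theta> + 2 - \<gamma>\<close>, \<open>q = p/(p - 1)\<close>, and \<open>N(g)\<close> for the integral of \<open>|g|^p\<close> against the
  scale-invariant measure \<open>dr/r\<close>. The weights of the theorem are the ones that make everything
  homogeneous in \<open>r\<close>, so the problem is one-dimensional in the variable \<open>log r\<close>. Since
  \<open>L u = - r^(-\<delta>) D (D + \<gamma> - 1) u\<close>, the function \<open>r^(i \<delta>) L^i u\<close> arises from \<open>D u = r u'\<close> by applying,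
  up to sign, alternately the factors \<open>D + (\<gamma> - 1 - i \<delta>)\<close> and \<open>D - (i + 1) \<delta>\<close>, and the \<open>p\<close>-th power
  of the norm of \<open>\<nabla>^k u\<close> in the theorem is \<open>N\<close> of the result.

  Each first-order factor costs exactly its constant: \<open>N(D g + c g) \<ge> |c|^p N(g)\<close>
  (\<open>hardy_log\<close>). Indeed, by convexity \<open>|x + y|^p \<ge> |x|^p + p |x|^(p-2) x y\<close>; for \<open>x = c g\<close> and
  \<open>y = D g\<close> the mixed term is a total derivative, and its boundary values vanish along suitable
  sequences because \<open>N(g)\<close> is finite. Multiplying the constants gives
  \<open>N(final) \<ge> A^p N(r u')\<close> with an explicit product \<open>A\<close> (\<open>L_grad_log_energy\<close>), and evaluating
  the product by the Gamma function gives \<open>\<beta>\<^sub>0 = (\<eta> + 1) A^q\<close> (\<open>beta0_eq_rellich_const\<close>). Thus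
  \<open>W = A u\<close> satisfies the hypothesis of the case \<open>k = 1\<close> with \<open>\<tau> / A^p\<close> in place of \<open>\<tau>\<close>, and the
  exponentials are the same.

  The case \<open>k = 1\<close> (\<open>first_order_inequality\<close>) is a critical inequality of Moser and Ruf type. Pick
  \<open>R\<close> between \<open>1\<close> and \<open>e\<close> where \<open>|W(R)|^p\<close> is controlled by the lower order term. Beyond \<open>R\<close> the
  function is bounded, so \<open>exp_p\<close> is dominated by a multiple of \<open>|W|^p\<close>. Before \<open>R\<close>, the jump from
  \<open>0\<close> to \<open>|W(R)|\<close> is spread over a logarithmic interval whose length \<open>L\<close> is chosen such that its
  energy is at most the lower order term; the total energy is then at most \<open>1\<close>, and Moser's
  inequality applies (\<open>moser_near_0\<close>). There, with \<open>s\<close> the logarithmic distance from the start, Hoelder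
  gives \<open>|W|^q \<le> s\<close>, and the point is that the set where \<open>s - |W|^q \<le> \<lambda>\<close> has logarithmic length
  \<open>O(\<lambda>)\<close>: once this gap is small far out, almost no energy is left to keep it small (\<open>moser_gap\<close>).

  Two preparations are needed. Weak derivatives are only determined almost everywhere and are
  chosen arbitrarily, so a weakly differentiable function is first replaced by a genuine primitive
  of its weak derivative (\<open>has_weak_deriv_imp_primitive\<close>), for which the chain rule holds
  (\<open>primitive_of_chain\<close>). And membership in the Sobolev space only says that
  \<open>u^(j)\<close> lies in a weighted space that is too large near the origin; since the top weight is
  the critical one, Hardy's inequality on \<open>(0, 1]\<close> improves this to \<open>N(r^j u^(j)) < \<infinity>\<close> for all
  \<open>j\<close> from \<open>1\<close> to \<open>k\<close> (\<open>X_space_imp_log_regular\<close>).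
\<close>

section \<open>Smooth bumps and test functions\<close>

definition ntimes_diff :: "nat \<Rightarrow> (real \<Rightarrow> real) \<Rightarrow> bool" where
  "ntimes_diff n f \<longleftrightarrow> (\<forall>m<n. \<forall>x. (deriv ^^ m) f differentiable (at x))"

lemma ntimes_diff_0 [simp]: "ntimes_diff 0 f"
  by (simp add: ntimes_diff_def)

lemma ntimes_diff_Suc:
  "ntimes_diff (Suc n) f \<longleftrightarrow> (\<forall>x. f differentiable (at x)) \<and> ntimes_diff n (deriv f)"
  unfolding ntimes_diff_def
  by (subst All_less_Suc2) (simp add: funpow_Suc_right del: funpow.simps)

lemma deriv_eqI: "(\<And>x. (f has_real_derivative f' x) (at x)) \<Longrightarrow> deriv f = f'"
  by (auto intro: DERIV_imp_deriv)

lemma ntimes_diff_SucI: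
  assumes "\<And>x. (f has_real_derivative f' x) (at x)" "ntimes_diff n f'"
  shows "ntimes_diff (Suc n) f"
  using assms deriv_eqI[of f f'] by (auto simp: ntimes_diff_Suc real_differentiable_def)

lemma ntimes_diff_SucE:
  assumes "ntimes_diff (Suc n) f"
  obtains f' where "\<And>x. (f has_real_derivative f' x) (at x)" "ntimes_diff n f'"
  using assms unfolding ntimes_diff_Suc
  by (metis DERIV_deriv_iff_real_differentiable)

lemma ntimes_diff_mono: "ntimes_diff n f \<Longrightarrow> m \<le> n \<Longrightarrow> ntimes_diff m f"
  by (auto simp: ntimes_diff_def)

lemma ntimes_diff_const: "ntimes_diff n (\<lambda>x. c)"
proof (induction n arbitrary: c)
  case (Suc n)
  show ?case by (rule ntimes_diff_SucI[of _ "\<lambda>x. 0"]) (auto intro: Suc)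
qed auto

lemma ntimes_diff_add: "ntimes_diff n f \<Longrightarrow> ntimes_diff n g \<Longrightarrow> ntimes_diff n (\<lambda>x. f x + g x)"
proof (induction n arbitrary: f g)
  case (Suc n)
  from Suc.prems obtain f' g' where
    "\<And>x. (f has_real_derivative f' x) (at x)" "ntimes_diff n f'"
    "\<And>x. (g has_real_derivative g' x) (at x)" "ntimes_diff n g'"
    by (metis ntimes_diff_SucE)
  then show ?case
    by (intro ntimes_diff_SucI[of _ "\<lambda>x. f' x + g' x"] Suc.IH DERIV_add)
qed auto

lemma ntimes_diff_mult: "ntimes_diff n f \<Longrightarrow> ntimes_diff n g \<Longrightarrow> ntimes_diff n (\<lambda>x. f x * g x)"
proof (induction n arbitrary: f g)
  case (Suc n)
  from Suc.prems obtain f' g' where d: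
    "\<And>x. (f has_real_derivative f' x) (at x)" "ntimes_diff n f'"
    "\<And>x. (g has_real_derivative g' x) (at x)" "ntimes_diff n g'"
    by (metis ntimes_diff_SucE)
  have "ntimes_diff n f" "ntimes_diff n g"
    using Suc.prems ntimes_diff_mono by auto
  then show ?case using d
    by (intro ntimes_diff_SucI[of _ "\<lambda>x. f' x * g x + g' x * f x"] ntimes_diff_add Suc.IH DERIV_mult)
qed auto

lemma ntimes_diff_affine: "ntimes_diff n f \<Longrightarrow> ntimes_diff n (\<lambda>x. f (c * x + d))"
proof (induction n arbitrary: f)
  case (Suc n)
  from Suc.prems obtain f' where d:
    "\<And>x. (f has_real_derivative f' x) (at x)" "ntimes_diff n f'"
    by (metis ntimes_diff_SucE)
  have "((\<lambda>x. f (c * x + d)) has_real_derivative f' (c * x + d) * c) (at x)" for x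
  proof -
    have "((\<lambda>x. c * x + d) has_real_derivative c) (at x)"
      by (auto intro!: derivative_eq_intros)
    then show ?thesis using d(1) by (rule DERIV_chain2[rotated])
  qed
  then show ?case using d
    using ntimes_diff_SucI[of "\<lambda>x. f (c * x + d)" "\<lambda>x. f' (c * x + d) * c" n]
      ntimes_diff_mult[OF Suc.IH[OF d(2)] ntimes_diff_const] by blast
qed auto

definition smooth :: "(real \<Rightarrow> real) \<Rightarrow> bool" where
  "smooth f \<longleftrightarrow> (\<forall>n. ntimes_diff n f)"

lemma smooth_iff: "smooth f \<longleftrightarrow> (\<forall>n x. (deriv ^^ n) f differentiable (at x))"
  unfolding smooth_def ntimes_diff_def by blast

lemma smooth_unfold: "smooth f \<longleftrightarrow> (\<forall>x. f differentiable (at x)) \<and> smooth (deriv f)"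
  unfolding smooth_def by (metis ntimes_diff_Suc ntimes_diff_mono le_SucI order_refl)

lemma smooth_has_deriv: "smooth f \<Longrightarrow> (f has_real_derivative deriv f x) (at x)"
  using smooth_unfold DERIV_deriv_iff_real_differentiable by blast

lemma smooth_deriv: "smooth f \<Longrightarrow> smooth (deriv f)"
  using smooth_unfold by blast

lemma smooth_const: "smooth (\<lambda>x. c)"
  unfolding smooth_def using ntimes_diff_const by (rule allI)

lemma smooth_add: "smooth f \<Longrightarrow> smooth g \<Longrightarrow> smooth (\<lambda>x. f x + g x)"
  unfolding smooth_def by (intro allI ntimes_diff_add) simp_all

lemma smooth_mult: "smooth f \<Longrightarrow> smooth g \<Longrightarrow> smooth (\<lambda>x. f x * g x)"
  unfolding smooth_def by (intro allI ntimes_diff_mult) simp_all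

lemma smooth_affine: "smooth f \<Longrightarrow> smooth (\<lambda>x. f (a * x + b))"
  using ntimes_diff_affine[of _ f a b] unfolding smooth_def by simp

lemma smooth_continuous: "smooth f \<Longrightarrow> continuous_on S f"
  by (intro continuous_at_imp_continuous_on ballI DERIV_isCont[OF smooth_has_deriv])

lemma poly_div_exp_tendsto_0:
  fixes P :: "real poly"
  shows "((\<lambda>y. poly P y * exp (- y)) \<longlongrightarrow> 0) at_top"
proof -
  have "((\<lambda>y. \<Sum>i\<le>degree P. coeff P i * (y ^ i / exp y)) \<longlongrightarrow> (\<Sum>i\<le>degree P. coeff P i * 0)) at_top"
    by (intro tendsto_intros tendsto_power_div_exp_0)
  then show ?thesis
    by (simp add: poly_altdef sum_divide_distrib exp_minus field_simps)
qed

text \<open>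
  The family \<open>P(1/x) exp(-1/x)\<close>, extended by \<open>0\<close>, is closed under differentiation, which makes its
  members smooth; the polynomial \<open>P = 1\<close> gives the usual flat function.
\<close>

definition flat_at_0 :: "real poly \<Rightarrow> real \<Rightarrow> real" where
  "flat_at_0 P x = (if 0 < x then poly P (1 / x) * exp (- (1 / x)) else 0)"

lemma flat_at_0_has_deriv:
  "(flat_at_0 P has_real_derivative flat_at_0 ([:0, 0, 1:] * (P - pderiv P)) x) (at x)"
proof -
  consider "x > 0" | "x < 0" | "x = 0" by linarith
  then show ?thesis
  proof cases
    case 1
    have inv: "((\<lambda>x. 1 / x) has_real_derivative - (1 / x\<^sup>2)) (at x)"
      using 1 by (auto intro!: derivative_eq_intros simp: power2_eq_square)
    have "((\<lambda>x. poly P (1 / x) * exp (- (1 / x))) has_real_derivative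
        poly (pderiv P) (1 / x) * (- (1 / x\<^sup>2)) * exp (- (1 / x)) +
        exp (- (1 / x)) * (- (- (1 / x\<^sup>2))) * poly P (1 / x)) (at x)"
      by (intro DERIV_mult DERIV_chain2[OF poly_DERIV inv] DERIV_chain2[OF DERIV_exp] DERIV_minus inv)
    also have "poly (pderiv P) (1 / x) * (- (1 / x\<^sup>2)) * exp (- (1 / x)) +
        exp (- (1 / x)) * (- (- (1 / x\<^sup>2))) * poly P (1 / x) =
        flat_at_0 ([:0, 0, 1:] * (P - pderiv P)) x"
      using 1 by (simp add: flat_at_0_def power2_eq_square) (simp add: field_simps)
    finally have "((\<lambda>x. poly P (1 / x) * exp (- (1 / x))) has_real_derivative
        flat_at_0 ([:0, 0, 1:] * (P - pderiv P)) x) (at x)" .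
    then show ?thesis
      by (rule has_field_derivative_transform_within[where d = x])
        (use 1 in \<open>auto simp: dist_real_def flat_at_0_def\<close>)
  next
    case 2
    have "((\<lambda>x. 0) has_real_derivative flat_at_0 ([:0, 0, 1:] * (P - pderiv P)) x) (at x)"
      using 2 by (auto simp: flat_at_0_def)
    then show ?thesis
      by (rule has_field_derivative_transform_within[where d = "-x"])
        (use 2 in \<open>auto simp: dist_real_def flat_at_0_def\<close>)
  next
    case 3
    have "((\<lambda>h. poly (pCons 0 P) (1 / h) * exp (- (1 / h))) \<longlongrightarrow> 0) (at_right 0)"
      by (rule filterlim_compose[OF poly_div_exp_tendsto_0])
        (simp add: filterlim_inverse_at_top_right flip: inverse_eq_divide)
    then have "((\<lambda>h. flat_at_0 P h / h) \<longlongrightarrow> 0) (at_right 0)"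
      by (rule Lim_transform_eventually)
        (auto simp: flat_at_0_def eventually_at_right_less intro!: eventually_at_rightI[of 0 1])
    moreover have "((\<lambda>h. flat_at_0 P h / h) \<longlongrightarrow> 0) (at_left 0)"
      by (rule Lim_transform_eventually[of "\<lambda>x. 0"])
        (auto simp: flat_at_0_def intro!: eventually_at_leftI[of "-1"])
    ultimately have "((\<lambda>h. flat_at_0 P h / h) \<longlongrightarrow> 0) (at 0)"
      by (simp add: filterlim_split_at_real)
    then show ?thesis
      unfolding 3 DERIV_def by (simp add: flat_at_0_def)
  qed
qed

lemma smooth_flat_at_0: "smooth (flat_at_0 P)"
proof -
  have "ntimes_diff n (flat_at_0 P)" for n
  proof (induction n arbitrary: P)
    case (Suc n)
    show ?case by (rule ntimes_diff_SucI[OF flat_at_0_has_deriv Suc.IH])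
  qed auto
  then show ?thesis by (simp add: smooth_def)
qed

lemma test_functionI:
  assumes "smooth \<phi>" "0 < a" "\<And>x. x \<notin> {a..b} \<Longrightarrow> \<phi> x = 0"
  shows "test_function \<phi>"
proof -
  have "{x. \<phi> x \<noteq> 0} \<subseteq> {a..b}" using assms(3) by blast
  then have *: "closure {x. \<phi> x \<noteq> 0} \<subseteq> {a..b}"
    by (simp add: closure_minimal)
  then have "compact (closure {x. \<phi> x \<noteq> 0})"
    by (meson bounded_closed_interval bounded_subset closed_closure compact_eq_bounded_closed)
  then show ?thesis using * assms smooth_iff
    by (auto simp: test_function_def)
qed

lemma test_functionD:
  assumes "test_function \<phi>"
  shows "smooth \<phi>" and "\<exists>a b. 0 < a \<and> a \<le> b \<and> (\<forall>x. x \<notin> {a..b} \<longrightarrow> \<phi> x = 0)"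
proof -
  let ?K = "closure {x. \<phi> x \<noteq> 0}"
  show "smooth \<phi>" using assms smooth_iff by (auto simp: test_function_def)
  show "\<exists>a b. 0 < a \<and> a \<le> b \<and> (\<forall>x. x \<notin> {a..b} \<longrightarrow> \<phi> x = 0)"
  proof (cases "?K = {}")
    case True
    then have "\<phi> x = 0" for x by simp
    then show ?thesis by (intro exI[of _ 1]) auto
  next
    case False
    have K: "compact ?K" "?K \<subseteq> {0<..}" using assms by (auto simp: test_function_def)
    obtain a b where "a \<in> ?K" "\<forall>x\<in>?K. a \<le> x" "b \<in> ?K" "\<forall>x\<in>?K. x \<le> b"
      using compact_attains_inf[OF K(1) False] compact_attains_sup[OF K(1) False] by blast
    then have "0 < a" "a \<le> b" "\<forall>x. x \<notin> {a..b} \<longrightarrow> \<phi> x = 0"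
      using K(2) closure_subset[of "{x. \<phi> x \<noteq> 0}"] by auto
    then show ?thesis by blast
  qed
qed

lemma deriv_eq_0_outside:
  assumes "\<And>x. x \<notin> {a..b} \<Longrightarrow> \<phi> x = 0" and x: "x \<notin> {a..b}"
  shows "deriv \<phi> x = (0::real)"
proof -
  have "((\<lambda>x. 0) has_real_derivative 0) (at x)" by simp
  then have "(\<phi> has_real_derivative 0) (at x)"
    by (rule has_field_derivative_transform_within_open[where S = "- {a..b}"])
      (use assms in \<open>auto simp: closed_real_atLeastAtMost open_Compl\<close>)
  then show ?thesis by (rule DERIV_imp_deriv)
qed

lemma test_function_deriv:
  assumes "test_function \<phi>" shows "test_function (deriv \<phi>)"
proof -
  obtain a b where "0 < a" "a \<le> b" "\<forall>x. x \<notin> {a..b} \<longrightarrow> \<phi> x = 0"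
    using test_functionD[OF assms] by blast
  then show ?thesis
    by (intro test_functionI[of _ a b] smooth_deriv test_functionD(1)[OF assms] deriv_eq_0_outside) auto
qed

lemma test_function_lincomb:
  assumes "test_function \<phi>" "test_function \<psi>"
  shows "test_function (\<lambda>x. \<phi> x + c * \<psi> x)"
proof -
  obtain a b where 1: "0 < a" "a \<le> b" "\<forall>x. x \<notin> {a..b} \<longrightarrow> \<phi> x = 0"
    using test_functionD[OF assms(1)] by blast
  obtain a' b' where 2: "0 < a'" "a' \<le> b'" "\<forall>x. x \<notin> {a'..b'} \<longrightarrow> \<psi> x = 0"
    using test_functionD[OF assms(2)] by blast
  have "\<phi> x + c * \<psi> x = 0" if "x \<notin> {min a a'..max b b'}" for x
  proof -
    have "x \<notin> {a..b}" "x \<notin> {a'..b'}" using that by auto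
    then show ?thesis using 1(3) 2(3) by simp
  qed
  moreover have "smooth (\<lambda>x. \<phi> x + c * \<psi> x)"
    by (rule smooth_add[OF test_functionD(1)[OF assms(1)]
          smooth_mult[OF smooth_const test_functionD(1)[OF assms(2)]]])
  ultimately show ?thesis
    using 1(1) 2(1) by (intro test_functionI[of _ "min a a'" "max b b'"]) auto
qed

text \<open>
  The antiderivative vanishing at \<open>a\<close> is constant on both sides of the support, and the mean value
  zero makes it vanish on the right as well.
\<close>

lemma test_function_antideriv:
  assumes \<psi>: "test_function \<psi>" and ab: "0 < a" "a \<le> b" "\<And>x. x \<notin> {a..b} \<Longrightarrow> \<psi> x = 0"
    and 0: "integral {a..b} \<psi> = 0"
  shows "\<exists>\<phi>. test_function \<phi> \<and> deriv \<phi> = \<psi>"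
proof -
  have sm: "smooth \<psi>" by (rule test_functionD(1)[OF \<psi>])
  have cont: "continuous_on S \<psi>" for S by (rule smooth_continuous[OF sm])
  have "\<exists>\<phi>. \<forall>x. - \<infinity> < ereal x \<longrightarrow> ereal x < \<infinity> \<longrightarrow> (\<phi> has_vector_derivative \<psi> x) (at x)"
  proof (rule einterval_antiderivative)
    show "isCont \<psi> x" for x
      using cont[of UNIV] by (simp add: continuous_on_eq_continuous_at)
  qed simp
  then obtain \<phi> where \<phi>: "\<And>x. (\<phi> has_real_derivative \<psi> x) (at x)"
    by (auto simp: has_real_derivative_iff_has_vector_derivative)
  define \<Phi> where "\<Phi> x = \<phi> x - \<phi> a" for x
  have d: "(\<Phi> has_real_derivative \<psi> x) (at x)" for x
    unfolding \<Phi>_def using DERIV_diff[OF \<phi> DERIV_const] by simp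
  have i: "(\<psi> has_integral \<Phi> y - \<Phi> x) {x..y}" if "x \<le> y" for x y
  proof (rule fundamental_theorem_of_calculus[OF that])
    fix t show "(\<Phi> has_vector_derivative \<psi> t) (at t within {x..y})"
      using has_field_derivative_at_within[OF d]
      by (simp add: has_real_derivative_iff_has_vector_derivative)
  qed
  have flat: "\<Phi> y = \<Phi> x" if "x \<le> y" "{x<..<y} \<inter> {a..b} = {}" for x y
  proof -
    have "(\<psi> has_integral 0) {x..y}"
    proof (rule has_integral_spike_finite[of "{x, y}" _ \<psi> "\<lambda>x. 0"])
      fix t assume "t \<in> {x..y} - {x, y}"
      then have "t \<in> {x<..<y}" by auto
      then show "\<psi> t = 0" using that(2) ab(3) by blast
    qed simp_all
    then have "\<Phi> y - \<Phi> x = 0" by (rule has_integral_unique[OF i[OF that(1)]])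
    then show ?thesis by simp
  qed
  have \<Phi>a: "\<Phi> a = 0" by (simp add: \<Phi>_def)
  have \<Phi>b: "\<Phi> b = 0" using integral_unique[OF i[OF ab(2)]] 0 \<Phi>a by linarith
  have z: "\<Phi> x = 0" if "x \<notin> {a..b}" for x
  proof (cases "x < a")
    case True
    then have "{x<..<a} \<inter> {a..b} = {}" by auto
    then show ?thesis using flat[of x a] \<Phi>a True by simp
  next
    case False
    then have "b \<le> x" "{b<..<x} \<inter> {a..b} = {}" using that by auto
    then show ?thesis using flat[of b x] \<Phi>b by simp
  qed
  have "deriv \<Phi> = \<psi>" by (rule deriv_eqI[OF d])
  moreover have "smooth \<Phi>"
    unfolding smooth_unfold[of \<Phi>] \<open>deriv \<Phi> = \<psi>\<close> real_differentiable_def using d sm by blast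
  ultimately show ?thesis
    using test_functionI[where \<phi> = \<Phi>, OF _ ab(1) z] by blast
qed

text \<open>
  Rescaling the two flat factors instead of mollifying an indicator gives functions of explicit form
  that take values in \<open>[0, 1]\<close> and converge pointwise to the indicator of \<open>(a, b)\<close>, so that dominated
  convergence recovers integrals over intervals from pairings with test functions.
\<close>

definition bump :: "real \<Rightarrow> real \<Rightarrow> nat \<Rightarrow> real \<Rightarrow> real" where
  "bump a b n x = flat_at_0 1 (real (Suc n) * (x - a)) * flat_at_0 1 (real (Suc n) * (b - x))"

lemma test_function_bump: "0 < a \<Longrightarrow> test_function (bump a b n)"
proof (rule test_functionI[of _ a b])
  have "bump a b n = (\<lambda>x. flat_at_0 1 (real (Suc n) * x + (- real (Suc n) * a)) *
     flat_at_0 1 ((- real (Suc n)) * x + (real (Suc n) * b)))"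
    unfolding bump_def by (intro ext) (simp add: algebra_simps)
  then show "smooth (bump a b n)"
    by (simp only:) (rule smooth_mult[OF smooth_affine smooth_affine, OF smooth_flat_at_0 smooth_flat_at_0])
qed (auto simp: bump_def flat_at_0_def zero_less_mult_iff)

lemma bump_bounds: "0 \<le> bump a b n x" "bump a b n x \<le> 1"
  by (auto simp: bump_def flat_at_0_def intro!: mult_le_one)

lemma bump_pos: "a < x \<Longrightarrow> x < b \<Longrightarrow> 0 < bump a b n x"
  by (auto simp: bump_def flat_at_0_def zero_less_mult_iff)

lemma bump_outside: "x \<notin> {a<..<b} \<Longrightarrow> bump a b n x = 0"
  by (auto simp: bump_def flat_at_0_def zero_less_mult_iff)

lemma bump_tendsto: "(\<lambda>n. bump a b n x) \<longlonglongrightarrow> indicator {a<..<b} x"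
proof (cases "x \<in> {a<..<b}")
  case True
  have *: "(\<lambda>n. exp (- (1 / (real (Suc n) * c)))) \<longlonglongrightarrow> 1" if "c > 0" for c :: real
  proof -
    have "(\<lambda>n. exp (- (inverse (real (Suc n)) * (1 / c)))) \<longlonglongrightarrow> exp (- (0 * (1 / c)))"
      by (intro tendsto_intros LIMSEQ_inverse_real_of_nat)
    then show ?thesis by (simp add: inverse_eq_divide)
  qed
  have "(\<lambda>n. exp (- (1 / (real (Suc n) * (x - a)))) * exp (- (1 / (real (Suc n) * (b - x))))) \<longlonglongrightarrow> 1 * 1"
    using True by (intro tendsto_mult *) auto
  moreover have "bump a b n x = exp (- (1 / (real (Suc n) * (x - a)))) * exp (- (1 / (real (Suc n) * (b - x))))" for n
    using True unfolding bump_def flat_at_0_def by (simp add: zero_less_mult_iff)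
  ultimately show ?thesis using True by simp
qed (simp add: bump_outside)

section \<open>Uniqueness of weak derivatives\<close>

lemma borel_measurable_ident_halfline [measurable]: "(\<lambda>r. r) \<in> borel_measurable halfline"
  using id_borel_measurable_lebesgue_on by (simp add: id_def)

lemma borel_measurable_indicator_times:
  fixes g :: "real \<Rightarrow> real"
  assumes "A \<in> sets lebesgue" "g \<in> borel_measurable lebesgue"
  shows "(\<lambda>t. indicator A t * g t) \<in> borel_measurable lebesgue"
  by (rule borel_measurable_times[OF borel_measurable_indicator assms(2)]) (rule assms(1))

text \<open>
  The positive and the negative part of \<open>f\<close> are densities of two finite measures that agree on the
  half-lines \<open>(x, \<infinity>)\<close>, which generate the Borel sets; so the measures agree and the densities are
  equal.
\<close>

lemma AE_zero_if_upper_integrals_zero: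
  fixes f :: "real \<Rightarrow> real"
  assumes f: "integrable lebesgue f"
    and zero: "\<And>x. (\<integral>t. indicator {x<..} t * f t \<partial>lebesgue) = 0"
  shows "AE t in lebesgue. f t = 0"
proof -
  obtain g where g [measurable]: "g \<in> borel_measurable lborel" and fg: "AE x in lborel. f x = g x"
    using completion_ex_borel_measurable_real[OF borel_measurable_integrable[OF f]] by auto
  have fg': "AE x in lebesgue. f x = g x" using fg by (rule AE_completion)
  have gl: "g \<in> borel_measurable lebesgue" using g by (rule measurable_completion)
  have "integrable lebesgue g"
    using f integrable_cong_AE[OF borel_measurable_integrable[OF f] gl fg'] by simp
  then have int: "integrable lborel g" by (simp add: integrable_completion)
  have part: "integrable lborel (\<lambda>t. indicator {x<..} t * g t)" for x
    using integrable_mult_indicator[OF _ int, of "{x<..}"] by simp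
  have z: "(\<integral>t. indicator {x<..} t * g t \<partial>lborel) = 0" for x
  proof -
    have "(\<integral>t. indicator {x<..} t * g t \<partial>lborel) = (\<integral>t. indicator {x<..} t * g t \<partial>lebesgue)"
      by (rule integral_completion[symmetric]) measurable
    also have "\<dots> = (\<integral>t. indicator {x<..} t * f t \<partial>lebesgue)"
    proof (rule integral_cong_AE)
      show "(\<lambda>t. indicator {x<..} t * g t) \<in> borel_measurable lebesgue"
        by (rule measurable_completion) measurable
      show "(\<lambda>t. indicator {x<..} t * f t) \<in> borel_measurable lebesgue"
        using borel_measurable_integrable[OF f]
        by (intro borel_measurable_indicator_times) auto
      show "AE t in lebesgue. indicator {x<..} t * g t = indicator {x<..} t * f t"
        using fg' by eventually_elim simp
    qed
    finally show ?thesis using zero by simp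
  qed
  define M where "M = density lborel (\<lambda>x. ennreal (g x))"
  define N where "N = density lborel (\<lambda>x. ennreal (- g x))"
  have M: "emeasure M {x<..} = (\<integral>\<^sup>+t. ennreal (indicator {x<..} t * g t) \<partial>lborel)" for x
    unfolding M_def by (subst emeasure_density) (auto intro!: nn_integral_cong simp: indicator_def)
  have N: "emeasure N {x<..} = (\<integral>\<^sup>+t. ennreal (- (indicator {x<..} t * g t)) \<partial>lborel)" for x
    unfolding N_def by (subst emeasure_density) (auto intro!: nn_integral_cong simp: indicator_def)
  have fin: "emeasure M {x<..} < \<infinity>" "emeasure N {x<..} < \<infinity>" for x
    using part[of x] unfolding M N real_integrable_def by (auto simp: less_top)
  have "emeasure M {x<..} = emeasure N {x<..}" for x
    using z[of x] fin[of x] unfolding real_lebesgue_integral_def[OF part] M[symmetric] N[symmetric]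
    by (metis ennreal_enn2real eq_iff_diff_eq_0 infinity_ennreal_def)
  then have "M = N"
    by (intro measure_eqI_lessThan fin) (auto simp: M_def N_def)
  then have "AE x in lborel. ennreal (g x) = ennreal (- g x)"
    unfolding M_def N_def by (intro sigma_finite_measure.density_unique[OF sigma_finite_lborel]) measurable
  then have "AE x in lborel. g x = 0"
    by eventually_elim (metis ennreal_eq_0_iff ennreal_inj linorder_le_cases neg_le_0_iff_le
        eq_neg_iff_add_eq_0 add.inverse_neutral antisym)
  then have "AE x in lebesgue. g x = 0" by (rule AE_completion)
  with fg' show ?thesis by eventually_elim simp
qed

lemma AE_halfline_iff_negligible: "(AE r in halfline. P r) \<longleftrightarrow> negligible {r. 0 < r \<and> \<not> P r}"
proof -
  have "(AE r in halfline. P r) \<longleftrightarrow> (AE r in lebesgue. 0 < r \<longrightarrow> P r)"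
    by (subst AE_restrict_space_iff) auto
  also have "\<dots> \<longleftrightarrow> negligible {r. 0 < r \<and> \<not> P r}"
  proof
    assume "AE r in lebesgue. 0 < r \<longrightarrow> P r"
    then obtain N where "N \<in> null_sets lebesgue" "{r. 0 < r \<and> \<not> P r} \<subseteq> N"
      unfolding eventually_ae_filter by auto
    then show "negligible {r. 0 < r \<and> \<not> P r}"
      using negligible_iff_null_sets negligible_subset by blast
  next
    assume "negligible {r. 0 < r \<and> \<not> P r}"
    then show "AE r in lebesgue. 0 < r \<longrightarrow> P r"
      unfolding eventually_ae_filter negligible_iff_null_sets
      by (intro bexI[of _ "{r. 0 < r \<and> \<not> P r}"]) auto
  qed
  finally show ?thesis .
qed

lemma locally_integrable_Icc:
  "locally_integrable w \<Longrightarrow> 0 < a \<Longrightarrow> w absolutely_integrable_on {a..b}"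
  unfolding locally_integrable_def
  by (drule spec[of _ "{a..b}"]) auto

lemma locally_integrableI:
  assumes "\<And>a b. 0 < a \<Longrightarrow> a \<le> b \<Longrightarrow> w absolutely_integrable_on {a..b}"
  shows "locally_integrable w"
  unfolding locally_integrable_def
proof (intro allI impI)
  fix K :: "real set" assume K: "compact K" "K \<subseteq> {0<..}"
  show "w absolutely_integrable_on K"
  proof (cases "K = {}")
    case False
    obtain a b where ab: "a \<in> K" "\<forall>x\<in>K. a \<le> x" "b \<in> K" "\<forall>x\<in>K. x \<le> b"
      using compact_attains_inf[OF K(1) False] compact_attains_sup[OF K(1) False] by blast
    have "w absolutely_integrable_on {a..b}"
      using ab K(2) by (intro assms) auto
    moreover have "K \<in> sets lebesgue"
      using K(1) by (simp add: compact_imp_closed)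
    moreover have "K \<subseteq> {a..b}" using ab by auto
    ultimately show ?thesis by (metis set_integrable_subset)
  qed simp
qed

lemma
  assumes w: "locally_integrable w" and a: "0 < a"
    and \<phi>: "continuous_on {a..b} \<phi>" "\<And>x. x \<notin> {a..b} \<Longrightarrow> \<phi> x = 0"
  shows test_pairing_abs: "(\<lambda>r. w r * \<phi> r) absolutely_integrable_on {a..b}"
    and test_pairing_integrable: "integrable halfline (\<lambda>r. w r * \<phi> r)"
    and test_pairing_eq: "(\<integral>r. w r * \<phi> r \<partial>halfline) = integral {a..b} (\<lambda>r. w r * \<phi> r)"
proof -
  have "(\<lambda>r. \<phi> r * w r) absolutely_integrable_on {a..b}"
  proof (rule absolutely_integrable_bounded_measurable_product_real)
    show "\<phi> \<in> borel_measurable (lebesgue_on {a..b})"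
      using \<phi>(1) by (intro continuous_imp_measurable_on_sets_lebesgue) auto
    show "bounded (\<phi> ` {a..b})"
      using \<phi>(1) by (intro compact_imp_bounded compact_continuous_image) auto
    show "w absolutely_integrable_on {a..b}" using w a by (rule locally_integrable_Icc)
  qed auto
  then show 1: "(\<lambda>r. w r * \<phi> r) absolutely_integrable_on {a..b}" by (simp add: mult.commute)
  have eq: "indicator {0<..} r *\<^sub>R (w r * \<phi> r) = indicator {a..b} r *\<^sub>R (w r * \<phi> r)" for r
    using a \<phi>(2)[of r] by (auto simp: indicator_def)
  have "integrable lebesgue (\<lambda>r. indicator {0<..} r *\<^sub>R (w r * \<phi> r))"
    using 1 unfolding set_integrable_def eq .
  then show "integrable halfline (\<lambda>r. w r * \<phi> r)"
    by (subst integrable_restrict_space) auto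
  have "(\<integral>r. w r * \<phi> r \<partial>halfline) = (LINT r:{a..b}|lebesgue. w r * \<phi> r)"
    unfolding set_lebesgue_integral_def eq[symmetric] by (rule integral_restrict_space) auto
  then show "(\<integral>r. w r * \<phi> r \<partial>halfline) = integral {a..b} (\<lambda>r. w r * \<phi> r)"
    using set_lebesgue_integral_eq_integral(2)[OF 1] by simp
qed

lemma test_function_integrable:
  assumes "locally_integrable w" "test_function \<phi>"
  shows "integrable halfline (\<lambda>r. w r * \<phi> r)"
proof -
  obtain a b where "0 < a" "\<forall>x. x \<notin> {a..b} \<longrightarrow> \<phi> x = 0"
    using test_functionD(2)[OF assms(2)] by blast
  then show ?thesis
    using assms(1) smooth_continuous[OF test_functionD(1)[OF assms(2)]]
    by (intro test_pairing_integrable) auto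
qed

text \<open>
  The fundamental lemma of the calculus of variations: bumps turn the hypothesis into vanishing
  integrals over all compact intervals.
\<close>

lemma AE_zero_if_test_integrals_zero:
  assumes w: "locally_integrable w"
    and zero: "\<And>\<phi>. test_function \<phi> \<Longrightarrow> (\<integral>r. w r * \<phi> r \<partial>halfline) = 0"
  shows "AE r in halfline. w r = 0"
proof -
  have int0: "integral {a..b} w = 0" if "0 < a" for a b
  proof -
    have "(\<lambda>n. integral {a..b} (\<lambda>r. w r * bump a b n r))
        \<longlonglongrightarrow> integral {a..b} (\<lambda>r. w r * indicator {a<..<b} r)"
    proof (rule dominated_convergence(2))
      have c: "continuous_on {a..b} (bump a b n)" for n
        by (rule smooth_continuous[OF test_functionD(1)[OF test_function_bump[OF that]]])
      show "(\<lambda>r. w r * bump a b n r) integrable_on {a..b}" for n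
        by (rule set_lebesgue_integral_eq_integral(1)[OF test_pairing_abs[OF w that c]])
          (auto intro: bump_outside)
      show "(\<lambda>r. \<bar>w r\<bar>) integrable_on {a..b}"
        by (rule set_lebesgue_integral_eq_integral(1)[OF set_integrable_abs[OF locally_integrable_Icc[OF w that]]])
      show "norm (w r * bump a b n r) \<le> \<bar>w r\<bar>" for n r
        using bump_bounds[of a b n r] by (simp add: abs_mult mult_left_le)
      show "(\<lambda>n. w r * bump a b n r) \<longlonglongrightarrow> w r * indicator {a<..<b} r" for r
        by (intro tendsto_mult_left bump_tendsto)
    qed
    moreover have "integral {a..b} (\<lambda>r. w r * bump a b n r) = 0" for n
      using test_pairing_eq[OF w that, of b "bump a b n"] zero[OF test_function_bump[OF that]]
        smooth_continuous[OF test_functionD(1)[OF test_function_bump[OF that]]] bump_outside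
      by fastforce
    ultimately have "integral {a..b} (\<lambda>r. w r * indicator {a<..<b} r) = 0"
      by (simp add: LIMSEQ_const_iff)
    moreover have "integral {a..b} (\<lambda>r. w r * indicator {a<..<b} r) = integral {a..b} w"
      by (rule integral_spike[of "{a, b}"]) auto
    ultimately show ?thesis by simp
  qed
  have loc: "AE r in lebesgue. indicator {a..b} r * w r = 0" if "0 < a" for a b
  proof (rule AE_zero_if_upper_integrals_zero)
    have ab: "w absolutely_integrable_on {a..b}" using w that by (rule locally_integrable_Icc)
    then show "integrable lebesgue (\<lambda>r. indicator {a..b} r * w r)"
      by (simp add: set_integrable_def)
    fix x :: real
    have ab': "w absolutely_integrable_on {max a x..b}"
      using w that by (intro locally_integrable_Icc) auto
    have "(\<integral>t. indicator {x<..} t * (indicator {a..b} t * w t) \<partial>lebesgue)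
        = (\<integral>t. indicator {max a x..b} t *\<^sub>R w t \<partial>lebesgue)"
    proof (rule integral_cong_AE)
      have "(\<lambda>t. indicator {a..b} t * w t) \<in> borel_measurable lebesgue"
        using ab by (auto simp: set_integrable_def dest: borel_measurable_integrable)
      then show "(\<lambda>t. indicator {x<..} t * (indicator {a..b} t * w t)) \<in> borel_measurable lebesgue"
        by (intro borel_measurable_indicator_times[of "{x<..}"]) auto
      show "(\<lambda>t. indicator {max a x..b} t *\<^sub>R w t) \<in> borel_measurable lebesgue"
        using ab' by (auto simp: set_integrable_def dest: borel_measurable_integrable)
      have "AE t in lebesgue. t \<noteq> x"
        by (rule AE_completion) (rule AE_lborel_singleton)
      then show "AE t in lebesgue. indicator {x<..} t * (indicator {a..b} t * w t)
          = indicator {max a x..b} t *\<^sub>R w t"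
        by eventually_elim (auto simp: indicator_def)
    qed
    also have "\<dots> = integral {max a x..b} w"
      using set_lebesgue_integral_eq_integral(2)[OF ab'] by (simp add: set_lebesgue_integral_def)
    also have "\<dots> = 0" using that by (intro int0) auto
    finally show "(\<integral>t. indicator {x<..} t * (indicator {a..b} t * w t) \<partial>lebesgue) = 0" .
  qed
  have "AE r in lebesgue. \<forall>n. indicator {1 / real (Suc n)..real (Suc n)} r * w r = 0"
    unfolding AE_all_countable by (intro allI loc) simp
  then have "AE r in lebesgue. 0 < r \<longrightarrow> w r = 0"
  proof eventually_elim
    case (elim r)
    show ?case
    proof
      assume r: "0 < r"
      obtain n where n: "max r (1 / r) < real n" using reals_Archimedean2 by blast
      then have "1 / real (Suc n) \<le> r" "r \<le> real (Suc n)"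
        using r by (auto simp: field_simps)
      then show "w r = 0" using elim[rule_format, of n] by (simp add: indicator_def)
    qed
  qed
  then show ?thesis by (subst AE_restrict_space_iff) auto
qed

text \<open>
  The lemma of du Bois-Reymond. Subtracting from a test function a multiple of a fixed bump \<open>\<omega>\<close>
  makes its mean zero, hence makes it a derivative of a test function; so \<open>w\<close> pairs with every test
  function as the constant \<open>c\<close> does.
\<close>

lemma AE_const_if_test_deriv_integrals_zero:
  assumes w: "locally_integrable w"
    and zero: "\<And>\<phi>. test_function \<phi> \<Longrightarrow> (\<integral>r. w r * deriv \<phi> r \<partial>halfline) = 0"
  shows "\<exists>c. AE r in halfline. w r = c"
proof -
  define \<omega> where "\<omega> = bump 1 2 0"
  have t0: "test_function \<omega>" unfolding \<omega>_def by (rule test_function_bump) simp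
  have c0: "continuous_on S \<omega>" for S by (rule smooth_continuous[OF test_functionD(1)[OF t0]])
  define I where "I = integral {1..2} \<omega>"
  have I: "I > 0"
  proof -
    have "integral {1..2::real} (\<lambda>x. 0) < integral {1..2} \<omega>"
      by (rule integral_less_real[OF _ c0]) (auto simp: \<omega>_def bump_pos)
    then show ?thesis by (simp add: I_def)
  qed
  define c where "c = (\<integral>r. w r * \<omega> r \<partial>halfline) / I"
  have one: "locally_integrable (\<lambda>r. c)" for c :: real
    by (rule locally_integrableI) (simp add: absolutely_integrable_continuous_real)
  have wc: "locally_integrable (\<lambda>r. w r - c)"
    using w one[of c] by (auto simp: locally_integrable_def intro: set_integral_diff)
  have "(\<integral>r. (w r - c) * \<psi> r \<partial>halfline) = 0" if t: "test_function \<psi>" for \<psi>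
  proof -
    obtain a\<^sub>1 b\<^sub>1 where ab1: "0 < a\<^sub>1" "a\<^sub>1 \<le> b\<^sub>1" "\<forall>x. x \<notin> {a\<^sub>1..b\<^sub>1} \<longrightarrow> \<psi> x = 0"
      using test_functionD[OF t] by blast
    define a b where "a = min a\<^sub>1 1" and "b = max b\<^sub>1 2"
    have ab: "0 < a" "a \<le> b" using ab1 by (auto simp: a_def b_def)
    have out: "\<psi> x = 0" "\<omega> x = 0" if "x \<notin> {a..b}" for x
    proof -
      have "x \<notin> {a\<^sub>1..b\<^sub>1}" "x \<notin> {1<..<2}" using that by (auto simp: a_def b_def)
      then show "\<psi> x = 0" "\<omega> x = 0" using ab1(3) by (auto simp: \<omega>_def bump_outside)
    qed
    have ct: "continuous_on S \<psi>" for S by (rule smooth_continuous[OF test_functionD(1)[OF t]])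
    have "\<omega> x = 0" if "x \<in> {a..b} - {1..2}" for x
      using that unfolding \<omega>_def by (intro bump_outside) auto
    then have "{x \<in> {a..b} - {1..2}. \<omega> x \<noteq> 0} = {}" by blast
    moreover have "{x \<in> {1..2} - {a..b}. \<omega> x \<noteq> 0} = {}" using out(2) by blast
    ultimately have I': "integral {a..b} \<omega> = I"
      unfolding I_def by (intro integral_spike_set) (simp_all only: negligible_empty)
    define m where "m = integral {a..b} \<psi>"
    have "test_function (\<lambda>x. \<psi> x + (- (m / I)) * \<omega> x)"
      by (rule test_function_lincomb[OF t t0])
    moreover have "integral {a..b} (\<lambda>x. \<psi> x + (- (m / I)) * \<omega> x) = 0"
    proof -
      have "integral {a..b} (\<lambda>x. \<psi> x + (- (m / I)) * \<omega> x)
          = integral {a..b} \<psi> + integral {a..b} (\<lambda>x. (- (m / I)) * \<omega> x)"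
        by (intro integral_add integrable_continuous_real continuous_intros ct c0)
      then show ?thesis using I by (simp add: m_def I')
    qed
    ultimately obtain \<phi> where \<phi>: "test_function \<phi>" "deriv \<phi> = (\<lambda>x. \<psi> x + (- (m / I)) * \<omega> x)"
      using test_function_antideriv[of "\<lambda>x. \<psi> x + (- (m / I)) * \<omega> x" a b] ab out by auto
    have "0 = (\<integral>r. w r * (\<psi> r + (- (m / I)) * \<omega> r) \<partial>halfline)"
      using zero[OF \<phi>(1)] by (simp add: \<phi>(2))
    also have "\<dots> = (\<integral>r. w r * \<psi> r + (- (m / I)) * (w r * \<omega> r) \<partial>halfline)"
      by (intro Bochner_Integration.integral_cong) (auto simp: algebra_simps)
    also have "\<dots> = (\<integral>r. w r * \<psi> r \<partial>halfline) + (- (m / I)) * (\<integral>r. w r * \<omega> r \<partial>halfline)"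
      by (subst Bochner_Integration.integral_add)
        (auto intro!: test_function_integrable[OF w] t t0)
    finally have w\<psi>: "(\<integral>r. w r * \<psi> r \<partial>halfline) = c * m" using I by (simp add: c_def field_simps)
    have "(\<integral>r. c * \<psi> r \<partial>halfline) = c * m"
      using test_pairing_eq[OF one[of c] ab(1) ct out(1)] by (simp add: m_def)
    moreover have "(\<integral>r. (w r - c) * \<psi> r \<partial>halfline)
        = (\<integral>r. w r * \<psi> r \<partial>halfline) - (\<integral>r. c * \<psi> r \<partial>halfline)"
      unfolding left_diff_distrib
      by (rule Bochner_Integration.integral_diff) (intro test_function_integrable w one t)+
    ultimately show ?thesis using w\<psi> by linarith
  qed
  then have "AE r in halfline. w r - c = 0"
    by (rule AE_zero_if_test_integrals_zero[OF wc])
  then have "AE r in halfline. w r = c" by eventually_elim simp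
  then show ?thesis ..
qed

section \<open>Weakly differentiable functions as primitives\<close>

text \<open>
  Local absolute continuity of \<open>U\<close> with derivative \<open>V\<close>, encoded by the fundamental theorem of calculus:
  the calculus rules below are then statements about integrals over intervals.
\<close>

definition primitive_of :: "(real \<Rightarrow> real) \<Rightarrow> (real \<Rightarrow> real) \<Rightarrow> bool" where
  "primitive_of U V \<longleftrightarrow>
     (\<forall>a b. 0 < a \<longrightarrow> a \<le> b \<longrightarrow> V absolutely_integrable_on {a..b} \<and> integral {a..b} V = U b - U a)"

lemma primitive_of_abs: "primitive_of U V \<Longrightarrow> 0 < a \<Longrightarrow> V absolutely_integrable_on {a..b}"
  unfolding primitive_of_def by (cases "a \<le> b") auto

lemma primitive_of_eq: "primitive_of U V \<Longrightarrow> 0 < a \<Longrightarrow> a \<le> b \<Longrightarrow> integral {a..b} V = U b - U a"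
  unfolding primitive_of_def by auto

lemma primitive_of_integrable: "primitive_of U V \<Longrightarrow> 0 < a \<Longrightarrow> V integrable_on {a..b}"
  using primitive_of_abs set_lebesgue_integral_eq_integral(1) by blast

lemma primitive_of_has_integral:
  "primitive_of U V \<Longrightarrow> 0 < a \<Longrightarrow> a \<le> b \<Longrightarrow> (V has_integral (U b - U a)) {a..b}"
  using primitive_of_eq primitive_of_integrable integrable_integral by metis

lemma primitive_of_locally_integrable: "primitive_of U V \<Longrightarrow> locally_integrable V"
  by (rule locally_integrableI) (rule primitive_of_abs)

lemma primitive_of_continuous:
  assumes "primitive_of U V" "S \<subseteq> {0<..}"
  shows "continuous_on S U"
proof -
  have "isCont U x" if x: "0 < x" for x
  proof -
    have "continuous_on {x/2..x+1} (\<lambda>y. U (x/2) + integral {x/2..y} V)"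
      using x by (intro continuous_intros indefinite_integral_continuous_1 primitive_of_integrable[OF assms(1)]) auto
    moreover have "U (x/2) + integral {x/2..y} V = U y" if "y \<in> {x/2..x+1}" for y
      using primitive_of_eq[OF assms(1), of "x/2" y] that x by auto
    ultimately have "continuous_on {x/2..x+1} U"
      by (rule continuous_on_eq) simp
    then have "continuous_on {x/2<..<x+1} U"
      by (rule continuous_on_subset) auto
    then show ?thesis
      using x by (subst (asm) continuous_on_eq_continuous_at) auto
  qed
  then show ?thesis using assms(2)
    by (intro continuous_at_imp_continuous_on) auto
qed

lemma primitive_of_imp_locally_integrable: 
  assumes "primitive_of U V" shows "locally_integrable U"
  by (intro locally_integrableI absolutely_integrable_continuous_real primitive_of_continuous[OF assms]) auto

lemma absolutely_integrable_continuous_mult: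
  fixes G V :: "real \<Rightarrow> real"
  assumes "continuous_on {a..b} G" "V absolutely_integrable_on {a..b}"
  shows "(\<lambda>r. G r * V r) absolutely_integrable_on {a..b}"
proof (rule absolutely_integrable_bounded_measurable_product_real)
  show "G \<in> borel_measurable (lebesgue_on {a..b})"
    using assms(1) by (intro continuous_imp_measurable_on_sets_lebesgue) auto
  show "bounded (G ` {a..b})"
    using assms(1) by (intro compact_imp_bounded compact_continuous_image) auto
qed (use assms in auto)

text \<open>
  On a short interval \<open>[x, y]\<close>, the mean value theorem for \<open>\<Phi>\<close> and the intermediate value theorem for
  \<open>U\<close> give \<open>\<Phi>(U y) - \<Phi>(U x) = \<Phi>'(U s) (U y - U x)\<close> for some \<open>s\<close> in \<open>[x, y]\<close>, and \<open>U y - U x\<close> is the integral of \<open>V\<close>.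
  By uniform continuity of \<open>\<Phi>' \<circ> U\<close>, replacing \<open>\<Phi>'(U s)\<close> by \<open>\<Phi>'(U r)\<close> under that integral costs at most
  \<open>e\<close> times the integral of \<open>|V|\<close>; summing over a fine partition leaves an arbitrarily small error.
\<close>

lemma primitive_of_chain:
  assumes UV: "primitive_of U V"
    and \<Phi>: "\<And>x. (\<Phi> has_real_derivative \<Phi>' x) (at x)" and cont: "continuous_on UNIV \<Phi>'"
  shows "primitive_of (\<lambda>r. \<Phi> (U r)) (\<lambda>r. \<Phi>' (U r) * V r)"
  unfolding primitive_of_def
proof (intro allI impI conjI)
  fix a b :: real assume a: "0 < a" and ab: "a \<le> b"
  let ?G = "\<lambda>r. \<Phi>' (U r)" and ?K = "integral {a..b} (\<lambda>r. \<bar>V r\<bar>)"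
  have U: "continuous_on {a..b} U"
    using a by (intro primitive_of_continuous[OF UV]) auto
  have G: "continuous_on {a..b} ?G"
    using continuous_on_compose2[OF cont U] by auto
  show GV: "(\<lambda>r. ?G r * V r) absolutely_integrable_on {a..b}"
    by (rule absolutely_integrable_continuous_mult[OF G primitive_of_abs[OF UV a]])
  have V': "V absolutely_integrable_on {x..y}" "(\<lambda>r. ?G r * V r) absolutely_integrable_on {x..y}"
    "(\<lambda>r. \<bar>V r\<bar>) absolutely_integrable_on {x..y}" if "a \<le> x" "y \<le> b" for x y
    using that by (auto intro!: absolutely_integrable_on_subinterval[OF GV] set_integrable_abs
        absolutely_integrable_on_subinterval[OF primitive_of_abs[OF UV a, of b]])
  note int = V'[THEN set_lebesgue_integral_eq_integral(1)]
  have step: "\<bar>\<Phi> (U y) - \<Phi> (U x) - integral {x..y} (\<lambda>r. ?G r * V r)\<bar> \<le> e * integral {x..y} (\<lambda>r. \<bar>V r\<bar>)"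
    if xy: "a \<le> x" "x \<le> y" "y \<le> b" and e: "\<And>s t. s \<in> {x..y} \<Longrightarrow> t \<in> {x..y} \<Longrightarrow> \<bar>?G s - ?G t\<bar> \<le> e" for x y e
  proof -
    \<comment> \<open>mean value theorem for \<open>\<Phi>\<close>, then intermediate value theorem for \<open>U\<close>\<close>
    have "\<exists>\<xi>. min (U x) (U y) \<le> \<xi> \<and> \<xi> \<le> max (U x) (U y) \<and> \<Phi> (U y) - \<Phi> (U x) = (U y - U x) * \<Phi>' \<xi>"
    proof (cases "U x" "U y" rule: linorder_cases)
      case less
      then obtain z where "U x < z" "z < U y" "\<Phi> (U y) - \<Phi> (U x) = (U y - U x) * \<Phi>' z"
        using MVT2[of "U x" "U y" \<Phi> \<Phi>'] \<Phi> by blast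
      then show ?thesis by (intro exI[of _ z]) auto
    next
      case greater
      then obtain z where "U y < z" "z < U x" "\<Phi> (U x) - \<Phi> (U y) = (U x - U y) * \<Phi>' z"
        using MVT2[of "U y" "U x" \<Phi> \<Phi>'] \<Phi> by blast
      then show ?thesis by (intro exI[of _ z]) (auto simp: algebra_simps)
    qed auto
    then obtain \<xi> where \<xi>: "min (U x) (U y) \<le> \<xi>" "\<xi> \<le> max (U x) (U y)"
      "\<Phi> (U y) - \<Phi> (U x) = (U y - U x) * \<Phi>' \<xi>" by blast
    have Uxy: "continuous_on {x..y} U" using U xy by (auto elim: continuous_on_subset)
    have "\<exists>s\<in>{x..y}. U s = \<xi>"
    proof (cases "U x \<le> U y")
      case True
      then show ?thesis using IVT'[of U x \<xi> y] \<xi> xy Uxy by auto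
    next
      case False
      then show ?thesis using IVT2'[of U y \<xi> x] \<xi> xy Uxy by auto
    qed
    then obtain s where s: "s \<in> {x..y}" "U s = \<xi>" by blast
    have "\<Phi> (U y) - \<Phi> (U x) = integral {x..y} (\<lambda>r. ?G s * V r)"
      using primitive_of_eq[OF UV, of x y] xy a s(2) \<xi>(3) by simp
    then have "\<Phi> (U y) - \<Phi> (U x) - integral {x..y} (\<lambda>r. ?G r * V r)
        = integral {x..y} (\<lambda>r. ?G s * V r - ?G r * V r)"
      using integral_diff[OF integrable_on_mult_right[OF int(1)[OF xy(1,3)], of "?G s"] int(2)[OF xy(1,3)]]
      by simp
    moreover have "\<bar>integral {x..y} (\<lambda>r. ?G s * V r - ?G r * V r)\<bar> \<le> integral {x..y} (\<lambda>r. e * \<bar>V r\<bar>)"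
      unfolding real_norm_def[symmetric]
    proof (rule integral_norm_bound_integral)
      show "(\<lambda>r. ?G s * V r - ?G r * V r) integrable_on {x..y}"
        by (intro integrable_diff integrable_on_mult_right int xy)
      show "(\<lambda>r. e * norm (V r)) integrable_on {x..y}"
        unfolding real_norm_def by (intro integrable_on_mult_right int xy)
      show "norm (?G s * V r - ?G r * V r) \<le> e * norm (V r)" if "r \<in> {x..y}" for r
        using e[OF s(1) that] by (simp add: left_diff_distrib[symmetric] abs_mult mult_right_mono)
    qed
    ultimately show ?thesis by simp
  qed
  have "\<bar>\<Phi> (U b) - \<Phi> (U a) - integral {a..b} (\<lambda>r. ?G r * V r)\<bar> \<le> e * ?K" if "e > 0" for e
  proof -
    have "uniformly_continuous_on {a..b} ?G"
      using G by (intro compact_uniformly_continuous) auto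
    then obtain d where d: "d > 0" "\<And>s t. s \<in> {a..b} \<Longrightarrow> t \<in> {a..b} \<Longrightarrow> dist t s < d \<Longrightarrow> dist (?G t) (?G s) < e"
      using \<open>e > 0\<close> unfolding uniformly_continuous_on_def by metis
    obtain n where n: "(b - a) / d < real n" using reals_Archimedean2 by blast
    have npos: "0 < real n" using n d(1) ab by (smt (verit) divide_nonneg_pos)
    define h where "h = (b - a) / real n"
    have h: "0 \<le> h" "h < d" "a + real n * h = b"
      using n d(1) npos ab by (auto simp: h_def field_simps)
    have "\<bar>\<Phi> (U (a + real i * h)) - \<Phi> (U a) - integral {a..a + real i * h} (\<lambda>r. ?G r * V r)\<bar>
        \<le> e * integral {a..a + real i * h} (\<lambda>r. \<bar>V r\<bar>)" if "i \<le> n" for i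
      using that
    proof (induction i)
      case (Suc i)
      let ?x = "a + real i * h" and ?y = "a + real (Suc i) * h"
      have "real (Suc i) * h \<le> real n * h" using Suc.prems h(1) by (intro mult_right_mono) auto
      then have xy: "a \<le> ?x" "?x \<le> ?y" "?y \<le> b" "?y - ?x = h"
        using h by (auto simp: algebra_simps)
      have "\<bar>\<Phi> (U ?y) - \<Phi> (U ?x) - integral {?x..?y} (\<lambda>r. ?G r * V r)\<bar> \<le> e * integral {?x..?y} (\<lambda>r. \<bar>V r\<bar>)"
      proof (rule step[OF xy(1-3)])
        fix s t assume st: "s \<in> {?x..?y}" "t \<in> {?x..?y}"
        have in_ab: "r \<in> {a..b}" if "r \<in> {?x..?y}" for r
          using that xy unfolding atLeastAtMost_iff by linarith
        have "\<bar>t - s\<bar> \<le> h" using st xy(4) unfolding atLeastAtMost_iff by linarith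
        then have "dist (?G t) (?G s) < e"
          using h(2) by (intro d(2) in_ab st) (simp add: dist_real_def)
        then show "\<bar>?G s - ?G t\<bar> \<le> e" by (simp add: dist_real_def)
      qed
      moreover have "integral {a..?x} f + integral {?x..?y} f = integral {a..?y} f"
        if "f integrable_on {a..?y}" for f :: "real \<Rightarrow> real"
        by (rule Henstock_Kurzweil_Integration.integral_combine) (use xy that in auto)
      from this[OF int(2)] this[OF int(3)] have
        "integral {a..?x} (\<lambda>r. ?G r * V r) + integral {?x..?y} (\<lambda>r. ?G r * V r) = integral {a..?y} (\<lambda>r. ?G r * V r)"
        "integral {a..?x} (\<lambda>r. \<bar>V r\<bar>) + integral {?x..?y} (\<lambda>r. \<bar>V r\<bar>) = integral {a..?y} (\<lambda>r. \<bar>V r\<bar>)"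
        using xy by auto
      moreover have "\<bar>\<Phi> (U ?x) - \<Phi> (U a) - integral {a..?x} (\<lambda>r. ?G r * V r)\<bar> \<le> e * integral {a..?x} (\<lambda>r. \<bar>V r\<bar>)"
        using Suc by simp
      ultimately show ?case by (simp add: algebra_simps abs_le_iff) (smt (verit) distrib_left)
    qed auto
    from this[of n] h(3) show ?thesis by simp
  qed
  note small = this
  have K: "?K \<ge> 0" by (rule integral_nonneg) (auto intro: int ab)
  have "\<bar>\<Phi> (U b) - \<Phi> (U a) - integral {a..b} (\<lambda>r. ?G r * V r)\<bar> \<le> 0"
  proof (rule field_le_epsilon)
    fix e :: real assume "e > 0"
    then have "\<bar>\<Phi> (U b) - \<Phi> (U a) - integral {a..b} (\<lambda>r. ?G r * V r)\<bar> \<le> e / (?K + 1) * ?K"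
      using K by (intro small) auto
    also have "\<dots> \<le> e" using K \<open>e > 0\<close> by (simp add: field_simps)
    finally show "\<bar>\<Phi> (U b) - \<Phi> (U a) - integral {a..b} (\<lambda>r. ?G r * V r)\<bar> \<le> 0 + e" by simp
  qed
  then show "integral {a..b} (\<lambda>r. ?G r * V r) = \<Phi> (U b) - \<Phi> (U a)" by simp
qed

lemma primitive_of_add:
  assumes "primitive_of U V" "primitive_of U' V'"
  shows "primitive_of (\<lambda>r. U r + U' r) (\<lambda>r. V r + V' r)"
  unfolding primitive_of_def
proof (intro allI impI conjI)
  fix a b :: real assume "0 < a" "a \<le> b"
  then show "(\<lambda>r. V r + V' r) absolutely_integrable_on {a..b}"
    by (intro set_integral_add primitive_of_abs[OF assms(1)] primitive_of_abs[OF assms(2)])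
  show "integral {a..b} (\<lambda>r. V r + V' r) = U b + U' b - (U a + U' a)"
    using integral_add[OF primitive_of_integrable[OF assms(1) \<open>0 < a\<close>] primitive_of_integrable[OF assms(2) \<open>0 < a\<close>], of b]
      primitive_of_eq[OF assms(1) \<open>0 < a\<close> \<open>a \<le> b\<close>] primitive_of_eq[OF assms(2) \<open>0 < a\<close> \<open>a \<le> b\<close>] by simp
qed

lemma primitive_of_cmult:
  assumes "primitive_of U V"
  shows "primitive_of (\<lambda>r. c * U r) (\<lambda>r. c * V r)"
  using primitive_of_chain[OF assms, of "\<lambda>x. c * x" "\<lambda>x. c"]
  by (auto intro!: derivative_eq_intros continuous_intros)

text \<open>
  The product rule is the chain rule for the square, by polarisation.
\<close>

lemma primitive_of_mult:
  assumes "primitive_of U V" "primitive_of U' V'"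
  shows "primitive_of (\<lambda>r. U r * U' r) (\<lambda>r. V r * U' r + U r * V' r)"
proof -
  have sq: "primitive_of (\<lambda>r. (f r)\<^sup>2) (\<lambda>r. 2 * f r * f' r)" if "primitive_of f f'" for f f'
  proof (rule primitive_of_chain[OF that, of "\<lambda>x. x\<^sup>2" "\<lambda>x. 2 * x"])
    show "((\<lambda>x. x\<^sup>2) has_real_derivative 2 * x) (at x)" for x :: real
      using DERIV_pow[of 2 x] by simp
  qed (intro continuous_intros)
  have "primitive_of (\<lambda>r. 1/2 * ((U r + U' r)\<^sup>2 + ((-1) * (U r)\<^sup>2 + (-1) * (U' r)\<^sup>2)))
     (\<lambda>r. 1/2 * (2 * (U r + U' r) * (V r + V' r) + ((-1) * (2 * U r * V r) + (-1) * (2 * U' r * V' r))))"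
    by (intro primitive_of_cmult primitive_of_add sq assms)
  moreover have "1/2 * ((U r + U' r)\<^sup>2 + ((-1) * (U r)\<^sup>2 + (-1) * (U' r)\<^sup>2)) = U r * U' r" for r
    by (simp add: power2_eq_square algebra_simps)
  moreover have "1/2 * (2 * (U r + U' r) * (V r + V' r) + ((-1) * (2 * U r * V r) + (-1) * (2 * U' r * V' r)))
     = V r * U' r + U r * V' r" for r
    by (simp add: algebra_simps)
  ultimately show ?thesis by (simp only:)
qed

lemma primitive_of_C1:
  assumes "\<And>x. 0 < x \<Longrightarrow> (f has_real_derivative f' x) (at x)" "continuous_on {0<..} f'"
  shows "primitive_of f f'"
  unfolding primitive_of_def
proof (intro allI impI conjI)
  fix a b :: real assume "0 < a" "a \<le> b"
  show "f' absolutely_integrable_on {a..b}"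
    using \<open>0 < a\<close> by (intro absolutely_integrable_continuous_real continuous_on_subset[OF assms(2)]) auto
  have "(f' has_integral f b - f a) {a..b}"
  proof (rule fundamental_theorem_of_calculus[OF \<open>a \<le> b\<close>])
    fix x assume "x \<in> {a..b}"
    then have "(f has_real_derivative f' x) (at x within {a..b})"
      using \<open>0 < a\<close> assms(1)[of x] has_field_derivative_at_within by auto
    then show "(f has_vector_derivative f' x) (at x within {a..b})"
      by (simp add: has_real_derivative_iff_has_vector_derivative)
  qed
  then show "integral {a..b} f' = f b - f a" by (rule integral_unique)
qed

lemma primitive_of_powr: "primitive_of (\<lambda>r. r powr a) (\<lambda>r. a * r powr (a - 1))"
  by (rule primitive_of_C1) (auto intro!: derivative_eq_intros continuous_intros)

lemma primitive_of_cong_AE: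
  assumes "primitive_of U V" "AE r in halfline. V' r = V r"
  shows "primitive_of U V'"
  unfolding primitive_of_def
proof (intro allI impI conjI)
  fix a b :: real assume "0 < a" "a \<le> b"
  have neg: "negligible {r. 0 < r \<and> V' r \<noteq> V r}"
    using assms(2) by (simp add: AE_halfline_iff_negligible)
  have eq: "V' x = V x" if "x \<in> {a..b} - {r. 0 < r \<and> V' r \<noteq> V r}" for x using that \<open>0 < a\<close> by auto
  show "V' absolutely_integrable_on {a..b}"
    by (rule absolutely_integrable_spike[OF primitive_of_abs[OF assms(1) \<open>0 < a\<close>] neg eq])
  show "integral {a..b} V' = U b - U a"
    using integral_spike[OF neg, of "{a..b}" V V'] eq primitive_of_eq[OF assms(1) \<open>0 < a\<close> \<open>a \<le> b\<close>] by metis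
qed

lemma locally_integrable_cong_AE:
  assumes "locally_integrable f" "AE r in halfline. g r = f r"
  shows "locally_integrable g"
proof (rule locally_integrableI)
  fix a b :: real assume a: "0 < a"
  have neg: "negligible {r. 0 < r \<and> g r \<noteq> f r}"
    using assms(2) by (simp add: AE_halfline_iff_negligible)
  show "g absolutely_integrable_on {a..b}"
    by (rule absolutely_integrable_spike[OF locally_integrable_Icc[OF assms(1) a] neg]) (use a in auto)
qed

lemma integral_halfline_cong_AE:
  fixes f g :: "real \<Rightarrow> real"
  assumes "AE r in halfline. f r = g r" "integrable halfline f" "integrable halfline g"
  shows "(\<integral>r. f r \<partial>halfline) = (\<integral>r. g r \<partial>halfline)"
  using assms by (intro integral_cong_AE) auto

lemma has_weak_deriv_cong_AE:
  assumes w: "has_weak_deriv n u v" and u: "AE r in halfline. u' r = u r" and v: "AE r in halfline. v' r = v r"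
  shows "has_weak_deriv n u' v'"
proof -
  have loc: "locally_integrable u" "locally_integrable v" using w by (auto simp: has_weak_deriv_def)
  then have loc': "locally_integrable u'" "locally_integrable v'"
    using locally_integrable_cong_AE u v by auto
  have tn: "test_function ((deriv ^^ n) \<phi>)" if "test_function \<phi>" for \<phi>
    using that by (induction n) (auto intro: test_function_deriv)
  have eq: "(\<integral>r. f r * \<psi> r \<partial>halfline) = (\<integral>r. g r * \<psi> r \<partial>halfline)"
    if "AE r in halfline. f r = g r" "locally_integrable f" "locally_integrable g" "test_function \<psi>" for f g \<psi>
  proof (rule integral_halfline_cong_AE)
    show "AE r in halfline. f r * \<psi> r = g r * \<psi> r" using that(1) by eventually_elim simp
  qed (intro test_function_integrable that)+
  show ?thesis
    unfolding has_weak_deriv_def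
  proof (intro conjI loc' allI impI)
    fix \<phi> assume \<phi>: "test_function \<phi>"
    have "(\<integral>r. u r * (deriv ^^ n) \<phi> r \<partial>halfline) = (- 1) ^ n * (\<integral>r. v r * \<phi> r \<partial>halfline)"
      using w \<phi> unfolding has_weak_deriv_def by blast
    then show "(\<integral>r. u' r * (deriv ^^ n) \<phi> r \<partial>halfline) = (- 1) ^ n * (\<integral>r. v' r * \<phi> r \<partial>halfline)"
      by (simp only: eq[OF u loc'(1) loc(1) tn[OF \<phi>]] eq[OF v loc'(2) loc(2) \<phi>])
  qed
qed

lemma primitive_of_has_weak_deriv:
  assumes UV: "primitive_of U V"
  shows "has_weak_deriv 1 U V"
  unfolding has_weak_deriv_def
proof (intro conjI allI impI)
  show U: "locally_integrable U" and V: "locally_integrable V"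
    using primitive_of_locally_integrable primitive_of_imp_locally_integrable UV by auto
  fix \<phi> assume \<phi>: "test_function \<phi>"
  then obtain a b where ab: "0 < a" "a \<le> b" "\<forall>x. x \<notin> {a..b} \<longrightarrow> \<phi> x = 0"
    using test_functionD(2) by blast
  define a' b' where "a' = a / 2" and "b' = b + 1"
  have ab': "0 < a'" "a' \<le> b'" "\<phi> a' = 0" "\<phi> b' = 0" using ab by (auto simp: a'_def b'_def)
  have out: "\<phi> x = 0" if "x \<notin> {a'..b'}" for x using that ab by (auto simp: a'_def b'_def)
  have sm: "smooth \<phi>" by (rule test_functionD(1)[OF \<phi>])
  have "primitive_of \<phi> (deriv \<phi>)"
    by (rule primitive_of_C1[OF smooth_has_deriv[OF sm] smooth_continuous[OF smooth_deriv[OF sm]]])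
  then have "integral {a'..b'} (\<lambda>r. V r * \<phi> r + U r * deriv \<phi> r) = 0"
    using primitive_of_eq[OF primitive_of_mult[OF UV] ab'(1,2)] ab'(3,4) by simp
  moreover note 1 = test_pairing_abs[OF V ab'(1) smooth_continuous[OF sm] out]
    test_pairing_eq[OF V ab'(1) smooth_continuous[OF sm] out]
  moreover have out': "deriv \<phi> x = 0" if "x \<notin> {a'..b'}" for x
    by (rule deriv_eq_0_outside[OF out that])
  note 2 = test_pairing_abs[OF U ab'(1) smooth_continuous[OF smooth_deriv[OF sm]] out']
    test_pairing_eq[OF U ab'(1) smooth_continuous[OF smooth_deriv[OF sm]] out']
  ultimately show "(\<integral>r. U r * (deriv ^^ 1) \<phi> r \<partial>halfline) = (- 1) ^ 1 * (\<integral>r. V r * \<phi> r \<partial>halfline)"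
    using integral_add[OF set_lebesgue_integral_eq_integral(1)[OF 1(1)] set_lebesgue_integral_eq_integral(1)[OF 2(1)]]
    by simp
qed

lemma has_weak_deriv_unique:
  assumes "has_weak_deriv n u v" "has_weak_deriv n u v'"
  shows "AE r in halfline. v r = v' r"
proof -
  have loc: "locally_integrable v" "locally_integrable v'" using assms by (auto simp: has_weak_deriv_def)
  have "AE r in halfline. v r - v' r = 0"
  proof (rule AE_zero_if_test_integrals_zero)
    show "locally_integrable (\<lambda>r. v r - v' r)"
      using loc by (auto simp: locally_integrable_def intro: set_integral_diff)
    fix \<phi> assume \<phi>: "test_function \<phi>"
    have "(\<integral>r. v r * \<phi> r \<partial>halfline) = (\<integral>r. v' r * \<phi> r \<partial>halfline)"
      using assms \<phi> by (auto simp: has_weak_deriv_def)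
    then show "(\<integral>r. (v r - v' r) * \<phi> r \<partial>halfline) = 0"
      unfolding left_diff_distrib using loc \<phi>
      by (subst Bochner_Integration.integral_diff) (auto intro: test_function_integrable)
  qed
  then show ?thesis by eventually_elim simp
qed

lemma weak_deriv_AE:
  assumes "has_weak_deriv 1 u v"
  shows "AE r in halfline. weak_deriv u r = v r"
  unfolding weak_deriv_def by (rule has_weak_deriv_unique[OF someI[of "has_weak_deriv 1 u", OF assms] assms])

lemma weak_deriv_primitive_AE:
  assumes "primitive_of U V" "AE r in halfline. u r = U r"
  shows "AE r in halfline. weak_deriv u r = V r"
  by (rule weak_deriv_AE[OF has_weak_deriv_cong_AE[OF primitive_of_has_weak_deriv[OF assms(1)] assms(2)]]) simp

text \<open>
  The function and the indefinite integral of its weak derivative have the same weak derivative, so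
  their difference is almost everywhere constant.
\<close>

lemma has_weak_deriv_imp_primitive:
  assumes w: "has_weak_deriv 1 u v"
  obtains U where "primitive_of U v" "AE r in halfline. u r = U r"
proof -
  have loc: "locally_integrable u" "locally_integrable v" using w by (auto simp: has_weak_deriv_def)
  have int: "v integrable_on {a..b}" if "0 < a" for a b
    by (rule set_lebesgue_integral_eq_integral(1)[OF locally_integrable_Icc[OF loc(2) that]])
  define U where "U x = (if 1 \<le> x then integral {1..x} v else - integral {x..1} v)" for x
  have U: "primitive_of U v"
    unfolding primitive_of_def
  proof (intro allI impI conjI)
    fix a b :: real assume ab: "0 < a" "a \<le> b"
    show "v absolutely_integrable_on {a..b}" by (rule locally_integrable_Icc[OF loc(2) ab(1)])
    consider "1 \<le> a" | "a < 1" "1 \<le> b" | "b < 1" by linarith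
    then show "integral {a..b} v = U b - U a"
    proof cases
      case 1
      then show ?thesis using Henstock_Kurzweil_Integration.integral_combine[of 1 a b v] int[of 1 b] ab by (simp add: U_def)
    next
      case 2
      then show ?thesis using Henstock_Kurzweil_Integration.integral_combine[of a 1 b v] int[of a b] ab by (simp add: U_def)
    next
      case 3
      then show ?thesis using Henstock_Kurzweil_Integration.integral_combine[of a b 1 v] int[of a 1] ab by (simp add: U_def)
    qed
  qed
  have wU: "has_weak_deriv 1 U v" by (rule primitive_of_has_weak_deriv[OF U])
  have locU: "locally_integrable U" by (rule primitive_of_imp_locally_integrable[OF U])
  have "\<exists>c. AE r in halfline. u r - U r = c"
  proof (rule AE_const_if_test_deriv_integrals_zero)
    show "locally_integrable (\<lambda>r. u r - U r)"
      using loc locU by (auto simp: locally_integrable_def intro: set_integral_diff)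
    fix \<phi> assume \<phi>: "test_function \<phi>"
    have "(\<integral>r. u r * deriv \<phi> r \<partial>halfline) = (\<integral>r. U r * deriv \<phi> r \<partial>halfline)"
      using w wU \<phi> by (auto simp: has_weak_deriv_def)
    then show "(\<integral>r. (u r - U r) * deriv \<phi> r \<partial>halfline) = 0"
      unfolding left_diff_distrib using loc locU \<phi>
      by (subst Bochner_Integration.integral_diff) (auto intro: test_function_integrable test_function_deriv)
  qed
  then obtain c where c: "AE r in halfline. u r - U r = c" by blast
  have "primitive_of (\<lambda>r. U r + c) v"
    using U unfolding primitive_of_def by simp
  moreover have "AE r in halfline. u r = U r + c" using c by eventually_elim simp
  ultimately show ?thesis by (rule that)
qed

text \<open>
  The Sobolev space prescribes each \<open>u^(j)\<close> separately as a \<open>j\<close>-th weak derivative of \<open>u\<close>; testing with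
  derivatives of test functions shows that consecutive ones are related by a single weak derivative.
\<close>

lemma has_weak_deriv_Suc:
  assumes "has_weak_deriv j u v" "has_weak_deriv (Suc j) u v'"
  shows "has_weak_deriv 1 v v'"
  unfolding has_weak_deriv_def
proof (intro conjI allI impI)
  show "locally_integrable v" "locally_integrable v'" using assms by (auto simp: has_weak_deriv_def)
  fix \<phi> assume \<phi>: "test_function \<phi>"
  have "(- 1) ^ j * (\<integral>r. v r * deriv \<phi> r \<partial>halfline) = (\<integral>r. u r * (deriv ^^ j) (deriv \<phi>) r \<partial>halfline)"
    using assms(1) test_function_deriv[OF \<phi>] by (auto simp: has_weak_deriv_def)
  also have "\<dots> = (\<integral>r. u r * (deriv ^^ Suc j) \<phi> r \<partial>halfline)"
    by (simp add: funpow_Suc_right del: funpow.simps)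
  also have "\<dots> = (- 1) ^ Suc j * (\<integral>r. v' r * \<phi> r \<partial>halfline)"
    using assms(2) \<phi> unfolding has_weak_deriv_def by blast
  finally show "(\<integral>r. v r * (deriv ^^ 1) \<phi> r \<partial>halfline) = (- 1) ^ 1 * (\<integral>r. v' r * \<phi> r \<partial>halfline)"
    by (cases "even j") auto
qed

section \<open>A sharp Hardy inequality in the logarithmic scale\<close>

text \<open>
  The odd power: \<open>p\<close> times \<open>spow (p - 1)\<close> is the derivative of \<open>|x|^p\<close>.
\<close>

definition spow :: "real \<Rightarrow> real \<Rightarrow> real" where
  "spow q x = \<bar>x\<bar> powr q * sgn x"

lemma abs_spow: "\<bar>spow q x\<bar> = \<bar>x\<bar> powr q"
  by (simp add: spow_def abs_mult abs_sgn_eq)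

lemma spow_mult: "spow q (x * y) = spow q x * spow q y"
  by (simp add: spow_def abs_mult powr_mult sgn_mult)

lemma spow_mono:
  assumes "0 < q" "x \<le> y" shows "spow q x \<le> spow q y"
proof -
  consider "0 \<le> x" | "x < 0" "0 \<le> y" | "y < 0" by linarith
  then show ?thesis
  proof cases
    case 1 then show ?thesis using assms by (auto simp: spow_def sgn_if intro: powr_mono2)
  next
    case 2 then show ?thesis by (auto simp: spow_def sgn_if intro: order_trans[of _ 0])
  next
    case 3 then show ?thesis using assms by (auto simp: spow_def sgn_if intro: powr_mono2)
  qed
qed

lemma continuous_spow:
  assumes "0 < q" shows "continuous_on UNIV (spow q)"
proof -
  have "isCont (spow q) x" for x
  proof -
    consider "x > 0" | "x < 0" | "x = 0" by linarith
    then show ?thesis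
    proof cases
      case 1
      have "isCont (\<lambda>x. x powr q) x" using 1 by (intro continuous_intros) auto
      moreover have "eventually (\<lambda>y. spow q y = y powr q) (nhds x)"
        using eventually_nhds_in_open[of "{0<..}" x] 1
        by (auto simp: spow_def elim!: eventually_mono)
      ultimately show ?thesis by (simp add: isCont_cong)
    next
      case 2
      have "isCont (\<lambda>x. - ((- x) powr q)) x" using 2 by (intro continuous_intros) auto
      moreover have "eventually (\<lambda>y. spow q y = - ((- y) powr q)) (nhds x)"
        using eventually_nhds_in_open[of "{..<0}" x] 2
        by (auto simp: spow_def elim!: eventually_mono)
      ultimately show ?thesis by (simp add: isCont_cong)
    next
      case 3
      have "((\<lambda>y. \<bar>y\<bar> powr q) \<longlongrightarrow> \<bar>0\<bar> powr q) (at (0::real))"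
        using assms by (intro tendsto_intros) auto
      then have "(spow q \<longlongrightarrow> 0) (at 0)"
        by (intro tendsto_rabs_zero_cancel[of "spow q"]) (simp add: abs_spow)
      then show ?thesis using 3 by (simp add: isCont_def spow_def)
    qed
  qed
  then show ?thesis by (simp add: continuous_at_imp_continuous_on)
qed

lemma DERIV_abs_powr:
  assumes "1 < p"
  shows "((\<lambda>x. \<bar>x\<bar> powr p) has_real_derivative p * spow (p - 1) x) (at x)"
proof -
  consider "x > 0" | "x < 0" | "x = 0" by linarith
  then show ?thesis
  proof cases
    case 1
    have "((\<lambda>x. x powr p) has_real_derivative p * spow (p - 1) x) (at x)"
      using has_real_derivative_powr[OF 1, of p] 1 by (simp add: spow_def)
    then show ?thesis
      by (rule has_field_derivative_transform_within_open[where S = "{0<..}"]) (use 1 in auto)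
  next
    case 2
    have "((\<lambda>x. (- x) powr p) has_real_derivative p * (- x) powr (p - 1) * (- 1)) (at x)"
      using 2 by (intro DERIV_chain2[OF has_real_derivative_powr]) (auto intro!: derivative_eq_intros)
    then have "((\<lambda>x. (- x) powr p) has_real_derivative p * spow (p - 1) x) (at x)"
      using 2 by (simp add: spow_def)
    then show ?thesis
      by (rule has_field_derivative_transform_within_open[where S = "{..<0}"]) (use 2 in auto)
  next
    case 3
    have "((\<lambda>h. \<bar>h\<bar> powr (p - 1)) \<longlongrightarrow> \<bar>0\<bar> powr (p - 1)) (at (0::real))"
      using assms by (intro tendsto_intros) auto
    moreover have "\<bar>\<bar>h\<bar> powr p / h\<bar> = \<bar>h\<bar> powr (p - 1)" for h :: real
      by (cases "h = 0") (simp_all add: abs_divide powr_diff)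
    ultimately have "((\<lambda>h. \<bar>h\<bar> powr p / h) \<longlongrightarrow> 0) (at 0)"
      by (intro tendsto_rabs_zero_cancel[of "\<lambda>h. \<bar>h\<bar> powr p / h"]) simp
    then show ?thesis using 3 by (simp add: DERIV_def spow_def)
  qed
qed

text \<open>
  Convexity of \<open>|x|^p\<close>. This one pointwise inequality yields the Hardy inequality and the
  logarithmic Hoelder inequality below, both with sharp constants.
\<close>

lemma abs_powr_above_tangent:
  assumes "1 < p"
  shows "\<bar>x\<bar> powr p + p * spow (p - 1) x * y \<le> \<bar>x + y\<bar> powr p"
proof -
  consider "y = 0" | "y > 0" | "y < 0" by linarith
  then show ?thesis
  proof cases
    case 2
    then obtain z where z: "x < z" "z < x + y" "\<bar>x + y\<bar> powr p - \<bar>x\<bar> powr p = (x + y - x) * (p * spow (p - 1) z)"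
      using MVT2[of x "x + y" "\<lambda>x. \<bar>x\<bar> powr p" "\<lambda>x. p * spow (p - 1) x"] DERIV_abs_powr[OF assms] by auto
    have "p * spow (p - 1) x * y \<le> p * spow (p - 1) z * y"
      using spow_mono[of "p - 1" x z] z 2 assms by (intro mult_right_mono mult_left_mono) auto
    then show ?thesis using z(3) by (simp add: algebra_simps)
  next
    case 3
    then obtain z where z: "x + y < z" "z < x" "\<bar>x\<bar> powr p - \<bar>x + y\<bar> powr p = (x - (x + y)) * (p * spow (p - 1) z)"
      using MVT2[of "x + y" x "\<lambda>x. \<bar>x\<bar> powr p" "\<lambda>x. p * spow (p - 1) x"] DERIV_abs_powr[OF assms] by auto
    have "p * spow (p - 1) x * y \<le> p * spow (p - 1) z * y"
      using spow_mono[of "p - 1" z x] z 3 assms by (intro mult_right_mono_neg mult_left_mono) auto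
    then show ?thesis using z(3) by (simp add: algebra_simps)
  qed auto
qed

lemma primitive_of_abs_powr:
  assumes "1 < p" "primitive_of g g'"
  shows "primitive_of (\<lambda>r. \<bar>g r\<bar> powr p) (\<lambda>r. p * spow (p - 1) (g r) * g' r)"
  by (rule primitive_of_chain[OF assms(2) DERIV_abs_powr[OF assms(1)]])
    (use assms(1) in \<open>intro continuous_intros continuous_spow, simp\<close>)

text \<open>
  Apply the tangent inequality with \<open>x = c g\<close> and \<open>y = r g'\<close>: after division by \<open>r\<close> the mixed term is, up
  to a constant, the derivative of \<open>|g|^p\<close>. Keeping the boundary values gives a version that applies
  near the origin before \<open>g\<close> is known to have finite energy there.
\<close>

lemma hardy_Icc:
  assumes p: "1 < p" and g: "primitive_of g g'" and ab: "0 < a" "a \<le> b"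
    and int: "(\<lambda>r. \<bar>r * g' r + c * g r\<bar> powr p / r) integrable_on {a..b}"
  shows "\<bar>c\<bar> powr p * integral {a..b} (\<lambda>r. \<bar>g r\<bar> powr p / r)
      + spow (p - 1) c * (\<bar>g b\<bar> powr p - \<bar>g a\<bar> powr p)
    \<le> integral {a..b} (\<lambda>r. \<bar>r * g' r + c * g r\<bar> powr p / r)"
proof -
  have cg: "continuous_on {a..b} g"
    using ab by (intro primitive_of_continuous[OF g]) auto
  have "continuous_on {a..b} (\<lambda>r. \<bar>g r\<bar> powr p / r)"
    using ab p by (intro continuous_intros cg continuous_on_powr') auto
  then have i1: "(\<lambda>r. \<bar>g r\<bar> powr p / r) integrable_on {a..b}" by (rule integrable_continuous_real)
  note pr = primitive_of_abs_powr[OF p g]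
  have i2: "(\<lambda>r. p * spow (p - 1) (g r) * g' r) integrable_on {a..b}"
    by (rule primitive_of_integrable[OF pr ab(1)])
  have "\<bar>c\<bar> powr p * integral {a..b} (\<lambda>r. \<bar>g r\<bar> powr p / r)
      + spow (p - 1) c * (\<bar>g b\<bar> powr p - \<bar>g a\<bar> powr p)
    = integral {a..b} (\<lambda>r. \<bar>c\<bar> powr p * (\<bar>g r\<bar> powr p / r)
      + spow (p - 1) c * (p * spow (p - 1) (g r) * g' r))"
    using integral_add[OF integrable_on_mult_right[OF i1] integrable_on_mult_right[OF i2],
        of "\<bar>c\<bar> powr p" "spow (p - 1) c"] primitive_of_eq[OF pr ab]
    by (simp only: integral_mult_right)
  also have "\<dots> \<le> integral {a..b} (\<lambda>r. \<bar>r * g' r + c * g r\<bar> powr p / r)"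
  proof (rule integral_le[OF _ int])
    show "(\<lambda>r. \<bar>c\<bar> powr p * (\<bar>g r\<bar> powr p / r)
      + spow (p - 1) c * (p * spow (p - 1) (g r) * g' r)) integrable_on {a..b}"
      by (intro integrable_add integrable_on_mult_right i1 i2)
    fix r assume "r \<in> {a..b}"
    then have r: "0 < r" using ab by auto
    have "(\<bar>c * g r\<bar> powr p + p * spow (p - 1) (c * g r) * (r * g' r)) / r \<le> \<bar>c * g r + r * g' r\<bar> powr p / r"
      using abs_powr_above_tangent[OF p] r by (intro divide_right_mono) auto
    then show "\<bar>c\<bar> powr p * (\<bar>g r\<bar> powr p / r) + spow (p - 1) c * (p * spow (p - 1) (g r) * g' r)
        \<le> \<bar>r * g' r + c * g r\<bar> powr p / r"
      using r by (simp add: spow_mult abs_mult powr_mult add.commute add_divide_distrib mult_ac)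
  qed
  finally show ?thesis .
qed

lemma integrable_halfline_if_bounded:
  fixes h :: "real \<Rightarrow> real"
  assumes int: "\<And>x y. 0 < x \<Longrightarrow> x \<le> y \<Longrightarrow> h integrable_on {x..y}"
    and B: "\<And>x y. 0 < x \<Longrightarrow> x \<le> y \<Longrightarrow> integral {x..y} h \<le> B"
    and nonneg: "\<And>r. 0 < r \<Longrightarrow> 0 \<le> h r"
  shows "h integrable_on {0<..}" and "integral {0<..} h \<le> (B::real)"
proof -
  define I where "I k = {1 / real (Suc k)..real (Suc k)}" for k
  have I: "I k \<subseteq> {0<..}" for k
    unfolding I_def by (auto intro: less_le_trans[of 0 "1 / real (Suc k)"])
  have le: "1 / real (Suc k) \<le> real (Suc k)" for k
    by (simp add: field_simps)
  have Ik: "h integrable_on I k" "integral (I k) h \<le> B" for k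
    unfolding I_def using le by (auto intro!: int B simp del: of_nat_Suc)
  let ?f = "\<lambda>k r. if r \<in> I k then h r else 0"
  have fk: "?f k integrable_on {0<..}" "integral {0<..} (?f k) = integral (I k) h" for k
    using I[of k] Ik(1)[of k] by (auto simp: integrable_restrict_Int integral_restrict_Int Int_absorb2 Int_absorb1)
  have "h integrable_on {0<..} \<and> (\<lambda>k. integral {0<..} (?f k)) \<longlonglongrightarrow> integral {0<..} h"
  proof (rule monotone_convergence_increasing[OF fk(1)])
    fix k and r :: real assume r: "r \<in> {0<..}"
    have "1 / real (Suc (Suc k)) \<le> 1 / real (Suc k)" by (simp add: frac_le)
    then have "I k \<subseteq> I (Suc k)" by (auto simp: I_def)
    then show "?f k r \<le> ?f (Suc k) r" using nonneg[of r] r by auto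
  next
    fix r :: real assume r: "r \<in> {0<..}"
    obtain n where n: "max r (1 / r) < real n" using reals_Archimedean2 by blast
    have "r \<in> I k" if "k \<ge> n" for k
    proof -
      have "max r (1 / r) < real (Suc k)" using n that by linarith
      then show ?thesis using r by (auto simp: I_def field_simps)
    qed
    then have "eventually (\<lambda>k. h r = ?f k r) sequentially"
      by (auto simp: eventually_sequentially)
    then show "(\<lambda>k. ?f k r) \<longlonglongrightarrow> h r" by (rule Lim_transform_eventually[OF tendsto_const])
  next
    have "0 \<le> integral (I k) h" for k using I[of k] nonneg by (intro integral_nonneg Ik(1)) auto
    then show "bounded (range (\<lambda>k. integral {0<..} (?f k)))"
      unfolding fk(2) using Ik(2) by (intro boundedI[of _ B]) auto
  qed
  then show "h integrable_on {0<..}" and "integral {0<..} h \<le> B"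
    using LIMSEQ_le_const2[of "\<lambda>k. integral {0<..} (?f k)" "integral {0<..} h" B] Ik(2)
    unfolding fk(2) by auto
qed

definition Lp_log :: "real \<Rightarrow> (real \<Rightarrow> real) \<Rightarrow> bool" where
  "Lp_log p g \<longleftrightarrow> g \<in> borel_measurable halfline \<and> (\<lambda>r. \<bar>g r\<bar> powr p / r) integrable_on {0<..}"

definition log_energy :: "real \<Rightarrow> (real \<Rightarrow> real) \<Rightarrow> real" where
  "log_energy p g = integral {0<..} (\<lambda>r. \<bar>g r\<bar> powr p / r)"

lemma Lp_log_Icc:
  assumes "Lp_log p g" "0 < a"
  shows "(\<lambda>r. \<bar>g r\<bar> powr p / r) integrable_on {a..b}"
    and "integral {a..b} (\<lambda>r. \<bar>g r\<bar> powr p / r) \<le> log_energy p g"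
proof -
  have 1: "(\<lambda>r. \<bar>g r\<bar> powr p / r) integrable_on {0<..}" using assms by (simp add: Lp_log_def)
  have sub: "{a..b} \<subseteq> {0<..}" using assms by auto
  show 2: "(\<lambda>r. \<bar>g r\<bar> powr p / r) integrable_on {a..b}"
    using integrable_on_subinterval[OF 1 sub] .
  show "integral {a..b} (\<lambda>r. \<bar>g r\<bar> powr p / r) \<le> log_energy p g"
    unfolding log_energy_def by (rule integral_subset_le[OF sub 2 1]) auto
qed

lemma Lp_log_cong:
  assumes "Lp_log p f" "\<And>r. 0 < r \<Longrightarrow> f r = h r"
  shows "Lp_log p h" and "log_energy p h = log_energy p f"
proof -
  show "Lp_log p h"
    unfolding Lp_log_def
  proof
    show "h \<in> borel_measurable halfline"
      using assms measurable_lebesgue_cong[of "{0<..}" f h] unfolding Lp_log_def by auto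
    show "(\<lambda>r. \<bar>h r\<bar> powr p / r) integrable_on {0<..}"
      by (rule integrable_eq[of "\<lambda>r. \<bar>f r\<bar> powr p / r"]) (use assms in \<open>auto simp: Lp_log_def\<close>)
  qed
  show "log_energy p h = log_energy p f"
    unfolding log_energy_def by (rule integral_cong) (use assms in auto)
qed

lemma Lp_log_lincomb:
  assumes p: "0 < p" and f: "Lp_log p f" and g: "Lp_log p g"
  shows "Lp_log p (\<lambda>r. a * f r + b * g r)"
proof -
  have m [measurable]: "f \<in> borel_measurable halfline" "g \<in> borel_measurable halfline"
    using f g by (auto simp: Lp_log_def)
  let ?B = "\<lambda>r. (2 * \<bar>a\<bar>) powr p * (\<bar>f r\<bar> powr p / r) + (2 * \<bar>b\<bar>) powr p * (\<bar>g r\<bar> powr p / r)"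
  have "(\<lambda>r. \<bar>a * f r + b * g r\<bar> powr p / r) absolutely_integrable_on {0<..}"
  proof (rule measurable_bounded_by_integrable_imp_absolutely_integrable)
    show "(\<lambda>r. \<bar>a * f r + b * g r\<bar> powr p / r) \<in> borel_measurable halfline" by measurable
    show "?B integrable_on {0<..}"
      using f g by (intro integrable_add integrable_on_mult_right) (auto simp: Lp_log_def)
    fix r :: real assume "r \<in> {0<..}"
    then have r: "0 < r" by simp
    have "\<bar>a * f r + b * g r\<bar> \<le> max (2 * \<bar>a\<bar> * \<bar>f r\<bar>) (2 * \<bar>b\<bar> * \<bar>g r\<bar>)"
      using abs_triangle_ineq[of "a * f r" "b * g r"] unfolding abs_mult by linarith
    then have "\<bar>a * f r + b * g r\<bar> powr p \<le> max (2 * \<bar>a\<bar> * \<bar>f r\<bar>) (2 * \<bar>b\<bar> * \<bar>g r\<bar>) powr p"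
      using p by (intro powr_mono2) auto
    also have "\<dots> \<le> (2 * \<bar>a\<bar> * \<bar>f r\<bar>) powr p + (2 * \<bar>b\<bar> * \<bar>g r\<bar>) powr p"
      by (auto simp: max_def)
    finally have "\<bar>a * f r + b * g r\<bar> powr p / r \<le> ((2 * \<bar>a\<bar> * \<bar>f r\<bar>) powr p + (2 * \<bar>b\<bar> * \<bar>g r\<bar>) powr p) / r"
      using r by (intro divide_right_mono) auto
    then show "norm (\<bar>a * f r + b * g r\<bar> powr p / r) \<le> ?B r"
      using r by (simp add: powr_mult add_divide_distrib)
  qed simp
  then show ?thesis using set_lebesgue_integral_eq_integral(1) by (auto simp: Lp_log_def)
qed

lemma integral_inverse_Icc:
  fixes a b :: real
  assumes "0 < a" "a \<le> b"
  shows "((\<lambda>r. 1 / r) has_integral ln b - ln a) {a..b}"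
proof -
  have "primitive_of ln (\<lambda>r. 1 / r)"
    by (rule primitive_of_C1) (auto intro!: derivative_eq_intros continuous_intros)
  then show ?thesis by (rule primitive_of_has_integral[OF _ assms])
qed

text \<open>
  The measure \<open>dr/r\<close> is infinite near \<open>0\<close> and near \<open>\<infinity>\<close>: a lower bound for \<open>|g|^p\<close> on a logarithmic
  interval of length \<open>T\<close> would exceed the available energy.
\<close>

lemma Lp_log_small_value:
  assumes g: "Lp_log p g" and e: "0 < e" and x: "0 < x"
  shows "\<exists>a. 0 < a \<and> a \<le> x \<and> \<bar>g a\<bar> powr p < e" and "\<exists>b\<ge>x. \<bar>g b\<bar> powr p < e"
proof -
  define T where "T = (log_energy p g + 1) / e"
  have pos: "0 \<le> log_energy p g"
    unfolding log_energy_def by (rule integral_nonneg) (use g in \<open>auto simp: Lp_log_def\<close>)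
  then have T: "T > 0" "e * T > log_energy p g" using e by (auto simp: T_def field_simps)
  \<comment> \<open>\<open>T\<close> exceeds the energy divided by \<open>e\<close>\<close>
  have key: "\<exists>r\<in>{a..b}. \<bar>g r\<bar> powr p < e" if ab: "0 < a" "a \<le> b" "ln b - ln a = T" for a b
  proof (rule ccontr)
    assume "\<not> ?thesis"
    then have ge: "\<And>r. r \<in> {a..b} \<Longrightarrow> e \<le> \<bar>g r\<bar> powr p" by force
    have "e * (ln b - ln a) \<le> integral {a..b} (\<lambda>r. \<bar>g r\<bar> powr p / r)"
    proof (rule has_integral_le)
      show "((\<lambda>r. e * (1 / r)) has_integral e * (ln b - ln a)) {a..b}"
        by (intro has_integral_mult_right integral_inverse_Icc ab)
      show "((\<lambda>r. \<bar>g r\<bar> powr p / r) has_integral integral {a..b} (\<lambda>r. \<bar>g r\<bar> powr p / r)) {a..b}"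
        using Lp_log_Icc(1)[OF g ab(1)] by (rule integrable_integral)
      show "e * (1 / r) \<le> \<bar>g r\<bar> powr p / r" if "r \<in> {a..b}" for r
        using ge[OF that] that ab by (simp add: divide_right_mono)
    qed
    then show False using Lp_log_Icc(2)[OF g ab(1), of b] T ab(3) by simp
  qed
  have 1: "0 < x * exp (- T)" "x * exp (- T) \<le> x" "ln x - ln (x * exp (- T)) = T"
    using x T by (auto simp: ln_mult)
  show "\<exists>a. 0 < a \<and> a \<le> x \<and> \<bar>g a\<bar> powr p < e"
    using key[OF 1] 1(1) by (meson atLeastAtMost_iff less_le_trans)
  have 2: "0 < x" "x \<le> x * exp T" "ln (x * exp T) - ln x = T"
    using x T by (auto simp: ln_mult)
  show "\<exists>b\<ge>x. \<bar>g b\<bar> powr p < e"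
    using key[OF 2] by auto
qed

text \<open>
  The case of negative \<open>c\<close> is as good as that of positive \<open>c\<close>, because the boundary values vanish along
  suitable sequences at both ends. The constant is sharp: \<open>1 / |c|\<close> is the norm of the inverse of
  \<open>D + c\<close>.
\<close>

lemma hardy_log:
  assumes p: "1 < p" and prim: "primitive_of g g'" and g: "Lp_log p g"
    and h: "Lp_log p (\<lambda>r. r * g' r + c * g r)"
  shows "\<bar>c\<bar> powr p * log_energy p g \<le> log_energy p (\<lambda>r. r * g' r + c * g r)"
proof (cases "c = 0")
  case True
  have "0 \<le> log_energy p (\<lambda>r. r * g' r + c * g r)"
    unfolding log_energy_def by (rule integral_nonneg) (use h in \<open>auto simp: Lp_log_def\<close>)
  then show ?thesis using True by simp
next
  case False
  let ?N = "log_energy p (\<lambda>r. r * g' r + c * g r)" and ?k = "\<bar>c\<bar> powr (p - 1)"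
  have k: "0 < ?k" using False by simp
  have cp: "0 < \<bar>c\<bar> powr p" using False by simp
  have bd: "integral {x..y} (\<lambda>r. \<bar>g r\<bar> powr p / r) \<le> ?N / \<bar>c\<bar> powr p" if xy: "0 < x" "x \<le> y" for x y
  proof -
    have "\<bar>c\<bar> powr p * integral {x..y} (\<lambda>r. \<bar>g r\<bar> powr p / r) \<le> ?N + e" if e: "e > 0" for e
    proof -
      obtain a where a: "0 < a" "a \<le> x" "\<bar>g a\<bar> powr p < e / ?k"
        using Lp_log_small_value(1)[OF g _ xy(1), of "e / ?k"] e k by auto
      obtain b where b: "y \<le> b" "\<bar>g b\<bar> powr p < e / ?k"
        using Lp_log_small_value(2)[OF g, of "e / ?k" y] e k xy by auto
      have ab: "a \<le> b" using a b xy by auto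
      have "integral {x..y} (\<lambda>r. \<bar>g r\<bar> powr p / r) \<le> integral {a..b} (\<lambda>r. \<bar>g r\<bar> powr p / r)"
        using a b xy by (intro integral_subset_le Lp_log_Icc(1)[OF g]) auto
      then have "\<bar>c\<bar> powr p * integral {x..y} (\<lambda>r. \<bar>g r\<bar> powr p / r)
          \<le> \<bar>c\<bar> powr p * integral {a..b} (\<lambda>r. \<bar>g r\<bar> powr p / r)" using cp by simp
      also have "\<dots> \<le> ?N - spow (p - 1) c * (\<bar>g b\<bar> powr p - \<bar>g a\<bar> powr p)"
        using hardy_Icc[OF p prim a(1) ab Lp_log_Icc(1)[OF h a(1)]] Lp_log_Icc(2)[OF h a(1), of b] by linarith
      also have "- (spow (p - 1) c * (\<bar>g b\<bar> powr p - \<bar>g a\<bar> powr p)) \<le> ?k * (e / ?k)"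
      proof -
        have "\<bar>\<bar>g b\<bar> powr p - \<bar>g a\<bar> powr p\<bar> \<le> e / ?k" using a b by (simp add: abs_le_iff) (smt (verit) powr_ge_zero)
        then have "\<bar>spow (p - 1) c * (\<bar>g b\<bar> powr p - \<bar>g a\<bar> powr p)\<bar> \<le> ?k * (e / ?k)"
          unfolding abs_mult abs_spow using k by (intro mult_left_mono) auto
        then show ?thesis by linarith
      qed
      then have "?N - spow (p - 1) c * (\<bar>g b\<bar> powr p - \<bar>g a\<bar> powr p) \<le> ?N + e" using k by simp
      finally show ?thesis .
    qed
    then have "\<bar>c\<bar> powr p * integral {x..y} (\<lambda>r. \<bar>g r\<bar> powr p / r) \<le> ?N" by (rule field_le_epsilon)
    then show ?thesis using cp by (simp add: field_simps)
  qed
  have "log_energy p g \<le> ?N / \<bar>c\<bar> powr p"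
    unfolding log_energy_def[of p g]
    by (rule integrable_halfline_if_bounded(2)[OF Lp_log_Icc(1)[OF g] bd]) auto
  then show ?thesis using cp by (simp add: field_simps)
qed

text \<open>
  \<open>n\<close> logarithmic derivatives \<open>D = r d/dr\<close> exist and have finite energy: the Sobolev space of order \<open>n\<close>
  of the real line in the variable \<open>log r\<close>.
\<close>

primrec log_regular :: "real \<Rightarrow> nat \<Rightarrow> (real \<Rightarrow> real) \<Rightarrow> bool" where
  "log_regular p 0 f \<longleftrightarrow> Lp_log p f"
| "log_regular p (Suc n) f \<longleftrightarrow> Lp_log p f \<and> (\<exists>f'. primitive_of f f' \<and> log_regular p n (\<lambda>r. r * f' r))"

lemma log_regular_Lp_log: "log_regular p n f \<Longrightarrow> Lp_log p f"
  by (cases n) auto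

lemma log_regular_Suc_imp: "log_regular p (Suc n) f \<Longrightarrow> log_regular p n f"
  by (induction n arbitrary: f) auto

lemma primitive_of_cong:
  assumes "primitive_of U V" "\<And>r. 0 < r \<Longrightarrow> U r = U' r" "\<And>r. 0 < r \<Longrightarrow> V r = V' r"
  shows "primitive_of U' V'"
proof -
  have "primitive_of U V'"
    by (rule primitive_of_cong_AE[OF assms(1)]) (use assms(3) in auto)
  then show ?thesis using assms(2) by (auto simp: primitive_of_def)
qed

lemma log_regular_cong:
  assumes "log_regular p n f" "\<And>r. 0 < r \<Longrightarrow> f r = h r"
  shows "log_regular p n h"
proof (cases n)
  case 0
  then show ?thesis using assms Lp_log_cong(1) by auto
next
  case (Suc m)
  then obtain f' where f': "primitive_of f f'" "log_regular p m (\<lambda>r. r * f' r)" "Lp_log p f"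
    using assms(1) by auto
  have "primitive_of h f'" by (rule primitive_of_cong[OF f'(1) assms(2)]) auto
  then show ?thesis using Suc f' Lp_log_cong(1)[OF f'(3) assms(2)] by auto
qed

lemma log_regular_lincomb:
  assumes p: "0 < p"
  shows "log_regular p n f \<Longrightarrow> log_regular p n g \<Longrightarrow> log_regular p n (\<lambda>r. a * f r + b * g r)"
proof (induction n arbitrary: f g)
  case 0
  then show ?case by (simp add: Lp_log_lincomb[OF p])
next
  case (Suc n)
  then obtain f' g' where f': "primitive_of f f'" "log_regular p n (\<lambda>r. r * f' r)" "Lp_log p f"
    and g': "primitive_of g g'" "log_regular p n (\<lambda>r. r * g' r)" "Lp_log p g" by auto
  have "log_regular p n (\<lambda>r. a * (r * f' r) + b * (r * g' r))"
    by (rule Suc.IH[OF f'(2) g'(2)])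
  then have "log_regular p n (\<lambda>r. r * (a * f' r + b * g' r))" by (simp add: algebra_simps)
  moreover have "primitive_of (\<lambda>r. a * f r + b * g r) (\<lambda>r. a * f' r + b * g' r)"
    by (intro primitive_of_add primitive_of_cmult f' g')
  ultimately show ?case using Lp_log_lincomb[OF p f'(3) g'(3)] by auto
qed

text \<open>
  Differentiating \<open>r^a f\<close> gives \<open>r^(a-1) (D f + a f)\<close>. The hypothesis holds only almost everywhere,
  because the functions to which this is applied are weak derivatives or products with them.
\<close>

lemma weak_deriv_powr_step:
  assumes p: "1 < p" and f: "log_regular p (Suc n) f" and W: "AE r in halfline. W r = r powr a * f r"
  shows "\<exists>h. log_regular p n h \<and> (AE r in halfline. weak_deriv W r = r powr (a - 1) * h r)
    \<and> \<bar>a\<bar> powr p * log_energy p f \<le> log_energy p h"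
proof -
  obtain f' where f': "primitive_of f f'" "log_regular p n (\<lambda>r. r * f' r)" "Lp_log p f"
    using f by auto
  define h where "h r = r * f' r + a * f r" for r
  have h: "log_regular p n h"
    using log_regular_lincomb[OF _ f'(2) log_regular_Suc_imp[OF f], of 1 a] p unfolding h_def by simp
  have "AE r in halfline. weak_deriv W r = a * r powr (a - 1) * f r + r powr a * f' r"
    by (rule weak_deriv_primitive_AE[OF primitive_of_mult[OF primitive_of_powr f'(1)] W])
  then have "AE r in halfline. weak_deriv W r = r powr (a - 1) * h r"
  proof (rule lebesgue_on_mono)
    fix r :: real assume "weak_deriv W r = a * r powr (a - 1) * f r + r powr a * f' r" and "r \<in> {0<..}"
    then show "weak_deriv W r = r powr (a - 1) * h r"
      by (simp add: h_def powr_diff field_simps)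
  qed
  moreover have "\<bar>a\<bar> powr p * log_energy p f \<le> log_energy p h"
    using hardy_log[OF p f'(1) f'(3), of a] log_regular_Lp_log[OF h] unfolding h_def by simp
  ultimately show ?thesis using h by blast
qed

section \<open>From the Sobolev space to the first derivative\<close>

lemma abs_powr_mult_div:
  fixes r x a p :: real
  assumes "0 < r"
  shows "\<bar>r powr a * x\<bar> powr p / r = \<bar>x\<bar> powr p * r powr (a * p - 1)"
  using assms by (simp add: abs_mult powr_mult powr_powr powr_diff)

lemma weighted_integrable_on:
  fixes f :: "real \<Rightarrow> real"
  assumes f: "f \<in> borel_measurable halfline"
    and fin: "(\<integral>\<^sup>+ r. ennreal (\<bar>f r\<bar> powr p * r powr a) \<partial>halfline) < top"
  shows "(\<lambda>r. \<bar>f r\<bar> powr p * r powr a) integrable_on {0<..}"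
proof -
  note [measurable] = f
  have "integrable halfline (\<lambda>r. \<bar>f r\<bar> powr p * r powr a)"
    by (rule integrableI_nonneg) (use fin in \<open>auto simp: less_top\<close>)
  then show ?thesis by (rule integrable_on_lebesgue_on) simp
qed

text \<open>
  With \<open>g j = r^j u^(j)\<close> one has \<open>D (g j) - j (g j) = g (j + 1)\<close>. For \<open>j = k\<close> the energy of \<open>g j\<close> is the
  given norm. Going down from \<open>j + 1\<close> to \<open>j\<close>, Hardy's inequality on \<open>[x, 1]\<close> with \<open>c = - j\<close> bounds the
  energy near the origin: the boundary term at \<open>x\<close> has the favourable sign. On \<open>[1, \<infinity>)\<close> the given weight
  \<open>\<alpha> j \<ge> j p - 1\<close> dominates the critical one.
\<close>

lemma X_space_imp_log_regular:
  assumes p: "1 < p" and k: "1 \<le> k" and \<alpha>k: "\<alpha> k = real k * p - 1"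
    and \<alpha>: "\<And>i. 1 \<le> i \<Longrightarrow> i \<le> k \<Longrightarrow> real i * p - 1 \<le> \<alpha> i"
    and u: "u \<in> X_space k p \<alpha>"
  obtains U V where "primitive_of U V" "AE r in halfline. u r = U r"
    "log_regular p (k - 1) (\<lambda>r. r powr 1 * V r)"
proof -
  from u have "\<forall>j\<in>{..k}. \<exists>v. has_weak_deriv j u v \<and> v \<in> Lp_space p (\<alpha> j)"
    by (simp add: X_space_def)
  then obtain v where v: "\<forall>j\<in>{..k}. has_weak_deriv j u (v j) \<and> v j \<in> Lp_space p (\<alpha> j)"
    by (rule bchoice[THEN exE])
  \<comment> \<open>the weak derivative of order \<open>0\<close> is only almost everywhere equal to \<open>u\<close>, so \<open>u\<close> itself is taken\<close>
  define w where "w j = (if j = 0 then u else v j)" for j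
  have w: "has_weak_deriv j u (w j)" if "j \<le> k" for j
    using v that by (cases "j = 0") (auto simp: w_def has_weak_deriv_def)
  have "\<forall>j\<in>{..<k}. \<exists>U. primitive_of U (w (Suc j)) \<and> (AE r in halfline. w j r = U r)"
  proof
    fix j assume "j \<in> {..<k}"
    then have "has_weak_deriv 1 (w j) (w (Suc j))"
      by (intro has_weak_deriv_Suc[OF w w]) auto
    then show "\<exists>U. primitive_of U (w (Suc j)) \<and> (AE r in halfline. w j r = U r)"
      using has_weak_deriv_imp_primitive by blast
  qed
  then obtain U where U: "\<forall>j\<in>{..<k}. primitive_of (U j) (w (Suc j)) \<and> (AE r in halfline. w j r = U j r)"
    by (rule bchoice[THEN exE])
  define G where "G j = (if j < k then U j else w j)" for j
  have wG: "AE r in halfline. G j r = w j r" if "j \<le> k" for j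
  proof (cases "j < k")
    case True
    then have "AE r in halfline. w j r = U j r" using U by blast
    then have "AE r in halfline. U j r = w j r" by eventually_elim simp
    then show ?thesis using True by (simp add: G_def)
  qed (simp add: G_def)
  have prim: "primitive_of (G j) (G (Suc j))" if "j < k" for j
  proof -
    have "primitive_of (G j) (w (Suc j))" using U that by (simp add: G_def)
    then show ?thesis by (rule primitive_of_cong_AE) (use wG[of "Suc j"] that in auto)
  qed
  have int: "(\<lambda>r. \<bar>G j r\<bar> powr p * r powr \<alpha> j) integrable_on {0<..}" and meas: "G j \<in> borel_measurable halfline"
    if j: "1 \<le> j" "j \<le> k" for j
  proof -
    have vj: "v j \<in> Lp_space p (\<alpha> j)" "w j = v j" using v j by (auto simp: w_def)
    show m: "G j \<in> borel_measurable halfline"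
    proof (cases "j < k")
      case True
      then show ?thesis
        by (intro continuous_imp_measurable_on_sets_lebesgue primitive_of_continuous[OF prim]) auto
    next
      case False
      then show ?thesis using vj by (simp add: G_def Lp_space_def)
    qed
    have "(\<integral>\<^sup>+ r. ennreal (\<bar>G j r\<bar> powr p * r powr \<alpha> j) \<partial>halfline)
      = (\<integral>\<^sup>+ r. ennreal (\<bar>v j r\<bar> powr p * r powr \<alpha> j) \<partial>halfline)"
    proof (rule nn_integral_cong_AE)
      show "AE r in halfline. ennreal (\<bar>G j r\<bar> powr p * r powr \<alpha> j) = ennreal (\<bar>v j r\<bar> powr p * r powr \<alpha> j)"
        using wG[OF j(2)] unfolding vj(2) by eventually_elim simp
    qed
    also have "\<dots> < top"
      using vj(1) by (auto simp: Lp_space_def Lp_norm_def epowr_def less_top split: if_splits)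
    finally show "(\<lambda>r. \<bar>G j r\<bar> powr p * r powr \<alpha> j) integrable_on {0<..}"
      by (rule weighted_integrable_on[OF m])
  qed
  define g where "g j r = r powr real j * G j r" for j r
  have g_prim: "primitive_of (g j) (\<lambda>r. real j * r powr (real j - 1) * G j r + r powr real j * G (Suc j) r)"
    if "j < k" for j
    unfolding g_def by (rule primitive_of_mult[OF primitive_of_powr prim[OF that]])
  have g_next: "r * (real j * r powr (real j - 1) * G j r + r powr real j * G (Suc j) r) = real j * g j r + g (Suc j) r"
    if "0 < r" for j r
    using that by (simp add: g_def powr_diff powr_add algebra_simps)
  have g_meas: "g j \<in> borel_measurable halfline" if "1 \<le> j" "j \<le> k" for j
  proof -
    note [measurable] = meas[OF that]
    show ?thesis unfolding g_def by measurable
  qed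
  have energy: "\<bar>g j r\<bar> powr p / r = \<bar>G j r\<bar> powr p * r powr (real j * p - 1)" if "0 < r" for j r
    unfolding g_def by (rule abs_powr_mult_div[OF that])
  have Lp: "Lp_log p (g j)" if "1 \<le> j" "j \<le> k" for j
    using that(2,1)
  proof (induction rule: inc_induct)
    case base
    have "(\<lambda>r. \<bar>g k r\<bar> powr p / r) integrable_on {0<..}"
      by (rule integrable_eq[OF int[OF k order_refl]]) (simp add: energy \<alpha>k)
    then show ?case using g_meas[OF k] by (simp add: Lp_log_def)
  next
    case (step j)
    then have j: "1 \<le> j" "j < k" and next_Lp: "Lp_log p (g (Suc j))" by auto
    let ?g' = "\<lambda>r. real j * r powr (real j - 1) * G j r + r powr real j * G (Suc j) r"
    let ?h = "\<lambda>r. \<bar>g j r\<bar> powr p / r"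
    define B1 where "B1 = (log_energy p (g (Suc j)) + \<bar>spow (p - 1) (- real j)\<bar> * \<bar>g j 1\<bar> powr p) / real j powr p"
    define B2 where "B2 = integral {0<..} (\<lambda>r. \<bar>G j r\<bar> powr p * r powr \<alpha> j)"
    have jp: "0 < real j powr p" using j by simp
    have next_eq: "r * ?g' r + (- real j) * g j r = g (Suc j) r" if "0 < r" for r
      using g_next[OF that, of j] by simp
    have h_int: "?h integrable_on {x..y}" if "0 < x" for x y
    proof (rule integrable_continuous_real)
      show "continuous_on {x..y} ?h"
        using that p by (intro continuous_intros continuous_on_powr' primitive_of_continuous[OF g_prim[OF j(2)]]) auto
    qed
    have near0: "integral {x..1} ?h \<le> B1" if x: "0 < x" "x \<le> 1" for x
    proof -
      have Lp': "Lp_log p (\<lambda>r. r * ?g' r + (- real j) * g j r)"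
        and en: "log_energy p (\<lambda>r. r * ?g' r + (- real j) * g j r) = log_energy p (g (Suc j))"
        using Lp_log_cong[OF next_Lp, of "\<lambda>r. r * ?g' r + (- real j) * g j r"] next_eq by simp_all
      have "real j powr p * integral {x..1} ?h + spow (p - 1) (- real j) * (\<bar>g j 1\<bar> powr p - \<bar>g j x\<bar> powr p)
          \<le> log_energy p (g (Suc j))"
        using hardy_Icc[OF p g_prim[OF j(2)] x Lp_log_Icc(1)[OF Lp' x(1)]] Lp_log_Icc(2)[OF Lp' x(1), of 1] en by simp
      moreover have "spow (p - 1) (- real j) \<le> 0" by (simp add: spow_def)
      then have "spow (p - 1) (- real j) * \<bar>g j x\<bar> powr p \<le> 0" by (intro mult_nonpos_nonneg) auto
      moreover have "- (spow (p - 1) (- real j) * \<bar>g j 1\<bar> powr p) = \<bar>spow (p - 1) (- real j)\<bar> * \<bar>g j 1\<bar> powr p"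
        using \<open>spow (p - 1) (- real j) \<le> 0\<close> by simp
      ultimately have "real j powr p * integral {x..1} ?h
          \<le> log_energy p (g (Suc j)) + \<bar>spow (p - 1) (- real j)\<bar> * \<bar>g j 1\<bar> powr p"
        by (simp only: right_diff_distrib)
      then show ?thesis using jp by (simp add: B1_def field_simps)
    qed
    have near_inf: "integral {1..y} ?h \<le> B2" for y
    proof -
      have sub: "{1..y} \<subseteq> {0<..}" by auto
      have i: "(\<lambda>r. \<bar>G j r\<bar> powr p * r powr \<alpha> j) integrable_on {0<..}" using int[of j] j by simp
      have "integral {1..y} ?h \<le> integral {1..y} (\<lambda>r. \<bar>G j r\<bar> powr p * r powr \<alpha> j)"
      proof (rule integral_le[OF h_int integrable_on_subinterval[OF i sub]])
        fix r assume r: "r \<in> {1..y}"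
        then have "r powr (real j * p - 1) \<le> r powr \<alpha> j" using \<alpha>[of j] j by (intro powr_mono) auto
        then show "?h r \<le> \<bar>G j r\<bar> powr p * r powr \<alpha> j"
          using r by (subst energy) (auto intro: mult_left_mono)
      qed simp
      also have "\<dots> \<le> B2" unfolding B2_def
        by (rule integral_subset_le[OF sub integrable_on_subinterval[OF i sub] i]) simp
      finally show ?thesis .
    qed
    have "?h integrable_on {0<..}"
    proof (rule integrable_halfline_if_bounded(1)[OF h_int])
      fix x y :: real assume xy: "0 < x" "x \<le> y"
      have "integral {x..y} ?h \<le> integral {min x 1..max y 1} ?h"
        using xy by (intro integral_subset_le h_int) auto
      also have "\<dots> = integral {min x 1..1} ?h + integral {1..max y 1} ?h"
        using xy by (intro Henstock_Kurzweil_Integration.integral_combine[symmetric] h_int) auto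
      also have "\<dots> \<le> B1 + B2" using near0[of "min x 1"] near_inf[of "max y 1"] xy by (intro add_mono) auto
      finally show "integral {x..y} ?h \<le> B1 + B2" .
    qed auto
    then show ?case using g_meas[of j] j by (simp add: Lp_log_def)
  qed
  have reg: "log_regular p n (g j)" if "1 \<le> j" "j + n \<le> k" for n j
    using that
  proof (induction n arbitrary: j)
    case 0
    then show ?case using Lp by simp
  next
    case (Suc n)
    have "log_regular p n (\<lambda>r. real j * g j r + 1 * g (Suc j) r)"
      using p Suc.prems by (intro log_regular_lincomb Suc.IH) auto
    then have "log_regular p n (\<lambda>r. r * (real j * r powr (real j - 1) * G j r + r powr real j * G (Suc j) r))"
      by (rule log_regular_cong) (simp only: g_next mult_1)
    then show ?case using Lp[of j] g_prim[of j] Suc.prems by auto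
  qed
  show ?thesis
  proof
    show "primitive_of (G 0) (G 1)" using prim[of 0] k by simp
    show "AE r in halfline. u r = G 0 r" using wG[of 0] by (simp add: w_def eq_commute)
    show "log_regular p (k - 1) (\<lambda>r. r powr 1 * G 1 r)"
      using reg[of 1 "k - 1"] k by (simp add: g_def[abs_def])
  qed
qed

text \<open>
  If \<open>W' = r^(- i \<delta> - 1) g\<close>, then \<open>r^\<gamma> W' = r^(\<gamma> - 1 - i \<delta>) g\<close>, so the outer derivative in \<open>L W\<close> contributes
  the factor \<open>D + (\<gamma> - 1 - i \<delta>)\<close>.
\<close>

lemma L_op_step:
  assumes p: "1 < p" and g: "log_regular p (Suc n) g"
    and W: "AE r in halfline. weak_deriv W r = r powr (- (i * (\<theta> + 2 - \<gamma>)) - 1) * g r"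
  shows "\<exists>h. log_regular p n h \<and> (AE r in halfline. L_op \<theta> \<gamma> W r = r powr (- ((i + 1) * (\<theta> + 2 - \<gamma>))) * h r)
    \<and> \<bar>\<gamma> - 1 - i * (\<theta> + 2 - \<gamma>)\<bar> powr p * log_energy p g \<le> log_energy p h"
proof -
  let ?d = "\<theta> + 2 - \<gamma>"
  have "AE r in halfline. r powr \<gamma> * weak_deriv W r = r powr (\<gamma> - 1 - i * ?d) * g r"
    using W by eventually_elim (simp add: mult.assoc[symmetric] powr_add[symmetric] algebra_simps)
  from weak_deriv_powr_step[OF p g this] obtain h where h: "log_regular p n h"
    "AE r in halfline. weak_deriv (\<lambda>s. s powr \<gamma> * weak_deriv W s) r = r powr (\<gamma> - 1 - i * ?d - 1) * h r"
    "\<bar>\<gamma> - 1 - i * ?d\<bar> powr p * log_energy p g \<le> log_energy p h" by blast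
  have "log_regular p n (\<lambda>r. - h r)"
    using log_regular_lincomb[OF _ h(1) h(1), of "- 1" 0] p by simp
  moreover have "AE r in halfline. L_op \<theta> \<gamma> W r = r powr (- ((i + 1) * ?d)) * - h r"
    using h(2)
  proof eventually_elim
    case (elim r)
    have "r powr (- \<theta>) * r powr (\<gamma> - 1 - i * ?d - 1) = r powr (- ((i + 1) * ?d))"
      unfolding powr_add[symmetric] by (rule arg_cong[where f = "\<lambda>x. r powr x"]) (simp add: algebra_simps)
    then show ?case unfolding L_op_def elim by (simp add: mult.assoc[symmetric])
  qed
  moreover have "log_energy p (\<lambda>r. - h r) = log_energy p h" by (simp add: log_energy_def)
  ultimately show ?thesis using h(3) by (intro exI[of _ "\<lambda>r. - h r"]) simp
qed

section \<open>The sharp constant\<close>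

text \<open>
  The product of the constants of the factors \<open>D + (\<gamma> - 1 - j d)\<close> and \<open>D - (j + 1) d\<close> that lead from
  \<open>D u\<close> to the derivative of \<open>L^i u\<close>.
\<close>

definition radial_const :: "real \<Rightarrow> real \<Rightarrow> nat \<Rightarrow> real" where
  "radial_const \<gamma> d i = (\<Prod>j<i. (\<gamma> - 1 - real j * d) * ((real j + 1) * d))"

lemma L_op_iterate_deriv:
  fixes \<theta> \<gamma> :: real
  defines "d \<equiv> \<theta> + 2 - \<gamma>"
  assumes p: "1 < p" and g0: "log_regular p n g0"
    and u: "AE r in halfline. weak_deriv u r = r powr (- 1) * g0 r" and i: "2 * i \<le> n"
  shows "\<exists>g. log_regular p (n - 2 * i) g
    \<and> (AE r in halfline. weak_deriv ((L_op \<theta> \<gamma> ^^ i) u) r = r powr (- (real i * d) - 1) * g r)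
    \<and> \<bar>radial_const \<gamma> d i\<bar> powr p * log_energy p g0 \<le> log_energy p g"
  using i
proof (induction i)
  case 0
  then show ?case using g0 u by (intro exI[of _ g0]) (simp add: radial_const_def)
next
  case (Suc i)
  then obtain g where g: "log_regular p (n - 2 * i) g"
    "AE r in halfline. weak_deriv ((L_op \<theta> \<gamma> ^^ i) u) r = r powr (- (real i * d) - 1) * g r"
    "\<bar>radial_const \<gamma> d i\<bar> powr p * log_energy p g0 \<le> log_energy p g" by auto
  have n: "n - 2 * i = Suc (Suc (n - 2 * Suc i))" using Suc.prems by simp
  obtain f where f: "log_regular p (Suc (n - 2 * Suc i)) f"
    "AE r in halfline. (L_op \<theta> \<gamma> ^^ Suc i) u r = r powr (- ((real i + 1) * d)) * f r"
    "\<bar>\<gamma> - 1 - real i * d\<bar> powr p * log_energy p g \<le> log_energy p f"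
    using L_op_step[OF p g(1)[unfolded n] g(2)[unfolded d_def]] unfolding d_def by auto
  obtain h where h: "log_regular p (n - 2 * Suc i) h"
    "AE r in halfline. weak_deriv ((L_op \<theta> \<gamma> ^^ Suc i) u) r = r powr (- ((real i + 1) * d) - 1) * h r"
    "\<bar>- ((real i + 1) * d)\<bar> powr p * log_energy p f \<le> log_energy p h"
    using weak_deriv_powr_step[OF p f(1) f(2)] by blast
  have "\<bar>radial_const \<gamma> d (Suc i)\<bar> powr p * log_energy p g0
     = \<bar>- ((real i + 1) * d)\<bar> powr p * (\<bar>\<gamma> - 1 - real i * d\<bar> powr p * (\<bar>radial_const \<gamma> d i\<bar> powr p * log_energy p g0))"
    by (simp add: radial_const_def abs_mult powr_mult mult_ac)
  also have "\<dots> \<le> \<bar>- ((real i + 1) * d)\<bar> powr p * (\<bar>\<gamma> - 1 - real i * d\<bar> powr p * log_energy p g)"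
    by (intro mult_left_mono g(3)) auto
  also have "\<dots> \<le> \<bar>- ((real i + 1) * d)\<bar> powr p * log_energy p f"
    by (intro mult_left_mono f(3)) auto
  also note h(3)
  finally show ?case using h(1,2) by (intro exI[of _ h]) (simp add: add.commute)
qed

text \<open>
  For even \<open>k\<close> the last factor \<open>D - (k div 2) d\<close> is missing, since \<open>\<nabla>^k u\<close> ends with an application
  of \<open>L\<close>.
\<close>

definition rellich_const :: "real \<Rightarrow> real \<Rightarrow> nat \<Rightarrow> real" where
  "rellich_const \<gamma> d k = (if even k then radial_const \<gamma> d (k div 2 - 1) * (\<gamma> - 1 - real (k div 2 - 1) * d)
     else radial_const \<gamma> d (k div 2))"

lemma L_grad_log_energy:
  fixes \<theta> \<gamma> :: real
  defines "d \<equiv> \<theta> + 2 - \<gamma>"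
  assumes p: "1 < p" and k: "1 \<le> k" and g0: "log_regular p (k - 1) g0"
    and u: "AE r in halfline. weak_deriv u r = r powr (- 1) * g0 r"
  shows "\<exists>h. Lp_log p h
    \<and> (AE r in halfline. L_grad \<theta> \<gamma> k u r = r powr (- (real (k div 2) * d) - of_bool (odd k)) * h r)
    \<and> \<bar>rellich_const \<gamma> d k\<bar> powr p * log_energy p g0 \<le> log_energy p h"
proof (cases "even k")
  case False
  then have i: "2 * (k div 2) \<le> k - 1" "(k - 1) div 2 = k div 2" by (auto elim!: oddE)
  obtain g where g: "log_regular p (k - 1 - 2 * (k div 2)) g"
    "AE r in halfline. weak_deriv ((L_op \<theta> \<gamma> ^^ (k div 2)) u) r = r powr (- (real (k div 2) * d) - 1) * g r"
    "\<bar>radial_const \<gamma> d (k div 2)\<bar> powr p * log_energy p g0 \<le> log_energy p g"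
    using L_op_iterate_deriv[OF p g0 u i(1)] unfolding d_def by blast
  then show ?thesis using False log_regular_Lp_log[OF g(1)] i(2)
    by (intro exI[of _ g]) (simp add: L_grad_def rellich_const_def)
next
  case True
  define m where "m = k div 2 - 1"
  have m: "k div 2 = Suc m" "2 * m \<le> k - 1" "k - 1 - 2 * m = Suc 0" using True k by (auto simp: m_def elim!: evenE)
  obtain g where g: "log_regular p (k - 1 - 2 * m) g"
    "AE r in halfline. weak_deriv ((L_op \<theta> \<gamma> ^^ m) u) r = r powr (- (real m * d) - 1) * g r"
    "\<bar>radial_const \<gamma> d m\<bar> powr p * log_energy p g0 \<le> log_energy p g"
    using L_op_iterate_deriv[OF p g0 u m(2)] unfolding d_def by blast
  obtain h where h: "log_regular p 0 h"
    "AE r in halfline. (L_op \<theta> \<gamma> ^^ Suc m) u r = r powr (- ((real m + 1) * d)) * h r"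
    "\<bar>\<gamma> - 1 - real m * d\<bar> powr p * log_energy p g \<le> log_energy p h"
    using L_op_step[OF p g(1)[unfolded m(3)] g(2)[unfolded d_def]] unfolding d_def by auto
  have "\<bar>radial_const \<gamma> d m * (\<gamma> - 1 - real m * d)\<bar> powr p * log_energy p g0
    = \<bar>\<gamma> - 1 - real m * d\<bar> powr p * (\<bar>radial_const \<gamma> d m\<bar> powr p * log_energy p g0)"
    by (simp add: abs_mult powr_mult)
  also have "\<dots> \<le> \<bar>\<gamma> - 1 - real m * d\<bar> powr p * log_energy p g" by (intro mult_left_mono g(3)) auto
  also note h(3)
  finally show ?thesis using True h(1,2) m(1)
    by (intro exI[of _ h]) (simp add: L_grad_def rellich_const_def add.commute)
qed

text \<open>
  Stated with \<open>a + 1\<close> so that the empty product, which occurs for \<open>k = 1\<close>, is covered.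
\<close>

lemma prod_Gamma_falling:
  fixes a :: real
  assumes "a - real i + 1 > 0"
  shows "(\<Prod>j<i. a - real j) * Gamma (a - real i + 1) = Gamma (a + 1)"
  using assms
proof (induction i)
  case (Suc i)
  have "Gamma (a - real i + 1) = (a - real i) * Gamma (a - real i)"
    using Suc.prems by (intro Gamma_plus1) (auto elim!: nonpos_Ints_cases)
  then show ?case using Suc by (simp add: mult.assoc)
qed simp

lemma radial_const_eq:
  assumes "d \<noteq> 0"
  shows "radial_const \<gamma> d i = d ^ (2 * i) * fact i * (\<Prod>j<i. (\<gamma> - 1) / d - real j)"
proof (induction i)
  case (Suc i)
  have "\<gamma> - 1 - real i * d = d * ((\<gamma> - 1) / d - real i)" using assms by (simp add: field_simps)
  then show ?case using Suc unfolding radial_const_def by (simp add: mult_ac)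
qed (simp add: radial_const_def)

text \<open>
  The lower bound for \<open>\<theta>\<close> in the theorem is the hypothesis \<open>pos\<close>; it says that the smallest of the
  factors \<open>\<gamma> - 1 - j d\<close> is positive.
\<close>

lemma rellich_const_pos:
  assumes k: "1 \<le> k" and d: "0 < d" and pos: "0 < \<gamma> - 1 + d - real (k div 2) * d"
  shows "0 < rellich_const \<gamma> d k"
proof -
  have f: "0 < \<gamma> - 1 - real j * d" if "Suc j \<le> k div 2" for j
  proof -
    have "real (Suc j) * d \<le> real (k div 2) * d" using that d by (intro mult_right_mono) auto
    then show ?thesis using pos by (simp add: algebra_simps)
  qed
  have r: "0 < radial_const \<gamma> d i" if "i \<le> k div 2" for i
    unfolding radial_const_def using that d f by (intro prod_pos) auto
  show ?thesis
  proof (cases "even k")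
    case True
    then have "Suc (k div 2 - 1) \<le> k div 2" using k by (auto elim!: evenE)
    then show ?thesis using True r[of "k div 2 - 1"] f[of "k div 2 - 1"] by (simp add: rellich_const_def)
  qed (simp add: rellich_const_def r)
qed

lemma beta0_eq_rellich_const:
  fixes \<theta> \<gamma> :: real
  defines "d \<equiv> \<theta> + 2 - \<gamma>"
  assumes k: "1 \<le> k" and d: "0 < d" and \<gamma>: "1 < \<gamma>" and pos: "0 < \<gamma> - 1 + d - real (k div 2) * d"
  shows "beta0 k p \<eta> \<theta> \<gamma> = (\<eta> + 1) * rellich_const \<gamma> d k powr (p / (p - 1))"
proof -
  define a m where "a = (\<gamma> - 1) / d" and "m = k div 2"
  have a: "0 < a" "\<gamma> - 1 = a * d" using d \<gamma> by (auto simp: a_def)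
  have am: "0 < a - real m + 1"
  proof -
    have "0 < (a - real m + 1) * d" using pos a(2) by (simp add: m_def algebra_simps)
    then show ?thesis using d by (simp add: zero_less_mult_iff)
  qed
  have G0: "Gamma (a - real m + 1) \<noteq> 0" using Gamma_real_pos[OF am] by simp
  have prod: "(\<Prod>j<m. a - real j) = a * Gamma a / Gamma (a - real m + 1)"
    using prod_Gamma_falling[OF am] G0 Gamma_plus1[of a] a(1)
    by (simp add: field_simps nonpos_Ints_def)
  show ?thesis
  proof (cases "even k")
    case True
    then obtain n where n: "m = Suc n" "k = 2 * Suc n" using k by (cases m) (auto simp: m_def elim!: evenE)
    have "rellich_const \<gamma> d k = d ^ (2 * n) * fact n * (\<Prod>j<n. a - real j) * (d * (a - real n))"
      using True n radial_const_eq[of d \<gamma> n] d a by (simp add: rellich_const_def a_def[symmetric] m_def algebra_simps)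
    also have "\<dots> = d ^ (2 * n) * fact n * d * (\<Prod>j<m. a - real j)" by (simp add: n mult_ac)
    also have "\<dots> = (\<gamma> - 1) * d ^ (2 * n) * (fact n * Gamma a / Gamma (a - real m + 1))"
      unfolding prod a(2) by simp
    also have "d ^ (2 * n) = d powi (int k - 2)" using n by (simp add: power_int_def nat_mult_distrib)
    also have "fact n = Gamma (real k / 2)"
    proof -
      have "real k / 2 = 1 + real n" using n by simp
      then show ?thesis by (simp only: Gamma_fact)
    qed
    also have "a - real m + 1 = a - (real k - 2) / 2" using n by simp
    finally show ?thesis unfolding beta0_def if_P[OF True] a_def d_def by simp
  next
    case False
    then have km: "k = 2 * m + 1" by (auto simp: m_def elim!: oddE)
    have "rellich_const \<gamma> d k = d ^ (2 * m) * fact m * (\<Prod>j<m. a - real j)"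
      using False radial_const_eq[of d \<gamma> m] d by (simp add: rellich_const_def a_def[symmetric] m_def)
    also have "\<dots> = (a * d) * (d ^ (2 * m) / d) * (fact m * Gamma a / Gamma (a - real m + 1))"
      unfolding prod using d by simp
    also have "d ^ (2 * m) / d = d powi (int k - 2)"
    proof -
      have "int k - 2 = int (2 * m) - 1" using km by simp
      moreover have "d powi (int (2 * m) - 1) = d ^ (2 * m) / d"
        using d by (subst power_int_diff) (simp_all only: power_int_of_nat power_int_1_right, simp)
      ultimately show ?thesis by simp
    qed
    also have "fact m = Gamma ((real k + 1) / 2)"
    proof -
      have "(real k + 1) / 2 = 1 + real m" using km by simp
      then show ?thesis by (simp only: Gamma_fact)
    qed
    also have "a - real m + 1 = a - (real k - 3) / 2" using km by (simp add: field_simps)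
    finally have "rellich_const \<gamma> d k = (\<gamma> - 1) * d powi (int k - 2) *
        (Gamma ((real k + 1) / 2) * Gamma a / Gamma (a - (real k - 3) / 2))"
      unfolding a(2) .
    then show ?thesis unfolding beta0_def if_not_P[OF False] a_def d_def by simp
  qed
qed

lemma epowr_Lp_norm:
  assumes "0 < p"
  shows "epowr (Lp_norm p a f) p = (\<integral>\<^sup>+ r. ennreal (\<bar>f r\<bar> powr p * r powr a) \<partial>halfline)"
  using assms by (auto simp: Lp_norm_def epowr_def powr_powr powr_ge_zero less_top)

section \<open>Moser's inequality near the origin\<close>

lemma powr_sum_convex:
  fixes a b q \<mu> :: real
  assumes q: "1 < q" and "0 \<le> a" "0 \<le> b" and \<mu>: "0 < \<mu>" "\<mu> < 1"
  shows "(a + b) powr q \<le> (1 - \<mu>) powr (1 - q) * a powr q + \<mu> powr (1 - q) * b powr q"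
proof -
  let ?z = "a + b" and ?x = "a / (1 - \<mu>)" and ?y = "b / \<mu>"
  have x: "?z powr q + q * spow (q - 1) ?z * (?x - ?z) \<le> ?x powr q"
    using abs_powr_above_tangent[OF q, of ?z "?x - ?z"] assms by simp
  have y: "?z powr q + q * spow (q - 1) ?z * (?y - ?z) \<le> ?y powr q"
    using abs_powr_above_tangent[OF q, of ?z "?y - ?z"] assms by simp
  have "(1 - \<mu>) * ?x + \<mu> * ?y = ?z" using \<mu> by simp
  then have "(1 - \<mu>) * (?x - ?z) + \<mu> * (?y - ?z) = 0" by (simp add: algebra_simps)
  moreover have "(1 - \<mu>) * (Z + c * (?x - ?z)) + \<mu> * (Z + c * (?y - ?z))
      = Z + c * ((1 - \<mu>) * (?x - ?z) + \<mu> * (?y - ?z))" for Z c by (simp add: algebra_simps)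
  ultimately have "?z powr q = (1 - \<mu>) * (?z powr q + q * spow (q - 1) ?z * (?x - ?z))
     + \<mu> * (?z powr q + q * spow (q - 1) ?z * (?y - ?z))" by simp
  also have "\<dots> \<le> (1 - \<mu>) * ?x powr q + \<mu> * ?y powr q"
    using add_mono[OF mult_left_mono[OF x, of "1 - \<mu>"] mult_left_mono[OF y, of \<mu>]] \<mu> by simp
  also have "\<dots> = (1 - \<mu>) powr (1 - q) * a powr q + \<mu> powr (1 - q) * b powr q"
    using \<mu> assms by (simp add: powr_divide powr_diff)
  finally show ?thesis .
qed

text \<open>
  Two consecutive increments over logarithmic lengths \<open>L\<close> and \<open>l\<close>, of energies at most \<open>X\<close> and \<open>Y\<close>,
  combine as one increment over length \<open>L + l\<close> with energy \<open>X + Y\<close>.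
\<close>

lemma powr_sum_le_weighted:
  fixes a b L l X Y :: real
  assumes p: "1 < p" and ab: "0 \<le> a" "0 \<le> b" and L: "0 < L" "0 \<le> l"
    and a: "a powr p \<le> L powr (p - 1) * X" and b: "b powr p \<le> l powr (p - 1) * Y" and Y: "0 \<le> Y"
  shows "(a + b) powr p \<le> (L + l) powr (p - 1) * (X + Y)"
proof (cases "l = 0")
  case True
  then have "b powr p \<le> 0" using b p by simp
  then have "b = 0" by (smt (verit) powr_gt_zero powr_eq_0_iff)
  moreover have "L powr (p - 1) * X \<le> L powr (p - 1) * (X + Y)" using Y by (intro mult_left_mono) auto
  ultimately show ?thesis using a True by simp
next
  case False
  then have l: "0 < l" using L by simp
  define \<mu> where "\<mu> = l / (L + l)"
  have \<mu>: "0 < \<mu>" "\<mu> < 1" "1 - \<mu> = L / (L + l)" using l L by (auto simp: \<mu>_def field_simps)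
  have w: "(c / (L + l)) powr (1 - p) * (c powr (p - 1) * Z) = (L + l) powr (p - 1) * Z" if "0 < c" for c Z
  proof -
    have "(c / (L + l)) powr (1 - p) = c powr (1 - p) / (L + l) powr (1 - p)"
      using that l L by (simp add: powr_divide)
    moreover have "c powr (1 - p) * c powr (p - 1) = 1" using that by (simp add: powr_add[symmetric])
    moreover have "1 / (L + l) powr (1 - p) = (L + l) powr (p - 1)"
      using powr_minus_divide[of "L + l" "1 - p"] by simp
    ultimately show ?thesis by (metis (no_types, lifting) mult.assoc mult.left_neutral times_divide_eq_left mult.commute)
  qed
  have "(a + b) powr p \<le> (1 - \<mu>) powr (1 - p) * a powr p + \<mu> powr (1 - p) * b powr p"
    by (rule powr_sum_convex[OF p ab \<mu>(1,2)])
  also have "\<dots> \<le> (1 - \<mu>) powr (1 - p) * (L powr (p - 1) * X) + \<mu> powr (1 - p) * (l powr (p - 1) * Y)"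
    by (intro add_mono mult_left_mono a b) auto
  also have "\<dots> = (L + l) powr (p - 1) * (X + Y)"
    unfolding \<mu>(3) unfolding \<mu>_def w[OF L(1)] w[OF l] by (simp add: distrib_left)
  finally show ?thesis .
qed

lemma bernoulli_powr:
  fixes x r :: real
  assumes "1 \<le> r" "0 \<le> x" "x \<le> 1"
  shows "1 - r * x \<le> (1 - x) powr r"
proof (cases "r = 1")
  case False
  then show ?thesis using abs_powr_above_tangent[of r 1 "- x"] assms by (simp add: spow_def)
qed (use assms in simp)

text \<open>
  Here \<open>s\<close> and \<open>s + d\<close> are two points of the level set \<open>s - |W|^q \<le> lam\<close>, \<open>a\<close> is the modulus of \<open>W\<close> at the first, \<open>b\<close>
  bounds the increment between them, and \<open>E\<close>, \<open>F\<close> are the energies spent before and between. Membership of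
  the first point forces \<open>E \<ge> (1 - lam/s)^(p-1)\<close>, hence \<open>F \<le> (p - 1) lam / s\<close>. In the convexity
  inequality for \<open>(a + b)^q\<close> the weight \<open>\<mu>\<close> is chosen such that the increment contributes at most
  \<open>d / 2\<close>, while the first term exceeds \<open>s\<close> by a multiple of \<open>lam\<close> only; so membership of the second point
  bounds \<open>d\<close>. The bound on \<open>s\<close> from below makes \<open>\<mu> \<le> 1/2\<close>.
\<close>

lemma moser_gap:
  fixes p a b s d E F lam :: real
  defines "q \<equiv> p / (p - 1)" and "K \<equiv> 2 powr p * (p - 1)"
  assumes p: "2 \<le> p" and lam: "0 < lam" and ab: "0 \<le> a" "0 \<le> b" and d: "0 \<le> d"
    and a: "a powr p \<le> s powr (p - 1) * E" and b: "b powr p \<le> d powr (p - 1) * F"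
    and EF: "0 \<le> E" "0 \<le> F" "E + F \<le> 1"
    and la: "s - lam \<le> a powr q" and lb: "s + d - lam \<le> (a + b) powr q" and s: "K * lam \<le> s"
  shows "d \<le> 2 * (1 + K) * lam"
proof -
  have K: "4 \<le> K"
  proof -
    have "2 powr 2 * 1 \<le> 2 powr p * (p - 1)" using p by (intro mult_mono powr_mono) auto
    then show ?thesis by (simp add: K_def)
  qed
  have "1 * lam < K * lam" using K lam by (intro mult_strict_right_mono) auto
  then have s0: "lam < s" "0 < s" using s lam by linarith+
  have q: "1 < q" "q * (p - 1) = p" "p / (p - 1) = q" "q - 1 = 1 / (p - 1)"
    using p by (auto simp: q_def field_simps)
  have root: "x powr q = (x powr p) powr (1 / (p - 1))" for x :: real
    using p by (simp add: powr_powr q_def)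
  have unroot: "(x powr (p - 1) * y) powr (1 / (p - 1)) = x * y powr (1 / (p - 1))" if "0 \<le> x" "0 \<le> y" for x y :: real
    using p that by (simp add: powr_mult powr_powr)
  \<comment> \<open>almost all the energy has been spent before \<open>s\<close>\<close>
  have F: "F \<le> (p - 1) * (lam / s)"
  proof -
    have "(s - lam) powr (p - 1) \<le> (a powr q) powr (p - 1)"
      using la s0 p by (intro powr_mono2) auto
    also have "\<dots> = a powr p" using q by (simp add: powr_powr)
    also note a
    finally have "((s - lam) / s) powr (p - 1) \<le> E"
      using s0 by (simp add: powr_divide field_simps)
    moreover have eq: "(s - lam) / s = 1 - lam / s" using s0 by (simp add: field_simps)
    moreover have "1 - (p - 1) * (lam / s) \<le> (1 - lam / s) powr (p - 1)"
      using p lam s0 by (intro bernoulli_powr) auto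
    ultimately have "1 - (p - 1) * (lam / s) \<le> E" unfolding eq by linarith
    then show ?thesis using EF by linarith
  qed
  \<comment> \<open>the factor \<open>2 powr (p - 1)\<close> becomes the \<open>1/2\<close> in \<open>d / 2\<close> after taking the root\<close>
  define \<mu> where "\<mu> = 2 powr (p - 1) * ((p - 1) * (lam / s))"
  have two: "2 powr p = 2 * 2 powr (p - 1)" using powr_add[of 2 1 "p - 1"] by simp
  have s\<mu>: "2 * (s * \<mu>) = K * lam" using s0 by (simp add: \<mu>_def K_def two)
  have \<mu>: "0 < \<mu>" "\<mu> \<le> 1/2"
  proof -
    show "0 < \<mu>" using p lam s0 by (simp add: \<mu>_def)
    have "s * (2 * \<mu>) \<le> s * 1" using s\<mu> s by (simp only: mult.left_commute mult_1_right)
    then have "2 * \<mu> \<le> 1" using mult_le_cancel_left_pos[OF s0(2)] by blast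
    then show "\<mu> \<le> 1/2" by linarith
  qed
  have aq: "a powr q \<le> s"
  proof -
    have "s powr (p - 1) * E \<le> s powr (p - 1) * 1" using EF by (intro mult_left_mono) auto
    then have "a powr p \<le> s powr (p - 1) * 1" using a by linarith
    then have "a powr q \<le> (s powr (p - 1) * 1) powr (1 / (p - 1))"
      unfolding root using p by (intro powr_mono2) auto
    then show ?thesis using unroot[of s 1] s0 by simp
  qed
  have bq: "\<mu> powr (1 - q) * b powr q \<le> d / 2"
  proof -
    have "b powr q \<le> (d powr (p - 1) * F) powr (1 / (p - 1))"
      unfolding root using p b by (intro powr_mono2) auto
    also have "\<dots> = d * F powr (1 / (p - 1))" using d EF by (intro unroot)
    also have "\<dots> \<le> d * (\<mu> / 2 powr (p - 1)) powr (1 / (p - 1))"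
      using F EF p d by (intro mult_left_mono powr_mono2) (auto simp: \<mu>_def)
    also have "(\<mu> / 2 powr (p - 1)) powr (1 / (p - 1)) = \<mu> powr (q - 1) / 2"
      using \<mu> p by (simp add: powr_divide powr_powr q)
    finally have "\<mu> powr (1 - q) * b powr q \<le> \<mu> powr (1 - q) * (d * (\<mu> powr (q - 1) / 2))"
      by (intro mult_left_mono) auto
    also have "\<dots> = (\<mu> powr (1 - q) * \<mu> powr (q - 1)) * d / 2" by simp
    also have "\<mu> powr (1 - q) * \<mu> powr (q - 1) = 1" using \<mu> by (simp add: powr_add[symmetric])
    finally show ?thesis by simp
  qed
  have one: "(1 - \<mu>) powr (1 - q) \<le> 1 + 2 * \<mu>"
  proof -
    have "q - 1 \<le> 1" using p by (simp add: q(4))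
    then have "(1 - \<mu>) powr (1 - q) \<le> (1 - \<mu>) powr (- 1)" using \<mu> by (intro powr_mono') auto
    also have "\<dots> = 1 / (1 - \<mu>)" using \<mu> by (simp add: powr_minus_divide)
    also have "\<dots> \<le> 1 + 2 * \<mu>"
    proof -
      have "0 \<le> \<mu> * (1 - 2 * \<mu>)" using \<mu> by simp
      then have "1 \<le> (1 + 2 * \<mu>) * (1 - \<mu>)" by (simp add: algebra_simps)
      then show ?thesis using \<mu> by (simp add: pos_divide_le_eq)
    qed
    finally show ?thesis .
  qed
  have "s + d - lam \<le> (1 - \<mu>) powr (1 - q) * a powr q + \<mu> powr (1 - q) * b powr q"
    using lb powr_sum_convex[OF q(1) ab, of \<mu>] \<mu> by linarith
  also have "\<dots> \<le> (1 + 2 * \<mu>) * s + d / 2"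
    using \<mu> by (intro add_mono mult_mono one aq bq) auto
  finally show ?thesis using s\<mu> by (simp add: algebra_simps)
qed

lemma nn_integral_halfline_Icc:
  assumes "0 < a" "\<And>r. r \<in> {a..b} \<Longrightarrow> 0 \<le> f r" "(f has_integral I) {a..b}"
  shows "(\<integral>\<^sup>+ r. ennreal (f r) * indicator {a..b} r \<partial>halfline) = ennreal I"
proof -
  have "(\<integral>\<^sup>+ r. ennreal (f r) * indicator {a..b} r \<partial>halfline)
    = (\<integral>\<^sup>+ r. ennreal (f r) * indicator {a..b} r * indicator {0<..} r \<partial>lebesgue)"
    by (subst nn_integral_restrict_space) auto
  also have "\<dots> = (\<integral>\<^sup>+ r. ennreal (f r) * indicator {a..b} r \<partial>lebesgue)"
    using assms(1) by (intro nn_integral_cong) (auto simp: indicator_def)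
  also have "\<dots> = ennreal I"
    unfolding nn_integral_completion by (rule nn_integral_has_integral_lebesgue'[OF assms(2,3)])
  finally show ?thesis .
qed

lemma nn_integral_halfline_eq:
  assumes "\<And>r. 0 < r \<Longrightarrow> 0 \<le> f r" "f integrable_on {0<..}"
  shows "(\<integral>\<^sup>+ r. ennreal (f r) \<partial>halfline) = ennreal (integral {0<..} f)"
proof -
  have "(\<integral>\<^sup>+ r. ennreal (f r) \<partial>halfline) = (\<integral>\<^sup>+ r. ennreal (f r) * indicator {0<..} r \<partial>lebesgue)"
    by (subst nn_integral_restrict_space) auto
  also have "\<dots> = ennreal (integral {0<..} f)"
    unfolding nn_integral_completion
    by (rule nn_integral_has_integral_lebesgue'[OF _ integrable_integral[OF assms(2)]]) (use assms(1) in auto)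
  finally show ?thesis .
qed

text \<open>
  Hoelder's inequality for \<open>W'\<close> against \<open>dr/r\<close>, as the tangent inequality at the mean slope \<open>m\<close> of \<open>W\<close> in
  the variable \<open>log r\<close>.
\<close>

lemma log_holder:
  assumes p: "1 < p" and W: "primitive_of W W'" and E: "Lp_log p (\<lambda>r. r * W' r)" and ab: "0 < a" "a \<le> b"
  shows "\<bar>W b - W a\<bar> powr p \<le> (ln b - ln a) powr (p - 1) * integral {a..b} (\<lambda>r. \<bar>r * W' r\<bar> powr p / r)"
proof (cases "a = b")
  case False
  define l where "l = ln b - ln a"
  have l: "0 < l" using False ab by (simp add: l_def)
  define m where "m = (W b - W a) / l"
  have "((\<lambda>r. \<bar>m\<bar> powr p * (1 / r) + p * spow (p - 1) m * (W' r - m * (1 / r))) has_integral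
    \<bar>m\<bar> powr p * l + p * spow (p - 1) m * ((W b - W a) - m * l)) {a..b}"
    unfolding l_def
    by (intro has_integral_add has_integral_mult_right has_integral_diff integral_inverse_Icc
        primitive_of_has_integral[OF W] ab)
  moreover have "((\<lambda>r. \<bar>r * W' r\<bar> powr p / r) has_integral integral {a..b} (\<lambda>r. \<bar>r * W' r\<bar> powr p / r)) {a..b}"
    by (rule integrable_integral[OF Lp_log_Icc(1)[OF E ab(1)]])
  moreover have "\<bar>m\<bar> powr p * (1 / r) + p * spow (p - 1) m * (W' r - m * (1 / r)) \<le> \<bar>r * W' r\<bar> powr p / r"
    if "r \<in> {a..b}" for r
  proof -
    have r: "0 < r" using that ab by auto
    have "(\<bar>m\<bar> powr p + p * spow (p - 1) m * (r * W' r - m)) / r \<le> \<bar>m + (r * W' r - m)\<bar> powr p / r"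
      using abs_powr_above_tangent[OF p, of m "r * W' r - m"] r by (intro divide_right_mono) auto
    moreover have "(\<bar>m\<bar> powr p + p * spow (p - 1) m * (r * W' r - m)) / r
      = \<bar>m\<bar> powr p * (1 / r) + p * spow (p - 1) m * (W' r - m * (1 / r))"
      using r by (simp add: field_simps)
    ultimately show ?thesis by simp
  qed
  ultimately have "\<bar>m\<bar> powr p * l + p * spow (p - 1) m * ((W b - W a) - m * l)
      \<le> integral {a..b} (\<lambda>r. \<bar>r * W' r\<bar> powr p / r)" by (rule has_integral_le)
  moreover have ml: "m * l = W b - W a" using l by (simp add: m_def)
  ultimately have "\<bar>m\<bar> powr p * l \<le> integral {a..b} (\<lambda>r. \<bar>r * W' r\<bar> powr p / r)" by simp
  then have "l powr (p - 1) * (\<bar>m\<bar> powr p * l) \<le> l powr (p - 1) * integral {a..b} (\<lambda>r. \<bar>r * W' r\<bar> powr p / r)"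
    by (intro mult_left_mono) auto
  moreover have "l powr (p - 1) * (\<bar>m\<bar> powr p * l) = \<bar>W b - W a\<bar> powr p"
    using l unfolding ml[symmetric] by (simp add: abs_mult powr_mult powr_diff)
  ultimately show ?thesis by (simp add: l_def)
qed simp

text \<open>
  The parameters \<open>L\<close> and \<open>\<kappa>\<close> replace a boundary condition at \<open>R\<close>: they account for \<open>W\<close> rising from \<open>0\<close> to \<open>|W R|\<close>
  over a fictitious logarithmic interval of length \<open>L\<close> with energy \<open>\<kappa>\<close>. In terms of
  \<open>s = L + log (R / r)\<close>, the integrand is a constant times \<open>exp(- e0 (s - |W|^q))\<close> against \<open>dr/r\<close>. Slicing by
  the integer part \<open>n\<close> of \<open>s - |W|^q \<ge> 0\<close> bounds it by \<open>exp(- e0 n)\<close> on a set which, by \<open>moser_gap\<close>, lies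
  in two intervals of total logarithmic length \<open>(5 K + 4) (n + 1)\<close>; the sum over \<open>n\<close> converges.
\<close>

lemma moser_near_0:
  fixes p e0 R L \<kappa> :: real
  defines "q \<equiv> p / (p - 1)" and "K \<equiv> 2 powr p * (p - 1)"
  assumes p: "2 \<le> p" and e0: "0 < e0" and W: "primitive_of W W'" and E: "Lp_log p (\<lambda>r. r * W' r)"
    and R: "0 < R" and L: "0 < L" and \<kappa>: "0 \<le> \<kappa>" and WR: "\<bar>W R\<bar> powr p \<le> L powr (p - 1) * \<kappa>"
    and total: "\<kappa> + log_energy p (\<lambda>r. r * W' r) \<le> 1"
  shows "(\<integral>\<^sup>+ r. ennreal (exp (e0 * \<bar>W r\<bar> powr q) * r powr (e0 - 1)) * indicator {0<..R} r \<partial>halfline)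
    \<le> ennreal (exp (e0 * L) * R powr e0 * ((5 * K + 4) / (1 - exp (- e0))\<^sup>2))"
proof -
  have p1: "1 < p" using p by simp
  have q: "0 < q" "q * (p - 1) = p" using p by (auto simp: q_def)
  have K: "0 < K" using p by (simp add: K_def)
  let ?En = "\<lambda>a b. integral {a..b} (\<lambda>r. \<bar>r * W' r\<bar> powr p / r)"
  define s where "s r = L + (ln R - ln r)" for r
  have En0: "0 \<le> ?En a b" if "0 < a" for a b
    using that by (intro integral_nonneg Lp_log_Icc(1)[OF E]) auto
  have En_le: "?En a b \<le> log_energy p (\<lambda>r. r * W' r)" if "0 < a" for a b
    using Lp_log_Icc(2)[OF E that] .
  have s_pos: "0 < s r" if "0 < r" "r \<le> R" for r using that L by (simp add: s_def add_pos_nonneg)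
  have W_le: "\<bar>W r\<bar> powr p \<le> s r powr (p - 1) * (\<kappa> + ?En r R)" if r: "0 < r" "r \<le> R" for r
  proof -
    have "\<bar>W r\<bar> \<le> \<bar>W R\<bar> + \<bar>W R - W r\<bar>" by simp
    then have "\<bar>W r\<bar> powr p \<le> (\<bar>W R\<bar> + \<bar>W R - W r\<bar>) powr p" using p by (intro powr_mono2) auto
    also have "\<dots> \<le> (L + (ln R - ln r)) powr (p - 1) * (\<kappa> + ?En r R)"
      using r by (intro powr_sum_le_weighted[OF p1 _ _ L _ WR log_holder[OF p1 W E]] En0) auto
    finally show ?thesis by (simp add: s_def)
  qed
  define lev where "lev r = s r - \<bar>W r\<bar> powr q" for r
  have lev0: "0 \<le> lev r" if r: "0 < r" "r \<le> R" for r
  proof -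
    have "s r powr (p - 1) * (\<kappa> + ?En r R) \<le> s r powr (p - 1) * 1"
      using total En_le[OF r(1), of R] by (intro mult_left_mono) auto
    then have "\<bar>W r\<bar> powr p \<le> s r powr (p - 1)" using W_le[OF r] by simp
    then have "(\<bar>W r\<bar> powr p) powr (1 / (p - 1)) \<le> (s r powr (p - 1)) powr (1 / (p - 1))"
      using p by (intro powr_mono2) auto
    then show ?thesis using p s_pos[OF r] by (simp add: powr_powr lev_def q_def)
  qed
  define D where "D lam = 2 * (1 + K) * lam" for lam
  \<comment> \<open>two points of one level set, the first of which is far out, are logarithmically close\<close>
  have gap: "ln r1 - ln r2 \<le> D lam"
    if r: "0 < r2" "r2 \<le> r1" "r1 \<le> R" and lam: "0 < lam" "lev r1 \<le> lam" "lev r2 \<le> lam" and far: "K * lam \<le> s r1"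
    for r1 r2 lam
    unfolding D_def K_def
  proof (rule moser_gap[OF p lam(1)])
    have r1: "0 < r1" using r by simp
    show "\<bar>W r1\<bar> powr p \<le> s r1 powr (p - 1) * (\<kappa> + ?En r1 R)" by (rule W_le[OF r1 r(3)])
    show "\<bar>W r1 - W r2\<bar> powr p \<le> (ln r1 - ln r2) powr (p - 1) * ?En r2 r1"
      by (rule log_holder[OF p1 W E r(1,2)])
    have "?En r2 r1 + ?En r1 R = ?En r2 R"
      using r by (intro Henstock_Kurzweil_Integration.integral_combine Lp_log_Icc(1)[OF E]) auto
    then show "\<kappa> + ?En r1 R + ?En r2 r1 \<le> 1" using En_le[OF r(1), of R] total by linarith
    show "0 \<le> \<kappa> + ?En r1 R" "0 \<le> ?En r2 r1" using En0 r r1 \<kappa> by auto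
    show "s r1 - lam \<le> \<bar>W r1\<bar> powr (p / (p - 1))" using lam(2) by (simp add: lev_def q_def)
    have "\<bar>W r2\<bar> powr q \<le> (\<bar>W r1\<bar> + \<bar>W r1 - W r2\<bar>) powr q" using q by (intro powr_mono2) auto
    then show "s r1 + (ln r1 - ln r2) - lam \<le> (\<bar>W r1\<bar> + \<bar>W r1 - W r2\<bar>) powr (p / (p - 1))"
      using lam(3) by (simp add: lev_def q_def s_def)
    show "2 powr p * (p - 1) * lam \<le> s r1" using far by (simp add: K_def)
  qed (use r in auto)
  have "\<exists>\<rho>>0. \<forall>r. 0 < r \<longrightarrow> r \<le> R \<longrightarrow> lev r \<le> lam \<longrightarrow>
      r \<in> {R * exp (- (K * lam))..R} \<or> r \<in> {\<rho> * exp (- D lam)..\<rho> * exp (D lam)}" if lam: "0 < lam" for lam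
  proof -
    have near: "r \<in> {R * exp (- (K * lam))..R}" if "0 < r" "r \<le> R" "s r < K * lam" for r
    proof -
      have "ln (R * exp (- (K * lam))) \<le> ln r" using that L R by (simp add: s_def ln_mult)
      then show ?thesis using that R by (subst (asm) ln_le_cancel_iff) auto
    qed
    show ?thesis
    proof (cases "\<exists>\<rho>. 0 < \<rho> \<and> \<rho> \<le> R \<and> lev \<rho> \<le> lam \<and> K * lam \<le> s \<rho>")
      case True
      then obtain \<rho> where \<rho>: "0 < \<rho>" "\<rho> \<le> R" "lev \<rho> \<le> lam" "K * lam \<le> s \<rho>" by blast
      have "r \<in> {\<rho> * exp (- D lam)..\<rho> * exp (D lam)}"
        if r: "0 < r" "r \<le> R" "lev r \<le> lam" "K * lam \<le> s r" for r
      proof -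
        have "\<bar>ln r - ln \<rho>\<bar> \<le> D lam"
          using gap[of r \<rho> lam] gap[of \<rho> r lam] r \<rho> lam
          by (cases "r \<le> \<rho>") (auto simp: abs_le_iff intro: order_trans[of _ 0] simp: D_def K)
        then have "ln (\<rho> * exp (- D lam)) \<le> ln r" "ln r \<le> ln (\<rho> * exp (D lam))"
          using \<rho> by (auto simp: ln_mult)
        then show ?thesis using r \<rho> by (subst (asm) (1 2) ln_le_cancel_iff) auto
      qed
      then show ?thesis using near \<rho>(1) by (intro exI[of _ \<rho>]) (meson not_le)
    next
      case False
      then show ?thesis using near by (intro exI[of _ 1]) (auto simp: not_le)
    qed
  qed
  then obtain \<rho> where \<rho>: "\<And>lam. 0 < lam \<Longrightarrow> 0 < \<rho> lam" and cover: "\<And>lam r. 0 < lam \<Longrightarrow> 0 < r \<Longrightarrow> r \<le> R \<Longrightarrow> lev r \<le> lam \<Longrightarrow>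
      r \<in> {R * exp (- (K * lam))..R} \<or> r \<in> {\<rho> lam * exp (- D lam)..\<rho> lam * exp (D lam)}"
    by metis
  define I1 I2 where "I1 n = {R * exp (- (K * real (Suc n)))..R}"
    and "I2 n = {\<rho> (real (Suc n)) * exp (- D (real (Suc n)))..\<rho> (real (Suc n)) * exp (D (real (Suc n)))}" for n
  define C where "C = exp (e0 * L) * R powr e0"
  have C: "0 < C" using R by (simp add: C_def)
  define c where "c n = C * exp (- e0) ^ n" for n
  have c0: "0 \<le> c n" for n using C by (simp add: c_def)
  let ?t = "\<lambda>n r. ennreal (c n) * (ennreal (1 / r) * indicator (I1 n) r + ennreal (1 / r) * indicator (I2 n) r)"
  have pt: "ennreal (exp (e0 * \<bar>W r\<bar> powr q) * r powr (e0 - 1)) * indicator {0<..R} r \<le> (\<Sum>n. ?t n r)"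
    if "r \<in> space halfline" for r
  proof (cases "r \<le> R")
    case True
    have r: "0 < r" using that by simp
    define n where "n = nat \<lfloor>lev r\<rfloor>"
    have n: "real n \<le> lev r" "lev r \<le> real (Suc n)" using lev0[OF r True] by (auto simp: n_def) linarith+
    have "e0 * \<bar>W r\<bar> powr q = e0 * L + e0 * ln R - e0 * ln r - e0 * lev r"
      by (simp add: lev_def s_def algebra_simps)
    moreover have "R powr e0 = exp (e0 * ln R)" "r powr e0 = exp (e0 * ln r)"
      using r R by (simp_all add: powr_def)
    ultimately have "exp (e0 * \<bar>W r\<bar> powr q) = C / r powr e0 * exp (- (e0 * lev r))"
      by (simp only: C_def exp_add exp_diff exp_minus) (simp only: divide_inverse mult_ac)
    moreover have "exp (- (e0 * lev r)) \<le> exp (- e0) ^ n"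
      using n(1) e0 by (simp add: exp_of_nat_mult[symmetric] mult.commute)
    then have "C / r powr e0 * exp (- (e0 * lev r)) \<le> C / r powr e0 * exp (- e0) ^ n"
      using C by (intro mult_left_mono) auto
    ultimately have "exp (e0 * \<bar>W r\<bar> powr q) * r powr (e0 - 1) \<le> C / r powr e0 * exp (- e0) ^ n * r powr (e0 - 1)"
      by (intro mult_right_mono) auto
    also have "\<dots> = c n * (1 / r)" using r by (simp add: c_def powr_diff)
    finally have "ennreal (exp (e0 * \<bar>W r\<bar> powr q) * r powr (e0 - 1)) \<le> ennreal (c n) * ennreal (1 / r)"
      using c0 r by (simp add: ennreal_mult[symmetric] ennreal_leI)
    also have "\<dots> \<le> ?t n r"
    proof -
      have "r \<in> I1 n \<or> r \<in> I2 n" using cover[of "real (Suc n)" r] n(2) r True by (simp add: I1_def I2_def)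
      then show ?thesis by (auto simp: indicator_def intro!: mult_left_mono)
    qed
    also have "\<dots> = (\<Sum>i\<in>{n}. ?t i r)" by simp
    also have "\<dots> \<le> (\<Sum>n. ?t n r)" by (rule sum_le_suminf) auto
    finally show ?thesis using r True by simp
  qed simp
  have meas: "(\<lambda>r. ennreal (1 / r) * indicator {a..b} r) \<in> borel_measurable halfline" for a b :: real
  proof -
    show ?thesis by measurable
  qed
  have It: "(\<integral>\<^sup>+ r. ennreal (1 / r) * indicator {a * exp (- x)..a * exp y} r \<partial>halfline) = ennreal (x + y)"
    if "0 < a" "0 \<le> x" "0 \<le> y" for a x y
  proof (rule nn_integral_halfline_Icc)
    show a0: "0 < a * exp (- x)" using that by simp
    have "((\<lambda>r. 1 / r) has_integral ln (a * exp y) - ln (a * exp (- x))) {a * exp (- x)..a * exp y}"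
      using that by (intro integral_inverse_Icc a0) (auto intro!: mult_left_mono)
    then show "((\<lambda>r. 1 / r) has_integral x + y) {a * exp (- x)..a * exp y}"
      using that by (simp add: ln_mult add.commute)
    show "0 \<le> 1 / r" if "r \<in> {a * exp (- x)..a * exp y}" for r using that a0 by auto
  qed
  have summand: "(\<integral>\<^sup>+ r. ?t n r \<partial>halfline) = ennreal (C * (5 * K + 4) * (real (Suc n) * exp (- e0) ^ n))" for n
  proof -
    have D0: "0 \<le> D (real (Suc n))" using K by (simp add: D_def)
    have "(\<integral>\<^sup>+ r. ?t n r \<partial>halfline) = ennreal (c n) *
      ((\<integral>\<^sup>+ r. ennreal (1 / r) * indicator (I1 n) r \<partial>halfline) + (\<integral>\<^sup>+ r. ennreal (1 / r) * indicator (I2 n) r \<partial>halfline))"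
      unfolding I1_def I2_def by (subst nn_integral_cmult) (intro borel_measurable_add meas, subst nn_integral_add, auto intro: meas)
    also have "(\<integral>\<^sup>+ r. ennreal (1 / r) * indicator (I1 n) r \<partial>halfline) = ennreal (K * real (Suc n))"
      using It[of R "K * real (Suc n)" 0] R K unfolding I1_def by simp
    also have "(\<integral>\<^sup>+ r. ennreal (1 / r) * indicator (I2 n) r \<partial>halfline) = ennreal (D (real (Suc n)) + D (real (Suc n)))"
      unfolding I2_def using D0 by (intro It \<rho>) auto
    also have "ennreal (c n) * (ennreal (K * real (Suc n)) + ennreal (D (real (Suc n)) + D (real (Suc n))))
      = ennreal (c n * (K * real (Suc n) + (D (real (Suc n)) + D (real (Suc n)))))"
    proof -
      have "ennreal x * (ennreal y + ennreal z) = ennreal (x * (y + z))" if "0 \<le> x" "0 \<le> y" "0 \<le> z" for x y z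
        using that by (simp add: ennreal_mult)
      then show ?thesis using D0 K c0 by auto
    qed
    also have "c n * (K * real (Suc n) + (D (real (Suc n)) + D (real (Suc n)))) = C * (5 * K + 4) * (real (Suc n) * exp (- e0) ^ n)"
      by (simp add: c_def D_def algebra_simps)
    finally show ?thesis .
  qed
  have "(\<integral>\<^sup>+ r. ennreal (exp (e0 * \<bar>W r\<bar> powr q) * r powr (e0 - 1)) * indicator {0<..R} r \<partial>halfline)
    \<le> (\<integral>\<^sup>+ r. (\<Sum>n. ?t n r) \<partial>halfline)"
    by (rule nn_integral_mono) (rule pt)
  also have "\<dots> = (\<Sum>n. \<integral>\<^sup>+ r. ?t n r \<partial>halfline)"
    unfolding I1_def I2_def by (intro nn_integral_suminf borel_measurable_times_ennreal borel_measurable_add borel_measurable_const meas)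
  also have "\<dots> = (\<Sum>n. ennreal (C * (5 * K + 4) * (real (Suc n) * exp (- e0) ^ n)))"
    unfolding summand ..
  also have "\<dots> = ennreal (C * (5 * K + 4) * (1 / (1 - exp (- e0))\<^sup>2))"
  proof (rule suminf_ennreal_eq)
    show "(\<lambda>n. C * (5 * K + 4) * (real (Suc n) * exp (- e0) ^ n)) sums (C * (5 * K + 4) * (1 / (1 - exp (- e0))\<^sup>2))"
      using e0 by (intro sums_mult geometric_deriv_sums) simp
    show "0 \<le> C * (5 * K + 4) * (real (Suc n) * exp (- e0) ^ n)" for n using C K by simp
  qed
  finally show ?thesis by (simp add: C_def)
qed

section \<open>The first-order inequality on the half-line\<close>

text \<open>
  The point \<open>m + 1\<close> lies between \<open>m\<close> and \<open>m + 1 + \<sigma>\<close>, so logarithmic convexity of \<open>Gamma\<close> extrapolates from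
  \<open>Gamma m\<close> and \<open>Gamma (m + 1)\<close> to a lower bound at \<open>m + 1 + \<sigma>\<close>.
\<close>

lemma Gamma_ge_fact_powr:
  assumes m: "1 \<le> m" and \<sigma>: "0 \<le> \<sigma>"
  shows "fact m * real m powr \<sigma> \<le> Gamma (real m + 1 + \<sigma>)"
proof -
  define t where "t = 1 / (1 + \<sigma>)"
  have t: "0 \<le> t" "t \<le> 1" "t * (1 + \<sigma>) = 1" using \<sigma> by (auto simp: t_def)
  have m0: "0 < real m" using m by simp
  have pos: "0 < Gamma (real m)" "0 < Gamma (real m + 1 + \<sigma>)"
    using m0 \<sigma> by (auto intro!: Gamma_real_pos)
  have "(1 - t) * real m + t * (real m + 1 + \<sigma>) = real m + t * (1 + \<sigma>)" by (simp add: algebra_simps)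
  then have mid: "(1 - t) *\<^sub>R real m + t *\<^sub>R (real m + 1 + \<sigma>) = real m + 1" using t(3) by simp
  have "ln (Gamma (real m + 1)) \<le> (1 - t) * ln (Gamma (real m)) + t * ln (Gamma (real m + 1 + \<sigma>))"
    using convex_onD[OF log_convex_Gamma_real t(1,2), of "real m" "real m + 1 + \<sigma>"] m0 \<sigma> unfolding mid by simp
  then have "(1 + \<sigma>) * ln (Gamma (real m + 1))
      \<le> (1 + \<sigma>) * ((1 - t) * ln (Gamma (real m)) + t * ln (Gamma (real m + 1 + \<sigma>)))"
    using \<sigma> by (intro mult_left_mono) auto
  also have "\<dots> = (1 + \<sigma> - t * (1 + \<sigma>)) * ln (Gamma (real m)) + t * (1 + \<sigma>) * ln (Gamma (real m + 1 + \<sigma>))"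
    by (simp add: algebra_simps)
  finally have "(1 + \<sigma>) * ln (Gamma (real m + 1)) \<le> \<sigma> * ln (Gamma (real m)) + ln (Gamma (real m + 1 + \<sigma>))"
    unfolding t(3) by simp
  moreover have G1: "Gamma (real m + 1) = real m * Gamma (real m)"
    using m0 by (intro Gamma_plus1) (auto elim!: nonpos_Ints_cases)
  moreover have "ln (real m * Gamma (real m)) = ln (real m) + ln (Gamma (real m))"
    using m0 pos(1) by (subst ln_mult_pos) auto
  ultimately have "ln (Gamma (real m + 1)) + \<sigma> * ln (real m) \<le> ln (Gamma (real m + 1 + \<sigma>))"
    by (simp add: algebra_simps)
  moreover have "ln (Gamma (real m + 1) * real m powr \<sigma>) = ln (Gamma (real m + 1)) + \<sigma> * ln (real m)"
    using m0 Gamma_real_pos[of "real m + 1"] by (subst ln_mult_pos) (auto simp: ln_powr)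
  ultimately have "ln (Gamma (real m + 1) * real m powr \<sigma>) \<le> ln (Gamma (real m + 1 + \<sigma>))" by simp
  then have "Gamma (real m + 1) * real m powr \<sigma> \<le> Gamma (real m + 1 + \<sigma>)"
    using m0 pos by (subst (asm) ln_le_cancel_iff) (auto simp: G1)
  then show ?thesis using Gamma_fact[of m, where 'a = real] by (simp add: add.commute)
qed

text \<open>
  Comparison of the series of \<open>exp_p\<close>, whose exponents are not integers, with two shifted copies of the
  exponential series.
\<close>

lemma exp_p_term_bound:
  fixes p t :: real
  assumes p: "2 \<le> p" and t: "0 \<le> t"
  defines "n \<equiv> nat \<lfloor>p - 1\<rfloor>"
  shows "t powr (p - 1 + real j) / Gamma (p + real j)
    \<le> t ^ (j + n) / fact (j + n) + 2 * (t ^ (j + (n + 1)) / fact (j + (n + 1)))"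
proof (cases "t = 0")
  case False
  then have t0: "0 < t" using t by simp
  define m where "m = j + n"
  define \<sigma> where "\<sigma> = p - 1 - real n"
  have n: "1 \<le> n" "real n \<le> p - 1" "p - 1 < real n + 1" using p by (auto simp: n_def le_nat_iff)
  then have \<sigma>: "0 \<le> \<sigma>" "\<sigma> \<le> 1" and m: "1 \<le> m" by (auto simp: \<sigma>_def m_def)
  have m0: "0 < real m" using m by simp
  have "t powr (p - 1 + real j) = t powr (real m + \<sigma>)"
    by (rule arg_cong[where f = "\<lambda>x. t powr x"]) (simp add: m_def \<sigma>_def)
  also have "\<dots> = t ^ m * t powr \<sigma>" using t0 by (simp add: powr_add powr_realpow)
  finally have num: "t powr (p - 1 + real j) = t ^ m * t powr \<sigma>" .
  have "Gamma (p + real j) = Gamma (real m + 1 + \<sigma>)"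
    by (rule arg_cong[where f = Gamma]) (simp add: m_def \<sigma>_def)
  then have den: "fact m * real m powr \<sigma> \<le> Gamma (p + real j)" using Gamma_ge_fact_powr[OF m \<sigma>(1)] by simp
  have "t powr (p - 1 + real j) / Gamma (p + real j) \<le> t ^ m * t powr \<sigma> / (fact m * real m powr \<sigma>)"
    unfolding num using den m0 t0 by (intro divide_left_mono mult_pos_pos) (auto intro: less_le_trans[of 0 "fact m * real m powr \<sigma>"])
  also have "\<dots> = t ^ m / fact m * (t / real m) powr \<sigma>" using t0 m0 by (simp add: powr_divide)
  also have "\<dots> \<le> t ^ m / fact m * (1 + t / real m)"
  proof (intro mult_left_mono)
    show "(t / real m) powr \<sigma> \<le> 1 + t / real m"
    proof (cases "t / real m \<le> 1")
      case True
      then have "(t / real m) powr \<sigma> \<le> 1" using t0 m0 \<sigma> by (intro powr_le1) auto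
      moreover have "0 \<le> t / real m" using t0 m0 by simp
      ultimately show ?thesis by linarith
    next
      case False
      then have "(t / real m) powr \<sigma> \<le> (t / real m) powr 1" using \<sigma> by (intro powr_mono) auto
      then show ?thesis using False by simp
    qed
  qed (use t0 in simp)
  also have "\<dots> = t ^ m / fact m + t ^ (m + 1) / (real m * fact m)" using m0 by (simp add: field_simps)
  also have "t ^ (m + 1) / (real m * fact m) \<le> 2 * (t ^ (m + 1) / fact (m + 1))"
  proof -
    have "fact (m + 1) \<le> 2 * (real m * fact m)" using m by (simp add: algebra_simps)
    then have "t ^ (m + 1) / (real m * fact m) \<le> t ^ (m + 1) / (fact (m + 1) / 2)"
      using t0 m0 by (intro divide_left_mono) auto
    also have "t ^ (m + 1) / (fact (m + 1) / 2) = 2 * (t ^ (m + 1) / fact (m + 1))"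
      by (simp only: divide_divide_eq_right times_divide_eq_right mult.commute)
    finally show ?thesis .
  qed
  finally show ?thesis by (simp add: m_def add.assoc)
qed (use p in simp)

lemma
  fixes p t :: real
  assumes p: "2 \<le> p" and t: "0 \<le> t"
  shows exp_p_summable: "summable (\<lambda>j. t powr (p - 1 + real j) / Gamma (p + real j))"
    and exp_p_le_exp: "exp_p p t \<le> 3 * exp t"
proof -
  define n where "n = nat \<lfloor>p - 1\<rfloor>"
  let ?f = "\<lambda>j. t powr (p - 1 + real j) / Gamma (p + real j)"
  let ?e = "\<lambda>i. t ^ i / fact i"
  have e: "?e sums exp t" using exp_converges[of t] by (simp add: divide_inverse scaleR_conv_of_real mult.commute)
  have sh: "summable (\<lambda>j. ?e (j + i))" "(\<Sum>j. ?e (j + i)) \<le> exp t" for i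
  proof -
    show "summable (\<lambda>j. ?e (j + i))" using e by (simp add: sums_iff summable_iff_shift[of ?e])
    have "exp t = (\<Sum>j. ?e (j + i)) + sum ?e {..<i}"
      using suminf_split_initial_segment[OF sums_summable[OF e], of i] sums_unique[OF e] by simp
    moreover have "0 \<le> sum ?e {..<i}" using t by (intro sum_nonneg) auto
    ultimately show "(\<Sum>j. ?e (j + i)) \<le> exp t" by linarith
  qed
  have f0: "0 \<le> ?f j" for j using p by (intro divide_nonneg_nonneg less_imp_le[OF Gamma_real_pos]) auto
  let ?b = "\<lambda>j. ?e (j + n) + 2 * ?e (j + (n + 1))"
  have b: "summable ?b" by (intro summable_add summable_mult sh)
  have fb: "?f j \<le> ?b j" for j using exp_p_term_bound[OF p t, of j] by (simp add: n_def)
  show f: "summable ?f"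
  proof (rule summable_comparison_test'[OF b])
    show "norm (?f j) \<le> ?b j" for j using f0[of j] fb[of j] unfolding real_norm_def by linarith
  qed
  have "exp_p p t \<le> suminf ?b" unfolding exp_p_def by (rule suminf_le[OF fb f b])
  also have "\<dots> = (\<Sum>j. ?e (j + n)) + 2 * (\<Sum>j. ?e (j + (n + 1)))"
    unfolding suminf_mult[OF sh(1), symmetric]
    by (rule suminf_add[symmetric, OF sh(1) summable_mult[OF sh(1)]])
  also have "\<dots> \<le> exp t + 2 * exp t" by (intro add_mono mult_left_mono sh(2)) auto
  finally show "exp_p p t \<le> 3 * exp t" by simp
qed

text \<open>
  The leading power \<open>t^(p-1)\<close> factors out of the series, and the remaining power series increases with
  \<open>t\<close>.
\<close>

lemma exp_p_le_powr:
  fixes p t T :: real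
  assumes p: "2 \<le> p" and t: "0 \<le> t" "t \<le> T" and T: "0 < T"
  shows "exp_p p t \<le> t powr (p - 1) * (3 * exp T / T powr (p - 1))"
proof -
  have G: "0 \<le> Gamma (p + real j)" for j using p by (intro less_imp_le[OF Gamma_real_pos]) auto
  have "exp_p p t \<le> (\<Sum>j. (t / T) powr (p - 1) * (T powr (p - 1 + real j) / Gamma (p + real j)))"
    unfolding exp_p_def
  proof (rule suminf_le[OF _ exp_p_summable[OF p t(1)] summable_mult[OF exp_p_summable[OF p]]])
    show "0 \<le> T" using T by simp
    fix j
    have "t powr (p - 1 + real j) \<le> (t / T) powr (p - 1) * T powr (p - 1 + real j)"
    proof (cases "t = 0")
      case False
      then have "t powr real j \<le> T powr real j" using t by (intro powr_mono2) auto
      then have "t powr (p - 1) * t powr real j \<le> t powr (p - 1) * T powr real j" by (intro mult_left_mono) auto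
      then show ?thesis using False t T by (simp add: powr_add powr_divide)
    qed simp
    then have "t powr (p - 1 + real j) / Gamma (p + real j)
        \<le> (t / T) powr (p - 1) * T powr (p - 1 + real j) / Gamma (p + real j)"
      by (rule divide_right_mono[OF _ G])
    then show "t powr (p - 1 + real j) / Gamma (p + real j)
        \<le> (t / T) powr (p - 1) * (T powr (p - 1 + real j) / Gamma (p + real j))" by simp
  qed
  also have "\<dots> = (t / T) powr (p - 1) * exp_p p T"
    unfolding exp_p_def using T by (intro suminf_mult exp_p_summable[OF p]) simp
  also have "\<dots> \<le> (t / T) powr (p - 1) * (3 * exp T)"
    using T by (intro mult_left_mono exp_p_le_exp[OF p]) auto
  also have "\<dots> = t powr (p - 1) * (3 * exp T / T powr (p - 1))" using t T by (simp add: powr_divide)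
  finally show ?thesis .
qed

text \<open>
  On a shell of logarithmic length \<open>1\<close> outside the unit ball, the weight \<open>r^\<eta>\<close> dominates \<open>1/r\<close>, so the minimum of \<open>|W|^p\<close>
  over the shell is at most the integral.
\<close>

lemma small_value_in_shell:
  assumes W: "continuous_on {0<..} W" and \<eta>: "- 1 \<le> \<eta>" and \<rho>: "1 \<le> \<rho>" and Y: "0 \<le> Y"
    and int: "(\<integral>\<^sup>+ r. ennreal (\<bar>W r\<bar> powr p * r powr \<eta>) \<partial>halfline) \<le> ennreal Y"
    and p: "0 < p"
  shows "\<exists>R\<in>{\<rho>..\<rho> * exp 1}. \<bar>W R\<bar> powr p \<le> Y"
proof -
  have "continuous_on {\<rho>..\<rho> * exp 1} (\<lambda>r. \<bar>W r\<bar>)"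
    using \<rho> by (intro continuous_intros continuous_on_subset[OF W]) auto
  moreover have "{\<rho>..\<rho> * exp 1} \<noteq> {}" using \<rho> by simp
  ultimately obtain R where R: "R \<in> {\<rho>..\<rho> * exp 1}" "\<And>t. t \<in> {\<rho>..\<rho> * exp 1} \<Longrightarrow> \<bar>W R\<bar> \<le> \<bar>W t\<bar>"
    using continuous_attains_inf[of "{\<rho>..\<rho> * exp 1}" "\<lambda>r. \<bar>W r\<bar>"] by auto
  let ?c = "\<bar>W R\<bar> powr p"
  have "((\<lambda>r. ?c * (1 / r)) has_integral ?c * (ln (\<rho> * exp 1) - ln \<rho>)) {\<rho>..\<rho> * exp 1}"
    using \<rho> by (intro has_integral_mult_right integral_inverse_Icc) auto
  then have "((\<lambda>r. ?c * (1 / r)) has_integral ?c) {\<rho>..\<rho> * exp 1}" using \<rho> by (simp add: ln_mult)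
  then have "ennreal ?c = (\<integral>\<^sup>+ r. ennreal (?c * (1 / r)) * indicator {\<rho>..\<rho> * exp 1} r \<partial>halfline)"
    using \<rho> by (intro nn_integral_halfline_Icc[symmetric]) auto
  also have "\<dots> \<le> (\<integral>\<^sup>+ r. ennreal (\<bar>W r\<bar> powr p * r powr \<eta>) \<partial>halfline)"
  proof (rule nn_integral_mono)
    fix r :: real
    show "ennreal (?c * (1 / r)) * indicator {\<rho>..\<rho> * exp 1} r \<le> ennreal (\<bar>W r\<bar> powr p * r powr \<eta>)"
    proof (cases "r \<in> {\<rho>..\<rho> * exp 1}")
      case True
      then have r: "1 \<le> r" using \<rho> by simp
      have "1 / r = r powr (- 1)" using r by (simp add: powr_minus_divide)
      also have "\<dots> \<le> r powr \<eta>" using r \<eta> by (intro powr_mono) auto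
      finally have "?c * (1 / r) \<le> \<bar>W r\<bar> powr p * r powr \<eta>"
        using R(2)[OF True] r p by (intro mult_mono powr_mono2) auto
      then show ?thesis using True by (simp add: ennreal_leI)
    qed simp
  qed
  also note int
  finally have "?c \<le> Y" using Y by simp
  then show ?thesis using R(1) by blast
qed

lemma first_order_inequality:
  fixes p \<eta> \<tau> :: real
  assumes p: "2 \<le> p" and \<eta>: "- 1 < \<eta>" and \<tau>: "0 < \<tau>"
  shows "\<exists>C>0. \<forall>W W'. primitive_of W W' \<longrightarrow> Lp_log p (\<lambda>r. r * W' r) \<longrightarrow>
    ennreal (log_energy p (\<lambda>r. r * W' r)) + ennreal \<tau> * (\<integral>\<^sup>+ r. ennreal (\<bar>W r\<bar> powr p * r powr \<eta>) \<partial>halfline) \<le> 1 \<longrightarrow>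
    (\<integral>\<^sup>+ r. ennreal (exp_p p ((\<eta> + 1) * \<bar>W r\<bar> powr (p / (p - 1))) * r powr \<eta>) \<partial>halfline) \<le> ennreal C"
proof -
  define e0 q K L M T where "e0 = \<eta> + 1" and "q = p / (p - 1)" and "K = 2 powr p * (p - 1)"
    and "L = (1 / \<tau>) powr (1 / (p - 1))" and "M = (1 / \<tau>) powr (1 / p) + 1" and "T = e0 * M powr q"
  define B where "B = exp (e0 * L) * exp 1 powr e0 * ((5 * K + 4) / (1 - exp (- e0))\<^sup>2)"
  define D where "D = e0 powr (p - 1) * (3 * exp T / T powr (p - 1))"
  have p1: "1 < p" using p by simp
  have e0: "0 < e0" using \<eta> by (simp add: e0_def)
  have q: "0 < q" "q * (p - 1) = p" using p by (auto simp: q_def)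
  have M: "1 \<le> M" by (simp add: M_def)
  have T: "0 < T" using e0 M by (simp add: T_def)
  have K: "0 < K" using p by (simp add: K_def)
  have L: "0 < L" "L powr (p - 1) = 1 / \<tau>" using \<tau> p by (auto simp: L_def powr_powr)
  have D0: "0 \<le> D" by (simp add: D_def)
  have B0: "0 \<le> B" using K by (simp add: B_def)
  show ?thesis
  proof (intro exI[of _ "3 * B + D * (1 / \<tau>) + 1"] conjI allI impI)
    show "0 < 3 * B + D * (1 / \<tau>) + 1" using B0 D0 \<tau> by (simp add: add_nonneg_pos)
    fix W W' assume W: "primitive_of W W'" and E: "Lp_log p (\<lambda>r. r * W' r)"
      and total: "ennreal (log_energy p (\<lambda>r. r * W' r)) + ennreal \<tau> * (\<integral>\<^sup>+ r. ennreal (\<bar>W r\<bar> powr p * r powr \<eta>) \<partial>halfline) \<le> 1"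
    let ?N = "log_energy p (\<lambda>r. r * W' r)" and ?X = "\<integral>\<^sup>+ r. ennreal (\<bar>W r\<bar> powr p * r powr \<eta>) \<partial>halfline"
    have cW: "continuous_on {0<..} W" by (rule primitive_of_continuous[OF W order_refl])
    have [measurable]: "W \<in> borel_measurable halfline"
      by (rule continuous_imp_measurable_on_sets_lebesgue[OF cW]) simp
    have N0: "0 \<le> ?N" unfolding log_energy_def
      by (rule integral_nonneg) (use E in \<open>auto simp: Lp_log_def\<close>)
    have "?X \<noteq> top"
    proof
      assume "?X = top"
      then have "ennreal \<tau> * ?X = top" using \<tau> by (simp add: ennreal_mult_top)
      then show False using total by (simp add: top_unique)
    qed
    then obtain Y where Y: "0 \<le> Y" "?X = ennreal Y" by (cases ?X) auto
    have tot: "?N + \<tau> * Y \<le> 1"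
    proof -
      have "ennreal (?N + \<tau> * Y) \<le> ennreal 1"
        using total N0 Y \<tau> by (simp add: ennreal_mult)
      then show ?thesis by (subst (asm) ennreal_le_iff) auto
    qed
    have Y1: "Y \<le> 1 / \<tau>" using tot N0 \<tau> by (simp add: field_simps)
    have shell: "\<exists>R\<in>{\<rho>..\<rho> * exp 1}. \<bar>W R\<bar> powr p \<le> Y" if "1 \<le> \<rho>" for \<rho>
      using small_value_in_shell[OF cW _ that Y(1), of \<eta> p] Y(2) \<eta> p by simp
    obtain R where R: "1 \<le> R" "R \<le> exp 1" "\<bar>W R\<bar> powr p \<le> Y" using shell[of 1] by auto
    have near: "(\<integral>\<^sup>+ r. ennreal (exp (e0 * \<bar>W r\<bar> powr q) * r powr (e0 - 1)) * indicator {0<..R} r \<partial>halfline) \<le> ennreal B"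
    proof -
      have "(\<integral>\<^sup>+ r. ennreal (exp (e0 * \<bar>W r\<bar> powr q) * r powr (e0 - 1)) * indicator {0<..R} r \<partial>halfline)
          \<le> ennreal (exp (e0 * L) * R powr e0 * ((5 * K + 4) / (1 - exp (- e0))\<^sup>2))"
        unfolding q_def K_def
      proof (rule moser_near_0[OF p e0 W E _ L(1)])
        show "\<bar>W R\<bar> powr p \<le> L powr (p - 1) * (\<tau> * Y)" using R(3) L(2) \<tau> by simp
      qed (use R tot Y \<tau> in auto)
      also have "\<dots> \<le> ennreal B"
        unfolding B_def using R K e0 by (intro ennreal_leI mult_right_mono mult_left_mono powr_mono2) auto
      finally show ?thesis .
    qed
    \<comment> \<open>a good point in the shell starting at \<open>r\<close>, plus an increment of energy and logarithmic length at most \<open>1\<close>\<close>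
    have bdd: "\<bar>W r\<bar> \<le> M" if r: "1 \<le> r" for r
    proof -
      obtain R' where R': "r \<le> R'" "R' \<le> r * exp 1" "\<bar>W R'\<bar> powr p \<le> Y" using shell[OF r] by auto
      have "ln R' \<le> ln (r * exp 1)" using R' r by (subst ln_le_cancel_iff) auto
      then have l: "0 \<le> ln R' - ln r" "ln R' - ln r \<le> 1" using r R' by (auto simp: ln_mult)
      let ?En = "integral {r..R'} (\<lambda>r. \<bar>r * W' r\<bar> powr p / r)"
      have En: "0 \<le> ?En" using r by (intro integral_nonneg Lp_log_Icc(1)[OF E]) auto
      have "?En \<le> ?N" using r by (intro Lp_log_Icc(2)[OF E]) auto
      then have En1: "?En \<le> 1" using tot Y \<tau> by (smt (verit) mult_nonneg_nonneg)
      have "\<bar>W R' - W r\<bar> powr p \<le> (ln R' - ln r) powr (p - 1) * ?En"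
        using log_holder[OF p1 W E _ R'(1)] r by simp
      also have "\<dots> \<le> 1 * 1" using l En En1 p by (intro mult_mono powr_le1) auto
      finally have "(\<bar>W R' - W r\<bar> powr p) powr (1 / p) \<le> 1 powr (1 / p)" using p by (intro powr_mono2) auto
      then have 1: "\<bar>W R' - W r\<bar> \<le> 1" using p by (simp add: powr_powr)
      have "(\<bar>W R'\<bar> powr p) powr (1 / p) \<le> (1 / \<tau>) powr (1 / p)" using R'(3) Y1 p by (intro powr_mono2) auto
      then have "\<bar>W R'\<bar> \<le> (1 / \<tau>) powr (1 / p)" using p by (simp add: powr_powr)
      then show ?thesis using 1 unfolding M_def by linarith
    qed
    have pt: "ennreal (exp_p p (e0 * \<bar>W r\<bar> powr q) * r powr \<eta>)
      \<le> ennreal 3 * (ennreal (exp (e0 * \<bar>W r\<bar> powr q) * r powr (e0 - 1)) * indicator {0<..R} r)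
        + ennreal D * ennreal (\<bar>W r\<bar> powr p * r powr \<eta>)" if "r \<in> space halfline" for r
    proof (cases "r \<le> R")
      case True
      have "exp_p p (e0 * \<bar>W r\<bar> powr q) \<le> 3 * exp (e0 * \<bar>W r\<bar> powr q)"
        using e0 by (intro exp_p_le_exp[OF p]) auto
      then have "exp_p p (e0 * \<bar>W r\<bar> powr q) * r powr \<eta> \<le> 3 * (exp (e0 * \<bar>W r\<bar> powr q) * r powr (e0 - 1))"
        by (simp add: e0_def mult_right_mono flip: mult.assoc)
      then have "ennreal (exp_p p (e0 * \<bar>W r\<bar> powr q) * r powr \<eta>) \<le> ennreal 3 * ennreal (exp (e0 * \<bar>W r\<bar> powr q) * r powr (e0 - 1))"
        by (subst ennreal_mult[symmetric]) (auto intro: ennreal_leI)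
      then show ?thesis using True that by (auto intro: add_increasing2)
    next
      case False
      then have r: "1 \<le> r" using R by simp
      have "e0 * \<bar>W r\<bar> powr q \<le> T" unfolding T_def using bdd[OF r] e0 q by (intro mult_left_mono powr_mono2) auto
      then have "exp_p p (e0 * \<bar>W r\<bar> powr q) \<le> (e0 * \<bar>W r\<bar> powr q) powr (p - 1) * (3 * exp T / T powr (p - 1))"
        using e0 by (intro exp_p_le_powr[OF p _ _ T]) auto
      also have "\<dots> = D * \<bar>W r\<bar> powr p" using e0 q by (simp add: D_def powr_mult powr_powr)
      finally have "exp_p p (e0 * \<bar>W r\<bar> powr q) * r powr \<eta> \<le> D * \<bar>W r\<bar> powr p * r powr \<eta>" by (intro mult_right_mono) auto
      then have "ennreal (exp_p p (e0 * \<bar>W r\<bar> powr q) * r powr \<eta>) \<le> ennreal D * ennreal (\<bar>W r\<bar> powr p * r powr \<eta>)"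
        using D0 by (subst ennreal_mult[symmetric]) (auto intro!: ennreal_leI simp: mult.assoc)
      then show ?thesis by (auto intro: add_increasing)
    qed
    have "(\<integral>\<^sup>+ r. ennreal (exp_p p (e0 * \<bar>W r\<bar> powr q) * r powr \<eta>) \<partial>halfline)
      \<le> (\<integral>\<^sup>+ r. ennreal 3 * (ennreal (exp (e0 * \<bar>W r\<bar> powr q) * r powr (e0 - 1)) * indicator {0<..R} r)
        + ennreal D * ennreal (\<bar>W r\<bar> powr p * r powr \<eta>) \<partial>halfline)"
      by (rule nn_integral_mono) (rule pt)
    also have "\<dots> = ennreal 3 * (\<integral>\<^sup>+ r. ennreal (exp (e0 * \<bar>W r\<bar> powr q) * r powr (e0 - 1)) * indicator {0<..R} r \<partial>halfline)
        + ennreal D * ?X"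
      by (subst nn_integral_add, measurable, subst nn_integral_cmult, measurable, subst nn_integral_cmult, measurable)
    also have "\<dots> \<le> ennreal 3 * ennreal B + ennreal D * ennreal (1 / \<tau>)"
      using Y Y1 by (intro add_mono mult_left_mono near) (auto intro: ennreal_leI)
    also have "\<dots> = ennreal (3 * B + D * (1 / \<tau>))"
    proof -
      have "ennreal a * ennreal b + ennreal c * ennreal d = ennreal (a * b + c * d)"
        if "0 \<le> a" "0 \<le> b" "0 \<le> c" "0 \<le> d" for a b c d
        using that by (simp add: ennreal_mult)
      from this[of 3 B D "1 / \<tau>"] show ?thesis using B0 D0 \<tau> by (simp only:) simp
    qed
    also have "\<dots> \<le> ennreal (3 * B + D * (1 / \<tau>) + 1)" by (intro ennreal_leI) simp
    finally show "(\<integral>\<^sup>+ r. ennreal (exp_p p ((\<eta> + 1) * \<bar>W r\<bar> powr (p / (p - 1))) * r powr \<eta>) \<partial>halfline)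
        \<le> ennreal (3 * B + D * (1 / \<tau>) + 1)" by (simp only: e0_def q_def)
  qed
qed

section \<open>The Adams inequality of order \<open>k\<close>\<close>

theorem corollary1p2:
  fixes k :: nat and p \<eta> \<gamma> \<theta> \<nu> :: real and \<alpha> :: "nat \<Rightarrow> real"
  assumes "k \<ge> 1" and "p \<ge> 2" and "\<eta> > - 1"
    and "\<alpha> k - real k * p + 1 = 0"
    and "\<And>i. 1 \<le> i \<Longrightarrow> i \<le> k \<Longrightarrow> \<alpha> i \<ge> \<alpha> k - (real k - real i) * p"
    and "\<gamma> = (2 * p - 1 + (p - 1) * \<eta>) / p"
    and "\<theta> + 2 > \<gamma>"
    and "\<theta> > real (k div 2) * (\<theta> + 2 - \<gamma>) - 1"
    and "\<nu> = \<alpha> k + real (k div 2) * (\<theta> - \<gamma>) * p"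
  shows "\<forall>\<tau>>0. \<exists>C>0.
    (SUP u \<in> {u \<in> X_space k p \<alpha>.
                epowr (Lp_norm p \<nu> (L_grad \<theta> \<gamma> k u)) p + ennreal \<tau> * epowr (Lp_norm p \<eta> u) p \<le> 1}.
       \<integral>\<^sup>+ r. ennreal (exp_p p (beta0 k p \<eta> \<theta> \<gamma> * \<bar>u r\<bar> powr (p / (p - 1))) * r powr \<eta>) \<partial>halfline)
    \<le> ennreal C"
proof (intro allI impI)
  fix \<tau> :: real assume \<tau>: "0 < \<tau>"
  have p: "1 < p" "0 < p" "p \<noteq> 0" using assms(2) by auto
  have \<alpha>k: "\<alpha> k = real k * p - 1" using assms(4) by simp
  have \<alpha>: "real i * p - 1 \<le> \<alpha> i" if "1 \<le> i" "i \<le> k" for i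
    using assms(5)[OF that] by (simp add: \<alpha>k algebra_simps)
  define d where "d = \<theta> + 2 - \<gamma>"
  have d: "0 < d" using assms(7) by (simp add: d_def)
  have "\<gamma> - 1 = (p - 1) * (1 + \<eta>) / p" unfolding assms(6) using p by (simp add: field_simps)
  then have \<gamma>: "1 < \<gamma>" using p assms(3) by (smt (verit) divide_pos_pos mult_pos_pos)
  have pos: "0 < \<gamma> - 1 + d - real (k div 2) * d" using assms(8) by (simp add: d_def)
  define A where "A = rellich_const \<gamma> d k"
  have A: "0 < A" unfolding A_def by (rule rellich_const_pos[OF assms(1) d pos])
  have beta: "beta0 k p \<eta> \<theta> \<gamma> = (\<eta> + 1) * A powr (p / (p - 1))"
    unfolding A_def d_def
    by (rule beta0_eq_rellich_const[OF assms(1) _ \<gamma>]) (use d pos in \<open>simp_all add: d_def\<close>)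
  have Ap: "0 < A powr p" using A by simp
  have "0 < \<tau> / A powr p" using \<tau> Ap by simp
  from first_order_inequality[OF assms(2,3) this] obtain C where C: "0 < C" and bound: "\<And>W W'. primitive_of W W' \<Longrightarrow> Lp_log p (\<lambda>r. r * W' r) \<Longrightarrow>
    ennreal (log_energy p (\<lambda>r. r * W' r)) + ennreal (\<tau> / A powr p) * (\<integral>\<^sup>+ r. ennreal (\<bar>W r\<bar> powr p * r powr \<eta>) \<partial>halfline) \<le> 1 \<Longrightarrow>
    (\<integral>\<^sup>+ r. ennreal (exp_p p ((\<eta> + 1) * \<bar>W r\<bar> powr (p / (p - 1))) * r powr \<eta>) \<partial>halfline) \<le> ennreal C"
    by blast
  \<comment> \<open>\<open>\<nu>\<close> is the weight that turns the norm of the highest derivative into the energy for \<open>dr/r\<close>\<close>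
  have \<nu>: "(- (real (k div 2) * d) - of_bool (odd k)) * p + \<nu> = - 1"
  proof -
    have "real k = 2 * real (k div 2) + of_bool (odd k)" by (cases "even k") (auto elim!: evenE oddE)
    then show ?thesis unfolding assms(9) \<alpha>k d_def by (simp add: algebra_simps)
  qed
  show "\<exists>C>0. (SUP u \<in> {u \<in> X_space k p \<alpha>.
                epowr (Lp_norm p \<nu> (L_grad \<theta> \<gamma> k u)) p + ennreal \<tau> * epowr (Lp_norm p \<eta> u) p \<le> 1}.
       \<integral>\<^sup>+ r. ennreal (exp_p p (beta0 k p \<eta> \<theta> \<gamma> * \<bar>u r\<bar> powr (p / (p - 1))) * r powr \<eta>) \<partial>halfline)
    \<le> ennreal C"
  proof (intro exI[of _ C] conjI C SUP_least)
    fix u assume "u \<in> {u \<in> X_space k p \<alpha>.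
                epowr (Lp_norm p \<nu> (L_grad \<theta> \<gamma> k u)) p + ennreal \<tau> * epowr (Lp_norm p \<eta> u) p \<le> 1}"
    then have u: "u \<in> X_space k p \<alpha>"
      and total: "epowr (Lp_norm p \<nu> (L_grad \<theta> \<gamma> k u)) p + ennreal \<tau> * epowr (Lp_norm p \<eta> u) p \<le> 1" by auto
    obtain U V where UV: "primitive_of U V" and uU: "AE r in halfline. u r = U r"
      and reg: "log_regular p (k - 1) (\<lambda>r. r powr 1 * V r)"
      using X_space_imp_log_regular[OF p(1) assms(1) \<alpha>k \<alpha> u] by blast
    have "AE r in halfline. weak_deriv u r = r powr (- 1) * (r powr 1 * V r)"
      by (rule lebesgue_on_mono[OF weak_deriv_primitive_AE[OF UV uU]])
        (simp add: mult.assoc[symmetric] powr_add[symmetric])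
    from L_grad_log_energy[OF p(1) assms(1) reg this] obtain h where h: "Lp_log p h"
      "AE r in halfline. L_grad \<theta> \<gamma> k u r = r powr (- (real (k div 2) * d) - of_bool (odd k)) * h r"
      "\<bar>A\<bar> powr p * log_energy p (\<lambda>r. r powr 1 * V r) \<le> log_energy p h"
      unfolding A_def d_def by blast
    have grad: "epowr (Lp_norm p \<nu> (L_grad \<theta> \<gamma> k u)) p = ennreal (log_energy p h)"
    proof -
      have "epowr (Lp_norm p \<nu> (L_grad \<theta> \<gamma> k u)) p = (\<integral>\<^sup>+ r. ennreal (\<bar>L_grad \<theta> \<gamma> k u r\<bar> powr p * r powr \<nu>) \<partial>halfline)"
        by (rule epowr_Lp_norm[OF p(2)])
      also have "\<dots> = (\<integral>\<^sup>+ r. ennreal (\<bar>h r\<bar> powr p / r) \<partial>halfline)"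
      proof (rule nn_integral_cong_AE, rule lebesgue_on_mono[OF h(2)])
        fix r :: real
        assume eq: "L_grad \<theta> \<gamma> k u r = r powr (- (real (k div 2) * d) - of_bool (odd k)) * h r" and "r \<in> {0<..}"
        then have r: "0 < r" by simp
        have "\<bar>L_grad \<theta> \<gamma> k u r\<bar> powr p * r powr \<nu>
          = \<bar>h r\<bar> powr p * r powr ((- (real (k div 2) * d) - of_bool (odd k)) * p + \<nu>)"
          unfolding eq powr_add by (simp add: abs_mult powr_mult powr_powr)
        then show "ennreal (\<bar>L_grad \<theta> \<gamma> k u r\<bar> powr p * r powr \<nu>) = ennreal (\<bar>h r\<bar> powr p / r)"
          unfolding \<nu> using r by (simp add: powr_minus_divide)
      qed
      also have "\<dots> = ennreal (log_energy p h)"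
        unfolding log_energy_def using h(1) by (intro nn_integral_halfline_eq) (auto simp: Lp_log_def)
      finally show ?thesis .
    qed
    have eqV: "A * (r powr 1 * V r) = r * (A * V r)" if "0 < r" for r using that by simp
    have LpV: "Lp_log p (\<lambda>r. A * (r powr 1 * V r))"
      using Lp_log_lincomb[OF p(2) log_regular_Lp_log[OF reg] log_regular_Lp_log[OF reg], of A 0] by simp
    have Lp: "Lp_log p (\<lambda>r. r * (A * V r))" by (rule Lp_log_cong(1)[OF LpV eqV])
    have en: "log_energy p (\<lambda>r. r * (A * V r)) \<le> log_energy p h"
    proof -
      have "log_energy p (\<lambda>r. r * (A * V r)) = log_energy p (\<lambda>r. A * (r powr 1 * V r))"
        by (rule Lp_log_cong(2)[OF LpV eqV])
      also have "\<dots> = \<bar>A\<bar> powr p * log_energy p (\<lambda>r. r powr 1 * V r)"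
        unfolding log_energy_def by (simp add: abs_mult powr_mult flip: integral_mult_right)
      also note h(3)
      finally show ?thesis .
    qed
    have XU: "(\<integral>\<^sup>+ r. ennreal (\<bar>A * U r\<bar> powr p * r powr \<eta>) \<partial>halfline) = ennreal (A powr p) * epowr (Lp_norm p \<eta> u) p"
    proof -
      have cU: "continuous_on {0<..} U" by (rule primitive_of_continuous[OF UV order_refl])
      have [measurable]: "U \<in> borel_measurable halfline"
        by (rule continuous_imp_measurable_on_sets_lebesgue[OF cU]) simp
      have "epowr (Lp_norm p \<eta> u) p = (\<integral>\<^sup>+ r. ennreal (\<bar>u r\<bar> powr p * r powr \<eta>) \<partial>halfline)"
        by (rule epowr_Lp_norm[OF p(2)])
      also have "\<dots> = (\<integral>\<^sup>+ r. ennreal (\<bar>U r\<bar> powr p * r powr \<eta>) \<partial>halfline)"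
        by (rule nn_integral_cong_AE) (use uU in eventually_elim, simp)
      finally have "ennreal (A powr p) * epowr (Lp_norm p \<eta> u) p
          = (\<integral>\<^sup>+ r. ennreal (A powr p) * ennreal (\<bar>U r\<bar> powr p * r powr \<eta>) \<partial>halfline)"
        by (simp add: nn_integral_cmult)
      also have "\<dots> = (\<integral>\<^sup>+ r. ennreal (\<bar>A * U r\<bar> powr p * r powr \<eta>) \<partial>halfline)"
        using A by (intro nn_integral_cong) (simp add: ennreal_mult[symmetric] abs_mult powr_mult mult.assoc)
      finally show ?thesis by simp
    qed
    have "ennreal (log_energy p (\<lambda>r. r * (A * V r)))
        + ennreal (\<tau> / A powr p) * (\<integral>\<^sup>+ r. ennreal (\<bar>A * U r\<bar> powr p * r powr \<eta>) \<partial>halfline)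
      \<le> epowr (Lp_norm p \<nu> (L_grad \<theta> \<gamma> k u)) p + ennreal \<tau> * epowr (Lp_norm p \<eta> u) p"
    proof (rule add_mono)
      show "ennreal (log_energy p (\<lambda>r. r * (A * V r))) \<le> epowr (Lp_norm p \<nu> (L_grad \<theta> \<gamma> k u)) p"
        unfolding grad by (rule ennreal_leI[OF en])
      have "ennreal (\<tau> / A powr p) * ennreal (A powr p) = ennreal \<tau>"
        using \<tau> Ap by (subst ennreal_mult[symmetric]) auto
      then show "ennreal (\<tau> / A powr p) * (\<integral>\<^sup>+ r. ennreal (\<bar>A * U r\<bar> powr p * r powr \<eta>) \<partial>halfline)
          \<le> ennreal \<tau> * epowr (Lp_norm p \<eta> u) p"
        unfolding XU by (simp add: mult.assoc[symmetric])
    qed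
    also note total
    finally have "(\<integral>\<^sup>+ r. ennreal (exp_p p ((\<eta> + 1) * \<bar>A * U r\<bar> powr (p / (p - 1))) * r powr \<eta>) \<partial>halfline) \<le> ennreal C"
      by (rule bound[OF primitive_of_cmult[OF UV] Lp])
    moreover have "(\<integral>\<^sup>+ r. ennreal (exp_p p (beta0 k p \<eta> \<theta> \<gamma> * \<bar>u r\<bar> powr (p / (p - 1))) * r powr \<eta>) \<partial>halfline)
      = (\<integral>\<^sup>+ r. ennreal (exp_p p ((\<eta> + 1) * \<bar>A * U r\<bar> powr (p / (p - 1))) * r powr \<eta>) \<partial>halfline)"
    proof (rule nn_integral_cong_AE)
      show "AE r in halfline. ennreal (exp_p p (beta0 k p \<eta> \<theta> \<gamma> * \<bar>u r\<bar> powr (p / (p - 1))) * r powr \<eta>)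
         = ennreal (exp_p p ((\<eta> + 1) * \<bar>A * U r\<bar> powr (p / (p - 1))) * r powr \<eta>)"
        using uU
      proof eventually_elim
        case (elim r)
        have "beta0 k p \<eta> \<theta> \<gamma> * \<bar>u r\<bar> powr (p / (p - 1)) = (\<eta> + 1) * \<bar>A * U r\<bar> powr (p / (p - 1))"
          unfolding beta elim using A by (simp add: abs_mult powr_mult)
        then show ?case by simp
      qed
    qed
    ultimately show "(\<integral>\<^sup>+ r. ennreal (exp_p p (beta0 k p \<eta> \<theta> \<gamma> * \<bar>u r\<bar> powr (p / (p - 1))) * r powr \<eta>) \<partial>halfline) \<le> ennreal C"
      by simp
  qed
qed

end
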